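(* Let $\kappa$ and $\lambda$ be infinite cardinals such that $\kappa>2^{\lambda}$ is completely characterizable, $\lambda$ is characterizable by a dense linear ordering, and $\lambda$ is the least cardinal $\mu$ with $\kappa^{\mu}>\kappa$. Then $\kappa^{\lambda}$ is completely characterizable.
   Context: All languages are countable. An infinite cardinal $\kappa$ is completely characterizable if there is a countable structure whose Scott sentence (a complete $\mathcal{L}_{\omega_1,\omega}$-sentence) has a model of cardinality $\kappa$ but none of cardinality $\kappa^+$. $\lambda$ is characterizable by a dense linear ordering if there is a countable structure $\mathcal{M}$ in a language containing a binary symbol $<$, with $<^{\mathcal{M}}$ a dense linear ordering without endpoints (on $\mathcal{M}$ or a subset of it), such that the Scott sentence of $\mathcal{M}$ has no model of cardinality $\lambda^+$ and has a model $\mathcal{N}$ in which the set linearly ordered by $<^{\mathcal{N}}$ has cardinality $\lambda$. *)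

theory Defs
  imports Main
begin

unbundle cardinal_syntax

text \<open>
  A symbol is a pair (name, arity); constants are function symbols of arity 0. As names are
  natural numbers, every language of this type is countable, and every countable language is of
  this form up to renaming of symbols.
\<close>

record lang =
  funs :: "(nat \<times> nat) set"
  rels :: "(nat \<times> nat) set"

text \<open>
  The length of the argument list tells apart symbols that share a name. The values of the
  interpretations outside the symbols of the language, or on tuples that leave the universe, are
  irrelevant.
\<close>

record 'a struct =
  univ :: "'a set"
  fint :: "nat \<Rightarrow> 'a list \<Rightarrow> 'a"
  rint :: "nat \<Rightarrow> 'a list \<Rightarrow> bool"

definition is_struct :: "lang \<Rightarrow> 'a struct \<Rightarrow> bool" where
  "is_struct L M \<longleftrightarrow> univ M \<noteq> {} \<and>
     (\<forall>(f, n) \<in> funs L. \<forall>xs. length xs = n \<and> set xs \<subseteq> univ M \<longrightarrow> fint M f xs \<in> univ M)"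

definition isomorphic :: "lang \<Rightarrow> 'a struct \<Rightarrow> 'b struct \<Rightarrow> bool" where
  "isomorphic L M N \<longleftrightarrow> (\<exists>h. bij_betw h (univ M) (univ N) \<and>
     (\<forall>(f, n) \<in> funs L. \<forall>xs. length xs = n \<and> set xs \<subseteq> univ M \<longrightarrow>
        h (fint M f xs) = fint N f (map h xs)) \<and>
     (\<forall>(R, n) \<in> rels L. \<forall>xs. length xs = n \<and> set xs \<subseteq> univ M \<longrightarrow>
        rint M R xs = rint N R (map h xs)))"

datatype tm = Var nat | App nat "tm list"

text \<open>
  Formulas of \<open>L\<^sub>\<omega>\<^sub>1\<^sub>\<omega>\<close>. A family indexed by the natural numbers may repeat members, so
  \<open>Conj\<close> covers conjunctions of all nonempty finite or countable sets of formulas.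
  Disjunctions and existential quantifiers are obtained by duality.
\<close>

datatype fm =
    Eq tm tm
  | Rel nat "tm list"
  | Neg fm
  | Conj "nat \<Rightarrow> fm"
  | All nat fm

fun wf_tm :: "lang \<Rightarrow> tm \<Rightarrow> bool" where
  "wf_tm L (Var x) = True"
| "wf_tm L (App f ts) = ((f, length ts) \<in> funs L \<and> (\<forall>t \<in> set ts. wf_tm L t))"

fun vars_tm :: "tm \<Rightarrow> nat set" where
  "vars_tm (Var x) = {x}"
| "vars_tm (App f ts) = (\<Union>t \<in> set ts. vars_tm t)"

fun eval_tm :: "'a struct \<Rightarrow> tm \<Rightarrow> (nat \<Rightarrow> 'a) \<Rightarrow> 'a" where
  "eval_tm M (Var x) e = e x"
| "eval_tm M (App f ts) e = fint M f (map (\<lambda>t. eval_tm M t e) ts)"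

primrec wf_fm :: "lang \<Rightarrow> fm \<Rightarrow> bool" where
  "wf_fm L (Eq s t) = (wf_tm L s \<and> wf_tm L t)"
| "wf_fm L (Rel R ts) = ((R, length ts) \<in> rels L \<and> (\<forall>t \<in> set ts. wf_tm L t))"
| "wf_fm L (Neg \<phi>) = wf_fm L \<phi>"
| "wf_fm L (Conj \<Phi>) = (\<forall>i. wf_fm L (\<Phi> i))"
| "wf_fm L (All x \<phi>) = wf_fm L \<phi>"

primrec free_vars :: "fm \<Rightarrow> nat set" where
  "free_vars (Eq s t) = vars_tm s \<union> vars_tm t"
| "free_vars (Rel R ts) = (\<Union>t \<in> set ts. vars_tm t)"
| "free_vars (Neg \<phi>) = free_vars \<phi>"
| "free_vars (Conj \<Phi>) = (\<Union>i. free_vars (\<Phi> i))"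
| "free_vars (All x \<phi>) = free_vars \<phi> - {x}"

primrec sat :: "'a struct \<Rightarrow> fm \<Rightarrow> (nat \<Rightarrow> 'a) \<Rightarrow> bool" where
  "sat M (Eq s t) e = (eval_tm M s e = eval_tm M t e)"
| "sat M (Rel R ts) e = rint M R (map (\<lambda>t. eval_tm M t e) ts)"
| "sat M (Neg \<phi>) e = (\<not> sat M \<phi> e)"
| "sat M (Conj \<Phi>) e = (\<forall>i. sat M (\<Phi> i) e)"
| "sat M (All x \<phi>) e = (\<forall>a \<in> univ M. sat M \<phi> (e(x := a)))"

text \<open>
  Subformulas of sentences have only finitely many free variables, so the usual restriction to
  formulas with finitely many free variables need not be imposed.
\<close>

definition is_sentence :: "lang \<Rightarrow> fm \<Rightarrow> bool" where
  "is_sentence L \<phi> \<longleftrightarrow> wf_fm L \<phi> \<and> free_vars \<phi> = {}"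

definition models :: "'a struct \<Rightarrow> fm \<Rightarrow> bool" where
  "models M \<phi> \<longleftrightarrow> (\<forall>e. range e \<subseteq> univ M \<longrightarrow> sat M \<phi> e)"

text \<open>
  A Scott sentence of a countable structure characterizes it up to isomorphism among the
  countable structures; it is unique up to logical equivalence. Every countable structure has a
  copy with universe a set of natural numbers, so structures of type \<open>nat struct\<close> represent all
  of them.
\<close>

definition scott_sentence :: "lang \<Rightarrow> nat struct \<Rightarrow> fm \<Rightarrow> bool" where
  "scott_sentence L M \<phi> \<longleftrightarrow> is_sentence L \<phi> \<and>
     (\<forall>N :: nat struct. is_struct L N \<longrightarrow> (models N \<phi> \<longleftrightarrow> isomorphic L M N))"

text \<open>
  A model of cardinality \<open>r\<close> can be copied to a subset of the field of \<open>r\<close>, so looking only at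
  structures over the type underlying \<open>r\<close> is no restriction.
\<close>

definition has_model_of_card :: "lang \<Rightarrow> fm \<Rightarrow> 'a rel \<Rightarrow> bool" where
  "has_model_of_card L \<phi> r \<longleftrightarrow>
     (\<exists>M :: 'a struct. is_struct L M \<and> models M \<phi> \<and> |univ M| =o r)"

definition completely_characterizable :: "'a rel \<Rightarrow> bool" where
  "completely_characterizable \<kappa> \<longleftrightarrow> Cinfinite \<kappa> \<and>
     (\<exists>L M \<phi>. is_struct L M \<and> scott_sentence L M \<phi> \<and>
        has_model_of_card L \<phi> \<kappa> \<and> \<not> has_model_of_card L \<phi> (cardSuc \<kappa>))"

definition sym_rel :: "'a struct \<Rightarrow> nat \<Rightarrow> 'a rel" where
  "sym_rel M p = {(x, y). x \<in> univ M \<and> y \<in> univ M \<and> rint M p [x, y]}"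

definition dense_linear_order_no_endpoints :: "'a set \<Rightarrow> 'a rel \<Rightarrow> bool" where
  "dense_linear_order_no_endpoints D r \<longleftrightarrow>
     D \<noteq> {} \<and> r \<subseteq> D \<times> D \<and> strict_linear_order_on D r \<and>
     (\<forall>x y. (x, y) \<in> r \<longrightarrow> (\<exists>z. (x, z) \<in> r \<and> (z, y) \<in> r)) \<and>
     (\<forall>x \<in> D. (\<exists>y. (y, x) \<in> r) \<and> (\<exists>y. (x, y) \<in> r))"

text \<open>
  The order may live on a proper subset of the universe. In the absence of endpoints, the set it
  orders is exactly the field of the relation, which is how that set is identified in \<open>N\<close>.
  The \<open>'n itself\<close> argument names the type over which \<open>N\<close> is sought: the requirement on \<open>N\<close>
  concerns the cardinality of the ordered set and not that of the universe.
\<close>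

definition characterizable_by_dlo :: "'n itself \<Rightarrow> 'l rel \<Rightarrow> bool" where
  "characterizable_by_dlo T lam \<longleftrightarrow>
     (\<exists>L p M \<phi>. (p, 2) \<in> rels L \<and> is_struct L M \<and> scott_sentence L M \<phi> \<and>
        (\<exists>D \<subseteq> univ M. dense_linear_order_no_endpoints D (sym_rel M p)) \<and>
        \<not> has_model_of_card L \<phi> (cardSuc lam) \<and>
        (\<exists>N :: 'n struct. is_struct L N \<and> models N \<phi> \<and> |Field (sym_rel N p)| =o lam))"

text \<open>
  \<open>\<mu>\<close> ranges over the relations on the type underlying \<open>lam\<close>: a cardinal that
  cannot be represented there exceeds \<open>lam\<close> anyway.
\<close>

definition least_exponent_exceeding :: "'l rel \<Rightarrow> 'k rel \<Rightarrow> bool" where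
  "least_exponent_exceeding lam \<kappa> \<longleftrightarrow>
     \<kappa> <o \<kappa> ^c lam \<and>
     (\<forall>\<mu> :: 'l rel. Card_order \<mu> \<and> \<kappa> <o \<kappa> ^c \<mu> \<longrightarrow> lam \<le>o \<mu>)"

end

(* A countable structure M and a structure N satisfy the same sentences of the infinitary logic iff
   there is a back-and-forth system between them, and by the downward Lowenheim-Skolem theorem
   every model of a Scott sentence of M is back-and-forth equivalent to M. So everything can be done
   with back-and-forth systems.

   Let A and B be models witnessing that kappa and lambda are characterizable. Add to the disjoint
   union of A and B a set F whose ordered pairs of distinct elements carry a color d in B and a color
   c in A, such that no distinct x, y, z satisfy d x y = d x z = d y z and c x y = c x z.
   Functions f, g from B to A, with d f g a point where they differ and c f g the value of g at this
   point, form such a coloring. Conversely, follow for each f in F the branch of a ramification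
   tree: along it the colors d are pairwise distinct, so f is coded by a partial function from B
   to A and a well-ordering of its domain. Hence |F| <= kappa^lambda in every model.
   As the forbidden triangles can be avoided in free amalgams (two new points receive a fresh
   color), there are generic colorings, both countable and of cardinality kappa^lambda, and
   genericity makes the combined structures back-and-forth equivalent. *)

theory Submission
  imports Defs "HOL-Library.Countable_Set" "HOL-Library.Nat_Bijection"
begin

text \<open>The forbidden triangle says: if \<open>b\<close> is the color \<open>d\<close> of all
  three pairs of \<open>x\<close>, \<open>y\<close>, \<open>z\<close>, then \<open>c x y\<close> and
  \<open>c x z\<close> differ. For functions this is trivial, since \<open>y\<close> and
  \<open>z\<close> differ at \<open>b\<close>. Abstractly it is what keeps branches short: if
  \<open>x\<close> precedes \<open>y\<close> on the branch of \<open>f\<close>, then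
  \<open>y\<close> and \<open>f\<close> have the same colors over \<open>x\<close>, so
  \<open>d x f = d y f\<close> would complete a forbidden triangle. A branch thus has at most lambda
  nodes, and as kappa is infinite, the number of codes is at most 2^(lambda * lambda) times
  kappa^lambda, that is kappa^lambda. In the construction, size and genericity compete. To have
  kappa^lambda points, pairs without prescribed colors need a color where two codes differ; to keep
  triangles away from the prescriptions, this color must avoid finitely many prescribed ones.
  Repeating every color infinitely often turns one difference of codes into infinitely many and
  resolves the conflict. In an arbitrary model, the sorts and the graphs of functions are visible in
  the language, so both parts are recovered up to back-and-forth equivalence, and the bounds kappa
  and lambda apply to them.\<close>

section \<open>Dependence of satisfaction on the free variables\<close>

lemma eval_tm_cong:
  "(\<And>v. v \<in> vars_tm t \<Longrightarrow> e v = e' v) \<Longrightarrow> eval_tm M t e = eval_tm M t e'"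
proof (induction t)
  case (App f ts)
  then have "map (\<lambda>t. eval_tm M t e) ts = map (\<lambda>t. eval_tm M t e') ts" by auto
  then show ?case by (simp only: eval_tm.simps)
qed simp

lemma sat_cong:
  "(\<And>v. v \<in> free_vars \<phi> \<Longrightarrow> e v = e' v) \<Longrightarrow> sat M \<phi> e = sat M \<phi> e'"
proof (induction \<phi> arbitrary: e e')
  case (Eq s t)
  then show ?case using eval_tm_cong[of s e e' M] eval_tm_cong[of t e e' M] by simp
next
  case (Rel R ts)
  then have "map (\<lambda>t. eval_tm M t e) ts = map (\<lambda>t. eval_tm M t e') ts"
    by (intro map_cong eval_tm_cong) auto
  then show ?case by (simp only: sat.simps)
next
  case (Neg \<phi>)
  then show ?case by (metis free_vars.simps(3) sat.simps(3))
next
  case (Conj \<Phi>)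
  have "sat M (\<Phi> i) e = sat M (\<Phi> i) e'" for i
    by (rule Conj.IH) (use Conj.prems in auto)
  then show ?case by simp
next
  case (All x \<phi>)
  have "sat M \<phi> (e(x := a)) = sat M \<phi> (e'(x := a))" for a
    by (rule All.IH) (use All.prems in auto)
  then show ?case by simp
qed

lemma eval_tm_in_univ:
  assumes "is_struct L M" "wf_tm L t" "\<And>v. v \<in> vars_tm t \<Longrightarrow> e v \<in> univ M"
  shows "eval_tm M t e \<in> univ M"
  using assms(2,3)
proof (induction t)
  case (App f ts)
  have "set (map (\<lambda>t. eval_tm M t e) ts) \<subseteq> univ M"
    using App by auto
  moreover have "(f, length (map (\<lambda>t. eval_tm M t e) ts)) \<in> funs L"
    using App.prems(1) by simp
  ultimately show ?case
    using assms(1) unfolding is_struct_def eval_tm.simps by blast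
qed simp

text \<open>The truth value of a sentence ignores the assignment, so \<open>e\<close> may even leave
  the universe; a nonempty universe provides an assignment that \<open>models\<close> really
  tests.\<close>

lemma models_sentence_iff:
  assumes "is_struct L M" "is_sentence L \<phi>"
  shows "models M \<phi> \<longleftrightarrow> sat M \<phi> e"
proof -
  obtain a where "a \<in> univ M" using assms(1) unfolding is_struct_def by blast
  then have "range (\<lambda>_::nat. a) \<subseteq> univ M" by blast
  moreover have "sat M \<phi> e1 = sat M \<phi> e2" for e1 e2
    using assms(2) unfolding is_sentence_def by (intro sat_cong) auto
  ultimately show ?thesis unfolding models_def by blast
qed

section \<open>Back-and-forth systems\<close>

text \<open>
  Only unnested atomic formulas are compared, so that function symbols can be traded for their
  graphs; nested terms are taken care of by extending the tuples with the values of subterms.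
\<close>

definition same_atoms :: "lang \<Rightarrow> 'a struct \<Rightarrow> 'b struct \<Rightarrow> 'a list \<Rightarrow> 'b list \<Rightarrow> bool" where
  "same_atoms L M N xs ys \<longleftrightarrow>
     (\<forall>i < length xs. \<forall>j < length xs. xs ! i = xs ! j \<longleftrightarrow> ys ! i = ys ! j) \<and>
     (\<forall>f is i. (f, length is) \<in> funs L \<longrightarrow> set is \<subseteq> {..<length xs} \<longrightarrow> i < length xs \<longrightarrow>
        (xs ! i = fint M f (map ((!) xs) is) \<longleftrightarrow> ys ! i = fint N f (map ((!) ys) is))) \<and>
     (\<forall>R is. (R, length is) \<in> rels L \<longrightarrow> set is \<subseteq> {..<length xs} \<longrightarrow>
        (rint M R (map ((!) xs) is) \<longleftrightarrow> rint N R (map ((!) ys) is)))"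

definition bf_system :: "lang \<Rightarrow> 'a struct \<Rightarrow> 'b struct \<Rightarrow> ('a list \<times> 'b list) set \<Rightarrow> bool" where
  "bf_system L M N S \<longleftrightarrow> ([], []) \<in> S \<and>
     (\<forall>(xs, ys) \<in> S. length xs = length ys \<and> set xs \<subseteq> univ M \<and> set ys \<subseteq> univ N \<and>
        same_atoms L M N xs ys \<and>
        (\<forall>x \<in> univ M. \<exists>y \<in> univ N. (xs @ [x], ys @ [y]) \<in> S) \<and>
        (\<forall>y \<in> univ N. \<exists>x \<in> univ M. (xs @ [x], ys @ [y]) \<in> S))"

definition bf_equiv :: "lang \<Rightarrow> 'a struct \<Rightarrow> 'b struct \<Rightarrow> bool" where
  "bf_equiv L M N \<longleftrightarrow> (\<exists>S. bf_system L M N S)"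

lemma bf_systemD:
  assumes "bf_system L M N S" "(xs, ys) \<in> S"
  shows "length xs = length ys" "set xs \<subseteq> univ M" "set ys \<subseteq> univ N" "same_atoms L M N xs ys"
    "x \<in> univ M \<Longrightarrow> \<exists>y \<in> univ N. (xs @ [x], ys @ [y]) \<in> S"
    "y \<in> univ N \<Longrightarrow> \<exists>x \<in> univ M. (xs @ [x], ys @ [y]) \<in> S"
  using assms unfolding bf_system_def by blast+

lemma bf_system_nil: "bf_system L M N S \<Longrightarrow> ([], []) \<in> S"
  unfolding bf_system_def by blast

lemma bf_systemI:
  assumes "([], []) \<in> S"
    and "\<And>xs ys. (xs, ys) \<in> S \<Longrightarrow> length xs = length ys \<and> set xs \<subseteq> univ M \<and> set ys \<subseteq> univ N"
    and "\<And>xs ys. (xs, ys) \<in> S \<Longrightarrow> same_atoms L M N xs ys"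
    and "\<And>xs ys x. (xs, ys) \<in> S \<Longrightarrow> x \<in> univ M \<Longrightarrow> \<exists>y \<in> univ N. (xs @ [x], ys @ [y]) \<in> S"
    and "\<And>xs ys y. (xs, ys) \<in> S \<Longrightarrow> y \<in> univ N \<Longrightarrow> \<exists>x \<in> univ M. (xs @ [x], ys @ [y]) \<in> S"
  shows "bf_system L M N S"
  unfolding bf_system_def using assms by blast

lemma same_atoms_eqD:
  "same_atoms L M N xs ys \<Longrightarrow> i < length xs \<Longrightarrow> j < length xs \<Longrightarrow> xs ! i = xs ! j \<longleftrightarrow> ys ! i = ys ! j"
  unfolding same_atoms_def by blast

lemma same_atoms_funD:
  "same_atoms L M N xs ys \<Longrightarrow> (f, length is) \<in> funs L \<Longrightarrow> set is \<subseteq> {..<length xs} \<Longrightarrow> i < length xs \<Longrightarrow>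
   xs ! i = fint M f (map ((!) xs) is) \<longleftrightarrow> ys ! i = fint N f (map ((!) ys) is)"
  unfolding same_atoms_def by blast

lemma same_atoms_relD:
  "same_atoms L M N xs ys \<Longrightarrow> (R, length is) \<in> rels L \<Longrightarrow> set is \<subseteq> {..<length xs} \<Longrightarrow>
   rint M R (map ((!) xs) is) \<longleftrightarrow> rint N R (map ((!) ys) is)"
  unfolding same_atoms_def by blast

lemma same_atoms_sym:
  assumes "length xs = length ys" "same_atoms L M N xs ys"
  shows "same_atoms L N M ys xs"
  using assms unfolding same_atoms_def by simp

lemma same_atoms_trans:
  assumes "length xs = length ys" "same_atoms L M N xs ys" "same_atoms L N K ys zs"
  shows "same_atoms L M K xs zs"
  using assms unfolding same_atoms_def by simp

lemma bf_system_converse: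
  assumes "bf_system L M N S"
  shows "bf_system L N M (S\<inverse>)"
proof (rule bf_systemI, goal_cases)
  case 1
  show ?case using bf_system_nil[OF assms] by blast
next
  case (2 ys xs)
  then have xy: "(xs, ys) \<in> S" by simp
  show ?case using bf_systemD(1-3)[OF assms xy] by metis
next
  case (3 ys xs)
  then have xy: "(xs, ys) \<in> S" by simp
  show ?case by (rule same_atoms_sym[OF bf_systemD(1,4)[OF assms xy]])
next
  case (4 ys xs y)
  then have xy: "(xs, ys) \<in> S" by simp
  show ?case using bf_systemD(6)[OF assms xy 4(2)] by blast
next
  case (5 ys xs x)
  then have xy: "(xs, ys) \<in> S" by simp
  show ?case using bf_systemD(5)[OF assms xy 5(2)] by blast
qed

lemma bf_equiv_sym: "bf_equiv L M N \<Longrightarrow> bf_equiv L N M"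
  unfolding bf_equiv_def using bf_system_converse by blast

lemma bf_equiv_trans:
  assumes "bf_equiv L M N" "bf_equiv L N K"
  shows "bf_equiv L M K"
proof -
  obtain S T where S: "bf_system L M N S" and T: "bf_system L N K T"
    using assms unfolding bf_equiv_def by blast
  have "bf_system L M K (S O T)"
  proof (rule bf_systemI, goal_cases)
    case 1
    show ?case using bf_system_nil[OF S] bf_system_nil[OF T] by blast
  next
    case (2 xs zs)
    then obtain ys where ys: "(xs, ys) \<in> S" "(ys, zs) \<in> T" by blast
    show ?case using bf_systemD(1,2)[OF S ys(1)] bf_systemD(1,3)[OF T ys(2)] by metis
  next
    case (3 xs zs)
    then obtain ys where ys: "(xs, ys) \<in> S" "(ys, zs) \<in> T" by blast
    show ?case
      by (rule same_atoms_trans[OF bf_systemD(1)[OF S ys(1)] bf_systemD(4)[OF S ys(1)]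
            bf_systemD(4)[OF T ys(2)]])
  next
    case (4 xs zs x)
    then obtain ys where ys: "(xs, ys) \<in> S" "(ys, zs) \<in> T" by blast
    obtain y where y: "y \<in> univ N" "(xs @ [x], ys @ [y]) \<in> S"
      using bf_systemD(5)[OF S ys(1) 4(2)] by blast
    show ?case using bf_systemD(5)[OF T ys(2) y(1)] y(2) by blast
  next
    case (5 xs zs z)
    then obtain ys where ys: "(xs, ys) \<in> S" "(ys, zs) \<in> T" by blast
    obtain y where y: "y \<in> univ N" "(ys @ [y], zs @ [z]) \<in> T"
      using bf_systemD(6)[OF T ys(2) 5(2)] by blast
    show ?case using bf_systemD(6)[OF S ys(1) y(1)] y(2) by blast
  qed
  then show ?thesis unfolding bf_equiv_def by blast
qed

lemma bf_system_forth_list: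
  assumes S: "bf_system L M N S" and "(xs, ys) \<in> S" "set us \<subseteq> univ M"
  shows "\<exists>vs. length vs = length us \<and> set vs \<subseteq> univ N \<and> (xs @ us, ys @ vs) \<in> S"
  using assms(3)
proof (induction us rule: rev_induct)
  case Nil
  then show ?case using assms(2) by simp
next
  case (snoc u us)
  then obtain vs where vs: "length vs = length us" "set vs \<subseteq> univ N" "(xs @ us, ys @ vs) \<in> S" by auto
  then obtain v where "v \<in> univ N" "((xs @ us) @ [u], (ys @ vs) @ [v]) \<in> S"
    using bf_systemD(5)[OF S vs(3), of u] snoc.prems by auto
  then show ?case using vs by (intro exI[of _ "vs @ [v]"]) auto
qed

lemma bf_system_back_list:
  assumes S: "bf_system L M N S" and "(xs, ys) \<in> S" "set vs \<subseteq> univ N"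
  shows "\<exists>us. length us = length vs \<and> set us \<subseteq> univ M \<and> (xs @ us, ys @ vs) \<in> S"
  using bf_system_forth_list[OF bf_system_converse[OF S], of ys xs vs] assms(2,3) by auto

lemma map_nth_append_upt:
  "map ((!) (xs @ us)) [length xs..<length xs + length us] = us"
  by (rule nth_equalityI) auto

lemma bf_system_eval_tm:
  assumes S: "bf_system L M N S" and M: "is_struct L M"
  shows "(xs, ys) \<in> S \<Longrightarrow> wf_tm L t \<Longrightarrow> \<forall>v \<in> vars_tm t. \<sigma> v < length xs \<Longrightarrow> i < length xs \<Longrightarrow>
    xs ! i = eval_tm M t (\<lambda>v. xs ! \<sigma> v) \<longleftrightarrow> ys ! i = eval_tm N t (\<lambda>v. ys ! \<sigma> v)"
proof (induction t arbitrary: xs ys i)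
  case (Var v)
  then show ?case using bf_systemD(4)[OF S Var.prems(1)] by (auto dest: same_atoms_eqD)
next
  case (App f ts)
  note D = bf_systemD[OF S App.prems(1)]
  define us where "us = map (\<lambda>t. eval_tm M t (\<lambda>v. xs ! \<sigma> v)) ts"
  have "set us \<subseteq> univ M"
  proof -
    have "eval_tm M t (\<lambda>v. xs ! \<sigma> v) \<in> univ M" if "t \<in> set ts" for t
    proof (rule eval_tm_in_univ[OF M])
      show "wf_tm L t" using App.prems(2) that by simp
      show "xs ! \<sigma> v \<in> univ M" if v: "v \<in> vars_tm t" for v
        using App.prems(3) v \<open>t \<in> set ts\<close> D(2) nth_mem[of "\<sigma> v" xs] by auto
    qed
    then show ?thesis unfolding us_def by auto
  qed
  then obtain vs where vs: "length vs = length us" "(xs @ us, ys @ vs) \<in> S"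
    using bf_system_forth_list[OF S App.prems(1)] by blast
  note D' = bf_systemD[OF S vs(2)]
  \<comment> \<open>The answers to the argument values are forced: the induction hypothesis for the
    \<open>k\<close>-th argument, at position \<open>length xs + k\<close> of the extended tuples,
    says that \<open>vs ! k\<close> is the value of that argument in \<open>N\<close>.\<close>
  have vs_eq: "vs = map (\<lambda>t. eval_tm N t (\<lambda>v. ys ! \<sigma> v)) ts"
  proof (rule nth_equalityI)
    show "length vs = length (map (\<lambda>t. eval_tm N t (\<lambda>v. ys ! \<sigma> v)) ts)"
      using vs(1) us_def by simp
    fix k assume k: "k < length vs"
    then have k': "k < length ts" using vs(1) us_def by simp
    have t: "ts ! k \<in> set ts" using k' by simp
    have lt: "\<sigma> v < length xs" if "v \<in> vars_tm (ts ! k)" for v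
      using App.prems(3) t that by auto
    have "(xs @ us) ! (length xs + k) = eval_tm M (ts ! k) (\<lambda>v. (xs @ us) ! \<sigma> v) \<longleftrightarrow>
          (ys @ vs) ! (length xs + k) = eval_tm N (ts ! k) (\<lambda>v. (ys @ vs) ! \<sigma> v)"
    proof (rule App.IH[OF t vs(2)])
      show "wf_tm L (ts ! k)" using App.prems(2) t by simp
      show "\<forall>v\<in>vars_tm (ts ! k). \<sigma> v < length (xs @ us)" using lt by fastforce
      show "length xs + k < length (xs @ us)" using k' us_def by simp
    qed
    moreover have "eval_tm M (ts ! k) (\<lambda>v. (xs @ us) ! \<sigma> v) = eval_tm M (ts ! k) (\<lambda>v. xs ! \<sigma> v)"
      by (rule eval_tm_cong) (simp add: nth_append lt)
    moreover have "eval_tm N (ts ! k) (\<lambda>v. (ys @ vs) ! \<sigma> v) = eval_tm N (ts ! k) (\<lambda>v. ys ! \<sigma> v)"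
      by (rule eval_tm_cong) (use lt D(1) in \<open>simp add: nth_append\<close>)
    ultimately show "vs ! k = map (\<lambda>t. eval_tm N t (\<lambda>v. ys ! \<sigma> v)) ts ! k"
      using k' D(1) by (simp add: us_def nth_append)
  qed
  define js where "js = [length xs..<length xs + length us]"
  have M1: "map ((!) (xs @ us)) js = us" unfolding js_def by (rule map_nth_append_upt)
  have N1: "map ((!) (ys @ vs)) js = vs"
    using map_nth_append_upt[of ys vs] vs(1) D(1) unfolding js_def by simp
  have "(f, length js) \<in> funs L" using App.prems(2) unfolding js_def us_def by simp
  moreover have "set js \<subseteq> {..<length (xs @ us)}" unfolding js_def by auto
  moreover have "i < length (xs @ us)" using App.prems(4) by simp
  ultimately have "(xs @ us) ! i = fint M f us \<longleftrightarrow> (ys @ vs) ! i = fint N f vs"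
    using same_atoms_funD[OF D'(4), of f js i] M1 N1 by simp
  then show ?case
    using App.prems(4) D(1) vs_eq by (simp add: nth_append us_def)
qed

text \<open>\<open>\<sigma>\<close> sends variables to positions of the tuples. A quantifier appends
  its witness and redirects its variable to the new last position, so rebinding a variable does not
  disturb earlier entries.\<close>

lemma bf_system_sat:
  assumes S: "bf_system L M N S" and M: "is_struct L M"
  shows "(xs, ys) \<in> S \<Longrightarrow> wf_fm L \<phi> \<Longrightarrow> \<forall>v \<in> free_vars \<phi>. \<sigma> v < length xs \<Longrightarrow>
    sat M \<phi> (\<lambda>v. xs ! \<sigma> v) \<longleftrightarrow> sat N \<phi> (\<lambda>v. ys ! \<sigma> v)"
proof (induction \<phi> arbitrary: xs ys \<sigma>)
  case (Eq s t)
  note D = bf_systemD[OF S Eq.prems(1)]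
  have "eval_tm M s (\<lambda>v. xs ! \<sigma> v) \<in> univ M"
    using Eq.prems(2,3) D(2) nth_mem by (intro eval_tm_in_univ[OF M]) (auto simp: subset_iff)
  \<comment> \<open>An equation between two terms is not unnested. With the value of
    \<open>s\<close> as a new entry, each side is compared with that entry: for \<open>s\<close>
    this identifies \<open>y\<close> as the value of \<open>s\<close> in \<open>N\<close>, for
    \<open>t\<close> it transfers the equation.\<close>
  then obtain y where y: "(xs @ [eval_tm M s (\<lambda>v. xs ! \<sigma> v)], ys @ [y]) \<in> S"
    using D(5) by blast
  let ?xs = "xs @ [eval_tm M s (\<lambda>v. xs ! \<sigma> v)]" and ?ys = "ys @ [y]"
  have "eval_tm M s (\<lambda>v. xs ! \<sigma> v) = eval_tm M u (\<lambda>v. xs ! \<sigma> v) \<longleftrightarrow> y = eval_tm N u (\<lambda>v. ys ! \<sigma> v)"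
    if u: "wf_tm L u" "\<forall>v \<in> vars_tm u. \<sigma> v < length xs" for u
  proof -
    have "?xs ! length xs = eval_tm M u (\<lambda>v. ?xs ! \<sigma> v) \<longleftrightarrow>
        ?ys ! length xs = eval_tm N u (\<lambda>v. ?ys ! \<sigma> v)"
      by (rule bf_system_eval_tm[OF S M y]) (use u in \<open>auto simp: less_Suc_eq\<close>)
    moreover have "eval_tm M u (\<lambda>v. ?xs ! \<sigma> v) = eval_tm M u (\<lambda>v. xs ! \<sigma> v)"
      by (rule eval_tm_cong) (use u in \<open>simp add: nth_append\<close>)
    moreover have "eval_tm N u (\<lambda>v. ?ys ! \<sigma> v) = eval_tm N u (\<lambda>v. ys ! \<sigma> v)"
      by (rule eval_tm_cong) (use u D(1) in \<open>simp add: nth_append\<close>)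
    moreover have "?xs ! length xs = eval_tm M s (\<lambda>v. xs ! \<sigma> v)" by simp
    moreover have "?ys ! length xs = y" by (simp add: D(1))
    ultimately show ?thesis by metis
  qed
  from this[of s] this[of t] show ?case
    using Eq.prems(2,3) by simp
next
  case (Rel R ts)
  note D = bf_systemD[OF S Rel.prems(1)]
  have ts: "wf_tm L t" "\<forall>v \<in> vars_tm t. \<sigma> v < length xs" if "t \<in> set ts" for t
    using Rel.prems(2,3) that by auto
  define us where "us = map (\<lambda>t. eval_tm M t (\<lambda>v. xs ! \<sigma> v)) ts"
  have "eval_tm M t (\<lambda>v. xs ! \<sigma> v) \<in> univ M" if "t \<in> set ts" for t
    using ts[OF that] D(2) nth_mem by (intro eval_tm_in_univ[OF M]) (auto simp: subset_iff)
  then have "set us \<subseteq> univ M" unfolding us_def by auto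
  then obtain vs where vs: "length vs = length us" "(xs @ us, ys @ vs) \<in> S"
    using bf_system_forth_list[OF S Rel.prems(1)] by blast
  note D' = bf_systemD[OF S vs(2)]
  have vs_eq: "vs = map (\<lambda>t. eval_tm N t (\<lambda>v. ys ! \<sigma> v)) ts"
  proof (rule nth_equalityI)
    show "length vs = length (map (\<lambda>t. eval_tm N t (\<lambda>v. ys ! \<sigma> v)) ts)"
      using vs(1) us_def by simp
    fix k assume k: "k < length vs"
    then have k': "k < length ts" using vs(1) us_def by simp
    have t: "ts ! k \<in> set ts" using k' by simp
    have "(xs @ us) ! (length xs + k) = eval_tm M (ts ! k) (\<lambda>v. (xs @ us) ! \<sigma> v) \<longleftrightarrow>
          (ys @ vs) ! (length xs + k) = eval_tm N (ts ! k) (\<lambda>v. (ys @ vs) ! \<sigma> v)"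
      by (rule bf_system_eval_tm[OF S M vs(2)]) (use ts[OF t] k' us_def in auto)
    moreover have "eval_tm M (ts ! k) (\<lambda>v. (xs @ us) ! \<sigma> v) = eval_tm M (ts ! k) (\<lambda>v. xs ! \<sigma> v)"
      by (rule eval_tm_cong) (use ts[OF t] in \<open>simp add: nth_append\<close>)
    moreover have "eval_tm N (ts ! k) (\<lambda>v. (ys @ vs) ! \<sigma> v) = eval_tm N (ts ! k) (\<lambda>v. ys ! \<sigma> v)"
      by (rule eval_tm_cong) (use ts[OF t] D(1) in \<open>simp add: nth_append\<close>)
    ultimately show "vs ! k = map (\<lambda>t. eval_tm N t (\<lambda>v. ys ! \<sigma> v)) ts ! k"
      using k' D(1) by (simp add: us_def nth_append)
  qed
  define js where "js = [length xs..<length xs + length us]"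
  have M1: "map ((!) (xs @ us)) js = us" unfolding js_def by (rule map_nth_append_upt)
  have N1: "map ((!) (ys @ vs)) js = vs"
    using map_nth_append_upt[of ys vs] vs(1) D(1) unfolding js_def by simp
  have "(R, length js) \<in> rels L" using Rel.prems(2) unfolding js_def us_def by simp
  moreover have "set js \<subseteq> {..<length (xs @ us)}" unfolding js_def by auto
  ultimately have "rint M R us \<longleftrightarrow> rint N R vs"
    using same_atoms_relD[OF D'(4), of R js] M1 N1 by simp
  then show ?case using vs_eq by (simp add: us_def)
next
  case (Neg \<phi>)
  show ?case using Neg.IH[OF Neg.prems(1), of \<sigma>] Neg.prems(2,3) by simp
next
  case (Conj \<Phi>)
  have "sat M (\<Phi> i) (\<lambda>v. xs ! \<sigma> v) \<longleftrightarrow> sat N (\<Phi> i) (\<lambda>v. ys ! \<sigma> v)" for i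
    by (rule Conj.IH) (use Conj.prems in auto)
  then show ?case by simp
next
  case (All x \<phi>)
  note D = bf_systemD[OF S All.prems(1)]
  have eq: "sat M \<phi> ((\<lambda>v. xs ! \<sigma> v)(x := a)) \<longleftrightarrow> sat N \<phi> ((\<lambda>v. ys ! \<sigma> v)(x := b))"
    if ab: "(xs @ [a], ys @ [b]) \<in> S" for a b
  proof -
    let ?s = "\<sigma>(x := length xs)"
    have "sat M \<phi> (\<lambda>v. (xs @ [a]) ! ?s v) \<longleftrightarrow> sat N \<phi> (\<lambda>v. (ys @ [b]) ! ?s v)"
      by (rule All.IH[OF ab]) (use All.prems in \<open>auto simp: less_Suc_eq\<close>)
    moreover have "sat M \<phi> (\<lambda>v. (xs @ [a]) ! ?s v) = sat M \<phi> ((\<lambda>v. xs ! \<sigma> v)(x := a))"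
      by (rule sat_cong) (use All.prems(3) in \<open>auto simp: nth_append\<close>)
    moreover have "sat N \<phi> (\<lambda>v. (ys @ [b]) ! ?s v) = sat N \<phi> ((\<lambda>v. ys ! \<sigma> v)(x := b))"
      by (rule sat_cong) (use All.prems(3) D(1) in \<open>auto simp: nth_append\<close>)
    ultimately show ?thesis by simp
  qed
  show ?case using D(5,6) eq by (simp only: sat.simps) blast
qed

lemma bf_equiv_models:
  assumes "bf_equiv L M N" "is_struct L M" "is_struct L N" "is_sentence L \<phi>"
  shows "models M \<phi> \<longleftrightarrow> models N \<phi>"
proof -
  obtain S where S: "bf_system L M N S" using assms(1) unfolding bf_equiv_def by blast
  \<comment> \<open>The entries \<open>[] ! v\<close> are unspecified, but a sentence has no free
    variable for which they would be looked up.\<close>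
  have "sat M \<phi> (\<lambda>v. [] ! id v) \<longleftrightarrow> sat N \<phi> (\<lambda>v. [] ! id v)"
    by (rule bf_system_sat[OF S assms(2) bf_system_nil[OF S]])
      (use assms(4) in \<open>auto simp: is_sentence_def\<close>)
  then show ?thesis using models_sentence_iff assms by metis
qed

section \<open>Isomorphisms and copies of structures\<close>

lemma isomorphicE:
  assumes "isomorphic L M N"
  obtains h where "bij_betw h (univ M) (univ N)"
    and "\<And>f xs. (f, length xs) \<in> funs L \<Longrightarrow> set xs \<subseteq> univ M \<Longrightarrow>
        h (fint M f xs) = fint N f (map h xs)"
    and "\<And>R xs. (R, length xs) \<in> rels L \<Longrightarrow> set xs \<subseteq> univ M \<Longrightarrow>
        rint M R xs = rint N R (map h xs)"
proof -
  from assms obtain h where 1: "bij_betw h (univ M) (univ N)"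
    and 2: "\<forall>(f, n) \<in> funs L. \<forall>xs. length xs = n \<and> set xs \<subseteq> univ M \<longrightarrow>
        h (fint M f xs) = fint N f (map h xs)"
    and 3: "\<forall>(R, n) \<in> rels L. \<forall>xs. length xs = n \<and> set xs \<subseteq> univ M \<longrightarrow>
        rint M R xs = rint N R (map h xs)"
    unfolding isomorphic_def by (elim exE conjE)
  show ?thesis by (rule that[OF 1]) (use 2 3 in fast)+
qed

lemma isomorphicI:
  assumes "bij_betw h (univ M) (univ N)"
    and "\<And>f xs. (f, length xs) \<in> funs L \<Longrightarrow> set xs \<subseteq> univ M \<Longrightarrow>
        h (fint M f xs) = fint N f (map h xs)"
    and "\<And>R xs. (R, length xs) \<in> rels L \<Longrightarrow> set xs \<subseteq> univ M \<Longrightarrow>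
        rint M R xs = rint N R (map h xs)"
  shows "isomorphic L M N"
  unfolding isomorphic_def using assms by (intro exI[of _ h]) auto

lemma is_struct_fint:
  assumes "is_struct L M" "(f, length xs) \<in> funs L" "set xs \<subseteq> univ M"
  shows "fint M f xs \<in> univ M"
  using assms unfolding is_struct_def by fast

lemma is_structI:
  assumes "univ M \<noteq> {}"
    "\<And>f xs. (f, length xs) \<in> funs L \<Longrightarrow> set xs \<subseteq> univ M \<Longrightarrow> fint M f xs \<in> univ M"
  shows "is_struct L M"
  unfolding is_struct_def using assms by auto

lemma isomorphic_bf_equiv:
  assumes "isomorphic L M N" "is_struct L M"
  shows "bf_equiv L M N"
proof -
  obtain h where h: "bij_betw h (univ M) (univ N)"
    and hf: "\<And>f xs. (f, length xs) \<in> funs L \<Longrightarrow> set xs \<subseteq> univ M \<Longrightarrow>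
        h (fint M f xs) = fint N f (map h xs)"
    and hr: "\<And>R xs. (R, length xs) \<in> rels L \<Longrightarrow> set xs \<subseteq> univ M \<Longrightarrow>
        rint M R xs = rint N R (map h xs)"
    using isomorphicE[OF assms(1)] by metis
  have inj: "h x = h y \<longleftrightarrow> x = y" if "x \<in> univ M" "y \<in> univ M" for x y
    using h that unfolding bij_betw_def inj_on_def by blast
  let ?S = "{(xs, map h xs) |xs. set xs \<subseteq> univ M}"
  have "bf_system L M N ?S"
  proof (rule bf_systemI, goal_cases)
    case 1
    show ?case by simp
  next
    case (2 xs ys)
    then show ?case using h unfolding bij_betw_def by auto
  next
    case (3 xs ys)
    then have ys: "ys = map h xs" and xs: "set xs \<subseteq> univ M" by auto
    have nth: "xs ! i \<in> univ M" if "i < length xs" for i using xs that by auto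
    have sub: "set (map ((!) xs) is) \<subseteq> univ M" if "set is \<subseteq> {..<length xs}" for "is"
      using that nth by auto
    have mp: "map ((!) ys) is = map h (map ((!) xs) is)" if "set is \<subseteq> {..<length xs}" for "is"
      using that unfolding ys by auto
    have "xs ! i = fint M f (map ((!) xs) is) \<longleftrightarrow> ys ! i = fint N f (map ((!) ys) is)"
      if "(f, length is) \<in> funs L" "set is \<subseteq> {..<length xs}" "i < length xs" for f "is" i
    proof -
      have "fint M f (map ((!) xs) is) \<in> univ M"
        using that(1) by (intro is_struct_fint[OF assms(2) _ sub[OF that(2)]]) simp
      moreover have "h (fint M f (map ((!) xs) is)) = fint N f (map ((!) ys) is)"
        using hf[OF _ sub[OF that(2)], of f] that(1) unfolding mp[OF that(2)] by simp
      ultimately show ?thesis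
        using inj[OF nth[OF that(3)]] that(3) by (metis nth_map ys)
    qed
    moreover have "rint M R (map ((!) xs) is) \<longleftrightarrow> rint N R (map ((!) ys) is)"
      if "(R, length is) \<in> rels L" "set is \<subseteq> {..<length xs}" for R "is"
      using hr[OF _ sub[OF that(2)], of R] that(1) unfolding mp[OF that(2)] by simp
    ultimately show ?case
      unfolding same_atoms_def using inj nth ys by auto
  next
    case (4 xs ys x)
    then show ?case using h unfolding bij_betw_def by (intro bexI[of _ "h x"]) auto
  next
    case (5 xs ys y)
    then obtain x where "x \<in> univ M" "h x = y"
      using h 5(2) unfolding bij_betw_def by (metis imageE)
    then show ?case using 5 by (intro bexI[of _ x]) auto
  qed
  then show ?thesis unfolding bf_equiv_def by blast
qed

lemma isomorphic_models:
  assumes "isomorphic L M N" "is_struct L M" "is_struct L N" "is_sentence L \<phi>"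
  shows "models M \<phi> \<longleftrightarrow> models N \<phi>"
  using bf_equiv_models[OF isomorphic_bf_equiv[OF assms(1,2)] assms(2-4)] .

text \<open>\<open>scott_sentence\<close> and \<open>has_model_of_card\<close> see only structures
  over one prescribed type; this transports a structure there along any injection of its
  universe.\<close>

lemma isomorphic_copy:
  fixes M :: "'a struct" and h :: "'a \<Rightarrow> 'b"
  assumes "is_struct L M" "inj_on h (univ M)"
  shows "\<exists>N :: 'b struct. univ N = h ` univ M \<and> is_struct L N \<and> isomorphic L M N"
proof -
  define g where "g = the_inv_into (univ M) h"
  have gh: "g (h x) = x" if "x \<in> univ M" for x
    using that assms(2) unfolding g_def by (simp add: the_inv_into_f_f)
  then have mgh: "map (g \<circ> h) xs = xs" if "set xs \<subseteq> univ M" for xs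
    using that by (induction xs) auto
  define N where "N = \<lparr>univ = h ` univ M, fint = \<lambda>f ys. h (fint M f (map g ys)),
     rint = \<lambda>R ys. rint M R (map g ys)\<rparr>"
  have "isomorphic L M N"
    by (rule isomorphicI[of h]) (use assms(2) mgh in \<open>auto simp: bij_betw_def N_def\<close>)
  moreover have "is_struct L N"
  proof (rule is_structI)
    show "univ N \<noteq> {}" using assms(1) unfolding N_def is_struct_def by simp
    fix f ys assume f: "(f, length ys) \<in> funs L" and ys: "set ys \<subseteq> univ N"
    have "set (map g ys) \<subseteq> univ M" using ys gh by (auto simp: N_def)
    then have "fint M f (map g ys) \<in> univ M"
      using is_struct_fint[OF assms(1)] f by simp
    then show "fint N f ys \<in> univ N" by (simp add: N_def)
  qed
  ultimately show ?thesis by (intro exI[of _ N]) (simp add: N_def)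
qed

section \<open>Scott sentences\<close>

definition true_fm :: fm where
  "true_fm = All 0 (Eq (Var 0) (Var 0))"

text \<open>The inserted \<open>true_fm\<close> makes the enumerated set nonempty, so empty
  conjunctions need no special treatment.\<close>

definition conj_set :: "fm set \<Rightarrow> fm" where
  "conj_set X = Conj (from_nat_into (insert true_fm X))"

definition disj_set :: "fm set \<Rightarrow> fm" where
  "disj_set X = Neg (conj_set (Neg ` X))"

definition imp_fm :: "fm \<Rightarrow> fm \<Rightarrow> fm" where
  "imp_fm \<phi> \<psi> = disj_set {Neg \<phi>, \<psi>}"

definition ex_fm :: "nat \<Rightarrow> fm \<Rightarrow> fm" where
  "ex_fm x \<phi> = Neg (All x (Neg \<phi>))"

fun alls :: "nat \<Rightarrow> fm \<Rightarrow> fm" where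
  "alls 0 \<phi> = \<phi>"
| "alls (Suc n) \<phi> = alls n (All n \<phi>)"

lemma range_from_nat_into_insert:
  "countable X \<Longrightarrow> range (from_nat_into (insert a X)) = insert a X"
  by (intro range_from_nat_into) auto

lemma ball_from_nat_into_insert:
  assumes "countable X"
  shows "(\<forall>i. P (from_nat_into (insert a X) i)) \<longleftrightarrow> P a \<and> (\<forall>x \<in> X. P x)"
proof -
  have "(\<forall>i. P (from_nat_into (insert a X) i)) \<longleftrightarrow> (\<forall>x \<in> range (from_nat_into (insert a X)). P x)"
    by blast
  then show ?thesis by (simp add: range_from_nat_into_insert[OF assms])
qed

lemma true_fm_simps [simp]: "sat M true_fm e" "wf_fm L true_fm" "free_vars true_fm = {}"
  unfolding true_fm_def by auto

lemma sat_conj_set [simp]: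
  "countable X \<Longrightarrow> sat M (conj_set X) e \<longleftrightarrow> (\<forall>\<phi> \<in> X. sat M \<phi> e)"
  unfolding conj_set_def
  using ball_from_nat_into_insert[of X "\<lambda>\<phi>. sat M \<phi> e" true_fm] by simp

lemma wf_conj_set [simp]:
  "countable X \<Longrightarrow> wf_fm L (conj_set X) \<longleftrightarrow> (\<forall>\<phi> \<in> X. wf_fm L \<phi>)"
  unfolding conj_set_def
  using ball_from_nat_into_insert[of X "wf_fm L" true_fm] by simp

lemma free_vars_conj_set [simp]:
  assumes "countable X"
  shows "free_vars (conj_set X) = (\<Union>\<phi> \<in> X. free_vars \<phi>)"
proof -
  have "free_vars (conj_set X) = \<Union> (free_vars ` range (from_nat_into (insert true_fm X)))"
    unfolding conj_set_def by auto
  also have "\<dots> = (\<Union>\<phi> \<in> X. free_vars \<phi>)"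
    unfolding range_from_nat_into_insert[OF assms] by simp
  finally show ?thesis .
qed

lemma sat_disj_set [simp]:
  "countable X \<Longrightarrow> sat M (disj_set X) e \<longleftrightarrow> (\<exists>\<phi> \<in> X. sat M \<phi> e)"
  unfolding disj_set_def by simp

lemma wf_disj_set [simp]:
  "countable X \<Longrightarrow> wf_fm L (disj_set X) \<longleftrightarrow> (\<forall>\<phi> \<in> X. wf_fm L \<phi>)"
  unfolding disj_set_def by simp

lemma free_vars_disj_set [simp]:
  "countable X \<Longrightarrow> free_vars (disj_set X) = (\<Union>\<phi> \<in> X. free_vars \<phi>)"
  unfolding disj_set_def by simp

lemma imp_fm_simps [simp]:
  "sat M (imp_fm \<phi> \<psi>) e \<longleftrightarrow> (sat M \<phi> e \<longrightarrow> sat M \<psi> e)"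
  "wf_fm L (imp_fm \<phi> \<psi>) \<longleftrightarrow> wf_fm L \<phi> \<and> wf_fm L \<psi>"
  "free_vars (imp_fm \<phi> \<psi>) = free_vars \<phi> \<union> free_vars \<psi>"
  unfolding imp_fm_def by auto

lemma ex_fm_simps [simp]:
  "sat M (ex_fm x \<phi>) e \<longleftrightarrow> (\<exists>a \<in> univ M. sat M \<phi> (e(x := a)))"
  "wf_fm L (ex_fm x \<phi>) \<longleftrightarrow> wf_fm L \<phi>"
  "free_vars (ex_fm x \<phi>) = free_vars \<phi> - {x}"
  unfolding ex_fm_def by auto

lemma wf_alls [simp]: "wf_fm L (alls n \<phi>) \<longleftrightarrow> wf_fm L \<phi>"
  by (induction n arbitrary: \<phi>) auto

lemma free_vars_alls: "free_vars \<phi> \<subseteq> {..<n} \<Longrightarrow> free_vars (alls n \<phi>) = {}"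
proof (induction n arbitrary: \<phi>)
  case (Suc n)
  have "free_vars (All n \<phi>) \<subseteq> {..<n}" using Suc.prems by (auto simp: less_Suc_eq)
  then show ?case using Suc.IH by simp
qed simp

lemma sat_nth_append:
  assumes "free_vars \<phi> \<subseteq> {..length xs}"
  shows "sat M \<phi> (((!) xs)(length xs := a)) = sat M \<phi> ((!) (xs @ [a]))"
proof (rule sat_cong)
  fix v assume "v \<in> free_vars \<phi>"
  then have "v \<le> length xs" using assms by auto
  then show "(((!) xs)(length xs := a)) v = (xs @ [a]) ! v"
    by (auto simp: nth_append)
qed

text \<open>The largest variable is bound innermost, so each quantifier appends one entry at the end
  of the list that serves as assignment.\<close>

lemma sat_alls:
  assumes "free_vars \<phi> \<subseteq> {..<n}"
  shows "sat M (alls n \<phi>) e \<longleftrightarrow> (\<forall>xs. length xs = n \<and> set xs \<subseteq> univ M \<longrightarrow> sat M \<phi> ((!) xs))"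
  using assms
proof (induction n arbitrary: \<phi>)
  case 0
  have "sat M \<phi> e = sat M \<phi> ((!) [])" by (rule sat_cong) (use 0 in auto)
  then show ?case by simp
next
  case (Suc n)
  have fv: "free_vars (All n \<phi>) \<subseteq> {..<n}" using Suc.prems by (auto simp: less_Suc_eq)
  have eq: "sat M \<phi> (((!) xs)(n := a)) = sat M \<phi> ((!) (xs @ [a]))" if "length xs = n" for xs a
    using sat_nth_append[of \<phi> xs M a] Suc.prems that by (auto simp: lessThan_Suc_atMost)
  have "sat M (alls (Suc n) \<phi>) e \<longleftrightarrow>
     (\<forall>xs. length xs = n \<and> set xs \<subseteq> univ M \<longrightarrow> (\<forall>a \<in> univ M. sat M \<phi> ((!) (xs @ [a]))))"
    using Suc.IH[OF fv] eq by simp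
  also have "\<dots> \<longleftrightarrow> (\<forall>ys. length ys = Suc n \<and> set ys \<subseteq> univ M \<longrightarrow> sat M \<phi> ((!) ys))"
  proof (intro iffI allI impI ballI)
    fix ys
    assume *: "\<forall>xs. length xs = n \<and> set xs \<subseteq> univ M \<longrightarrow> (\<forall>a \<in> univ M. sat M \<phi> ((!) (xs @ [a])))"
      and ys: "length ys = Suc n \<and> set ys \<subseteq> univ M"
    then obtain xs a where "ys = xs @ [a]" "length xs = n" by (metis length_Suc_conv_rev)
    then show "sat M \<phi> ((!) ys)" using * ys by auto
  next
    fix xs a
    assume "\<forall>ys. length ys = Suc n \<and> set ys \<subseteq> univ M \<longrightarrow> sat M \<phi> ((!) ys)"
      "length xs = n \<and> set xs \<subseteq> univ M" "a \<in> univ M"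
    then show "sat M \<phi> ((!) (xs @ [a]))" by simp
  qed
  finally show ?case .
qed

definition same_type :: "lang \<Rightarrow> 'a struct \<Rightarrow> 'a list \<Rightarrow> 'a list \<Rightarrow> bool" where
  "same_type L M xs ys \<longleftrightarrow> (\<forall>\<phi>. wf_fm L \<phi> \<longrightarrow> free_vars \<phi> \<subseteq> {..<length xs} \<longrightarrow>
     sat M \<phi> ((!) xs) = sat M \<phi> ((!) ys))"

text \<open>
  As there are only countably many tuples in a countable structure, the conjunction of all chosen
  separators isolates the full type of a tuple. No Scott rank analysis is needed.
\<close>

definition separator :: "lang \<Rightarrow> 'a struct \<Rightarrow> 'a list \<Rightarrow> 'a list \<Rightarrow> fm" where
  "separator L M xs ys = (SOME \<phi>. wf_fm L \<phi> \<and> free_vars \<phi> \<subseteq> {..<length xs} \<and>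
     sat M \<phi> ((!) xs) \<and> \<not> sat M \<phi> ((!) ys))"

lemma separator:
  assumes "\<not> same_type L M xs ys"
  shows "wf_fm L (separator L M xs ys)" "free_vars (separator L M xs ys) \<subseteq> {..<length xs}"
    "sat M (separator L M xs ys) ((!) xs)" "\<not> sat M (separator L M xs ys) ((!) ys)"
proof -
  obtain \<phi> where \<phi>: "wf_fm L \<phi>" "free_vars \<phi> \<subseteq> {..<length xs}"
    "sat M \<phi> ((!) xs) \<noteq> sat M \<phi> ((!) ys)"
    using assms unfolding same_type_def by blast
  have "\<exists>\<psi>. wf_fm L \<psi> \<and> free_vars \<psi> \<subseteq> {..<length xs} \<and> sat M \<psi> ((!) xs) \<and> \<not> sat M \<psi> ((!) ys)"
  proof (cases "sat M \<phi> ((!) xs)")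
    case True
    then show ?thesis using \<phi> by (intro exI[of _ \<phi>]) simp
  next
    case False
    then show ?thesis using \<phi> by (intro exI[of _ "Neg \<phi>"]) simp
  qed
  from someI_ex[OF this] show "wf_fm L (separator L M xs ys)"
    "free_vars (separator L M xs ys) \<subseteq> {..<length xs}"
    "sat M (separator L M xs ys) ((!) xs)" "\<not> sat M (separator L M xs ys) ((!) ys)"
    unfolding separator_def by blast+
qed

definition tuples :: "'a struct \<Rightarrow> nat \<Rightarrow> 'a list set" where
  "tuples M n = {xs. length xs = n \<and> set xs \<subseteq> univ M}"

definition type_fm :: "lang \<Rightarrow> 'a struct \<Rightarrow> 'a list \<Rightarrow> fm" where
  "type_fm L M xs =
     conj_set (separator L M xs ` {ys \<in> tuples M (length xs). \<not> same_type L M xs ys})"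

lemma countable_tuples:
  fixes M :: "nat struct"
  shows "countable {ys \<in> tuples M n. P ys}"
  by simp

lemma type_fm:
  fixes M :: "nat struct"
  shows "wf_fm L (type_fm L M xs)" "free_vars (type_fm L M xs) \<subseteq> {..<length xs}"
    "sat M (type_fm L M xs) ((!) xs)"
    "ys \<in> tuples M (length xs) \<Longrightarrow> sat M (type_fm L M xs) ((!) ys) \<Longrightarrow> same_type L M xs ys"
proof -
  note S = separator[of L M xs] and C = countable_tuples[of M]
  show "wf_fm L (type_fm L M xs)" "free_vars (type_fm L M xs) \<subseteq> {..<length xs}"
    "sat M (type_fm L M xs) ((!) xs)"
    unfolding type_fm_def using S(1-3) C by auto
  show "same_type L M xs ys" if "ys \<in> tuples M (length xs)" "sat M (type_fm L M xs) ((!) ys)"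
    using that S(4)[of ys] C unfolding type_fm_def by auto
qed

lemma same_type_sym: "length xs = length ys \<Longrightarrow> same_type L M xs ys \<Longrightarrow> same_type L M ys xs"
  unfolding same_type_def by auto

text \<open>That some element extends the tuple to one satisfying
  \<open>type_fm L M (xs @ [x])\<close> is itself a formula true of \<open>xs\<close>, hence of
  \<open>ys\<close>; any witness has the right type because \<open>type_fm\<close> isolates types in
  \<open>M\<close>.\<close>

lemma same_type_extend:
  fixes M :: "nat struct"
  assumes "same_type L M xs ys" "length xs = length ys" "set xs \<subseteq> univ M" "set ys \<subseteq> univ M" "x \<in> univ M"
  shows "\<exists>y \<in> univ M. same_type L M (xs @ [x]) (ys @ [y])"
proof -
  let ?\<theta> = "type_fm L M (xs @ [x])"
  have fv: "free_vars ?\<theta> \<subseteq> {..length xs}"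
    using type_fm(2)[of L M "xs @ [x]"] by (simp add: lessThan_Suc_atMost)
  have "sat M (ex_fm (length xs) ?\<theta>) ((!) xs)"
    using sat_nth_append[OF fv] type_fm(3)[of M L "xs @ [x]"] assms(5) by auto
  moreover have "wf_fm L (ex_fm (length xs) ?\<theta>)" using type_fm(1) by simp
  moreover have "free_vars (ex_fm (length xs) ?\<theta>) \<subseteq> {..<length xs}"
    using fv by (auto simp: le_eq_less_or_eq)
  ultimately have "sat M (ex_fm (length xs) ?\<theta>) ((!) ys)"
    using assms(1) unfolding same_type_def by blast
  then obtain y where y: "y \<in> univ M" "sat M ?\<theta> (((!) ys)(length ys := y))"
    using assms(2) by auto
  then have "sat M ?\<theta> ((!) (ys @ [y]))" using sat_nth_append[of ?\<theta> ys M y] fv assms(2) by simp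
  then have "same_type L M (xs @ [x]) (ys @ [y])"
    using type_fm(4)[of "ys @ [y]" M "xs @ [x]" L] assms y(1) by (simp add: tuples_def)
  then show ?thesis using y(1) by blast
qed

definition atoms :: "lang \<Rightarrow> nat \<Rightarrow> fm set" where
  "atoms L n = {Eq (Var i) (Var j) |i j. i < n \<and> j < n} \<union>
     {Eq (Var i) (App f (map Var is)) |i f is. i < n \<and> set is \<subseteq> {..<n} \<and> (f, length is) \<in> funs L} \<union>
     {Rel R (map Var is) |R is. set is \<subseteq> {..<n} \<and> (R, length is) \<in> rels L}"

lemma countable_atoms: "countable (atoms L n)"
proof -
  have "atoms L n \<subseteq> (\<Union>i j. {Eq (Var i) (Var j)}) \<union>
      (\<Union>i f is. {Eq (Var i) (App f (map Var is))}) \<union> (\<Union>R is. {Rel R (map Var is)})"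
    unfolding atoms_def by auto
  moreover have "countable \<dots>" by (intro countable_Un countable_UN) auto
  ultimately show ?thesis by (rule countable_subset)
qed

lemma atoms_wf: "\<phi> \<in> atoms L n \<Longrightarrow> wf_fm L \<phi>" and atoms_free_vars: "\<phi> \<in> atoms L n \<Longrightarrow> free_vars \<phi> \<subseteq> {..<n}"
  unfolding atoms_def by auto

lemma same_atomsI:
  assumes "\<And>\<phi>. \<phi> \<in> atoms L (length xs) \<Longrightarrow> sat M \<phi> ((!) xs) = sat N \<phi> ((!) ys)"
  shows "same_atoms L M N xs ys"
proof -
  have "xs ! i = xs ! j \<longleftrightarrow> ys ! i = ys ! j" if "i < length xs" "j < length xs" for i j
    using assms[of "Eq (Var i) (Var j)"] that by (simp add: atoms_def)
  moreover have "xs ! i = fint M f (map ((!) xs) is) \<longleftrightarrow> ys ! i = fint N f (map ((!) ys) is)"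
    if "(f, length is) \<in> funs L" "set is \<subseteq> {..<length xs}" "i < length xs" for f "is" i
  proof -
    have "Eq (Var i) (App f (map Var is)) \<in> atoms L (length xs)"
      using that unfolding atoms_def by blast
    from assms[OF this] show ?thesis by (simp add: comp_def)
  qed
  moreover have "rint M R (map ((!) xs) is) \<longleftrightarrow> rint N R (map ((!) ys) is)"
    if "(R, length is) \<in> rels L" "set is \<subseteq> {..<length xs}" for R "is"
  proof -
    have "Rel R (map Var is) \<in> atoms L (length xs)"
      using that unfolding atoms_def by blast
    from assms[OF this] show ?thesis by (simp add: comp_def)
  qed
  ultimately show ?thesis unfolding same_atoms_def by blast
qed

definition forth_fm :: "lang \<Rightarrow> 'a struct \<Rightarrow> 'a list \<Rightarrow> fm" where
  "forth_fm L M xs = alls (length xs) (imp_fm (type_fm L M xs)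
     (conj_set ((\<lambda>x. ex_fm (length xs) (type_fm L M (xs @ [x]))) ` univ M)))"

definition back_fm :: "lang \<Rightarrow> 'a struct \<Rightarrow> 'a list \<Rightarrow> fm" where
  "back_fm L M xs = alls (length xs) (imp_fm (type_fm L M xs)
     (All (length xs) (disj_set ((\<lambda>x. type_fm L M (xs @ [x])) ` univ M))))"

definition diagram_fm :: "lang \<Rightarrow> 'a struct \<Rightarrow> 'a list \<Rightarrow> fm" where
  "diagram_fm L M xs = alls (length xs) (imp_fm (type_fm L M xs)
     (conj_set ((\<lambda>\<alpha>. if sat M \<alpha> ((!) xs) then \<alpha> else Neg \<alpha>) ` atoms L (length xs))))"

text \<open>The clauses say of a model that the pairs of a tuple \<open>xs\<close> of
  \<open>M\<close> and a tuple satisfying \<open>type_fm L M xs\<close> form a back-and-forth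
  system; the clause for \<open>[]\<close> starts it. For \<open>M\<close> over the natural numbers
  there are only countably many \<open>xs\<close>.\<close>

definition scott_fm :: "lang \<Rightarrow> 'a struct \<Rightarrow> fm" where
  "scott_fm L M = conj_set (insert (type_fm L M [])
     (\<Union>xs \<in> lists (univ M). {forth_fm L M xs, back_fm L M xs, diagram_fm L M xs}))"

lemma sat_forth_fm:
  fixes M :: "nat struct"
  shows "sat N (forth_fm L M xs) e \<longleftrightarrow>
    (\<forall>ys \<in> tuples N (length xs). sat N (type_fm L M xs) ((!) ys) \<longrightarrow>
       (\<forall>x \<in> univ M. \<exists>y \<in> univ N. sat N (type_fm L M (xs @ [x])) ((!) (ys @ [y]))))"
proof -
  have fv: "free_vars (type_fm L M (xs @ [x])) \<subseteq> {..length xs}" for x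
    using type_fm(2)[of L M "xs @ [x]"] by (simp add: lessThan_Suc_atMost)
  have eq: "sat N (type_fm L M (xs @ [x])) (((!) ys)(length xs := a)) =
      sat N (type_fm L M (xs @ [x])) ((!) (ys @ [a]))" if "length ys = length xs" for x ys a
    using sat_nth_append[of "type_fm L M (xs @ [x])" ys N a] fv[of x] that by simp
  have "sat N (forth_fm L M xs) e \<longleftrightarrow>
    (\<forall>ys. length ys = length xs \<and> set ys \<subseteq> univ N \<longrightarrow> sat N (imp_fm (type_fm L M xs)
     (conj_set ((\<lambda>x. ex_fm (length xs) (type_fm L M (xs @ [x]))) ` univ M))) ((!) ys))"
    unfolding forth_fm_def
    by (rule sat_alls) (use fv type_fm(2)[of L M xs] in \<open>fastforce simp: le_eq_less_or_eq\<close>)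
  also have "\<dots> \<longleftrightarrow> (\<forall>ys \<in> tuples N (length xs). sat N (type_fm L M xs) ((!) ys) \<longrightarrow>
       (\<forall>x \<in> univ M. \<exists>y \<in> univ N. sat N (type_fm L M (xs @ [x])) ((!) (ys @ [y]))))"
    by (simp add: tuples_def eq)
  finally show ?thesis .
qed

lemma sat_back_fm:
  fixes M :: "nat struct"
  shows "sat N (back_fm L M xs) e \<longleftrightarrow>
    (\<forall>ys \<in> tuples N (length xs). sat N (type_fm L M xs) ((!) ys) \<longrightarrow>
       (\<forall>y \<in> univ N. \<exists>x \<in> univ M. sat N (type_fm L M (xs @ [x])) ((!) (ys @ [y]))))"
proof -
  have fv: "free_vars (type_fm L M (xs @ [x])) \<subseteq> {..length xs}" for x
    using type_fm(2)[of L M "xs @ [x]"] by (simp add: lessThan_Suc_atMost)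
  have eq: "sat N (type_fm L M (xs @ [x])) (((!) ys)(length xs := a)) =
      sat N (type_fm L M (xs @ [x])) ((!) (ys @ [a]))" if "length ys = length xs" for x ys a
    using sat_nth_append[of "type_fm L M (xs @ [x])" ys N a] fv[of x] that by simp
  have "sat N (back_fm L M xs) e \<longleftrightarrow>
    (\<forall>ys. length ys = length xs \<and> set ys \<subseteq> univ N \<longrightarrow> sat N (imp_fm (type_fm L M xs)
     (All (length xs) (disj_set ((\<lambda>x. type_fm L M (xs @ [x])) ` univ M)))) ((!) ys))"
    unfolding back_fm_def
    by (rule sat_alls) (use fv type_fm(2)[of L M xs] in \<open>fastforce simp: le_eq_less_or_eq\<close>)
  also have "\<dots> \<longleftrightarrow> (\<forall>ys \<in> tuples N (length xs). sat N (type_fm L M xs) ((!) ys) \<longrightarrow>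
       (\<forall>y \<in> univ N. \<exists>x \<in> univ M. sat N (type_fm L M (xs @ [x])) ((!) (ys @ [y]))))"
    by (simp add: tuples_def eq)
  finally show ?thesis .
qed

lemma sat_diagram_fm:
  fixes M :: "nat struct"
  shows "sat N (diagram_fm L M xs) e \<longleftrightarrow>
    (\<forall>ys \<in> tuples N (length xs). sat N (type_fm L M xs) ((!) ys) \<longrightarrow>
       (\<forall>\<alpha> \<in> atoms L (length xs). sat M \<alpha> ((!) xs) = sat N \<alpha> ((!) ys)))"
proof -
  have eq: "sat N (if b then \<alpha> else Neg \<alpha>) e' \<longleftrightarrow> b = sat N \<alpha> e'" for b \<alpha> e' by simp
  have "sat N (diagram_fm L M xs) e \<longleftrightarrow>
    (\<forall>ys. length ys = length xs \<and> set ys \<subseteq> univ N \<longrightarrow> sat N (imp_fm (type_fm L M xs)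
     (conj_set ((\<lambda>\<alpha>. if sat M \<alpha> ((!) xs) then \<alpha> else Neg \<alpha>) ` atoms L (length xs)))) ((!) ys))"
    unfolding diagram_fm_def
    by (rule sat_alls) (use countable_atoms atoms_free_vars[of _ L "length xs"]
        type_fm(2)[of L M xs] in \<open>auto split: if_splits\<close>)
  also have "\<dots> \<longleftrightarrow> (\<forall>ys \<in> tuples N (length xs). sat N (type_fm L M xs) ((!) ys) \<longrightarrow>
       (\<forall>\<alpha> \<in> atoms L (length xs). sat M \<alpha> ((!) xs) = sat N \<alpha> ((!) ys)))"
    by (simp only: imp_fm_simps sat_conj_set countable_image countable_atoms ball_simps eq
        tuples_def mem_Collect_eq)
  finally show ?thesis .
qed

lemma is_sentence_scott_fm:
  fixes M :: "nat struct"
  shows "is_sentence L (scott_fm L M)"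
proof -
  have fv: "free_vars (type_fm L M (xs @ [x])) \<subseteq> {..length xs}" for xs x
    using type_fm(2)[of L M "xs @ [x]"] by (simp add: lessThan_Suc_atMost)
  have "free_vars (forth_fm L M xs) = {}" "free_vars (back_fm L M xs) = {}" for xs
    unfolding forth_fm_def back_fm_def
    by (rule free_vars_alls; use fv type_fm(2)[of L M xs] in \<open>fastforce simp: le_eq_less_or_eq\<close>)+
  moreover have "free_vars (diagram_fm L M xs) = {}" for xs
    unfolding diagram_fm_def
    by (rule free_vars_alls) (use countable_atoms atoms_free_vars[of _ L "length xs"]
        type_fm(2)[of L M xs] in \<open>auto split: if_splits\<close>)
  moreover have "wf_fm L (forth_fm L M xs)" "wf_fm L (back_fm L M xs)" for xs
    unfolding forth_fm_def back_fm_def using type_fm(1) by auto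
  moreover have "wf_fm L (diagram_fm L M xs)" for xs
    unfolding diagram_fm_def using type_fm(1) by (auto simp: countable_atoms atoms_wf)
  ultimately show ?thesis
    unfolding is_sentence_def scott_fm_def
    using type_fm(1,2)[of L M "[]"] type_fm(1)[of L M "[]"] by (auto simp: countable_Un_iff)
qed

lemma sat_scott_fm:
  fixes M :: "nat struct"
  shows "sat N (scott_fm L M) e \<longleftrightarrow> sat N (type_fm L M []) e \<and>
    (\<forall>xs \<in> lists (univ M). sat N (forth_fm L M xs) e \<and> sat N (back_fm L M xs) e \<and> sat N (diagram_fm L M xs) e)"
  unfolding scott_fm_def by (subst sat_conj_set) auto

text \<open>A tuple of \<open>M\<close> satisfying \<open>type_fm L M xs\<close> has the type of
  \<open>xs\<close>. So the forth clauses are \<open>same_type_extend\<close>, the back clauses are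
  the same with the tuples exchanged, and the diagram clauses hold because atoms belong to the
  type.\<close>

lemma sat_scott_fm_self:
  fixes M :: "nat struct"
  shows "sat M (scott_fm L M) e"
proof -
  have "sat M (type_fm L M []) e = sat M (type_fm L M []) ((!) [])"
    by (rule sat_cong) (use type_fm(2)[of L M "[]"] in auto)
  moreover have "sat M (forth_fm L M xs) e" "sat M (back_fm L M xs) e" "sat M (diagram_fm L M xs) e"
    if xs: "xs \<in> lists (univ M)" for xs
  proof -
    have st: "same_type L M xs ys"
      if "ys \<in> tuples M (length xs)" "sat M (type_fm L M xs) ((!) ys)" for ys
      using type_fm(4) that .
    have X: "xs \<in> tuples M (length xs)" using xs by (auto simp: tuples_def)
    have ty: "sat M (type_fm L M us) ((!) vs)" if "same_type L M us vs" for us vs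
      using that type_fm(1,2,3) unfolding same_type_def by blast
    show "sat M (forth_fm L M xs) e" unfolding sat_forth_fm
    proof (intro ballI impI)
      fix ys x assume ys: "ys \<in> tuples M (length xs)" "sat M (type_fm L M xs) ((!) ys)" and x: "x \<in> univ M"
      then show "\<exists>y \<in> univ M. sat M (type_fm L M (xs @ [x])) ((!) (ys @ [y]))"
        using same_type_extend[OF st[OF ys] _ _ _ x] X ty by (auto simp: tuples_def)
    qed
    show "sat M (back_fm L M xs) e" unfolding sat_back_fm
    proof (intro ballI impI)
      fix ys y assume ys: "ys \<in> tuples M (length xs)" "sat M (type_fm L M xs) ((!) ys)" and y: "y \<in> univ M"
      have len: "length xs = length ys" using ys by (simp add: tuples_def)
      obtain x where x: "x \<in> univ M" "same_type L M (ys @ [y]) (xs @ [x])"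
        using same_type_extend[OF same_type_sym[OF len st[OF ys]] _ _ _ y] ys X by (auto simp: tuples_def)
      have "same_type L M (xs @ [x]) (ys @ [y])"
        by (rule same_type_sym[OF _ x(2)]) (simp add: len)
      then show "\<exists>x \<in> univ M. sat M (type_fm L M (xs @ [x])) ((!) (ys @ [y]))"
        using x(1) ty by blast
    qed
    show "sat M (diagram_fm L M xs) e" unfolding sat_diagram_fm
    proof (intro ballI impI)
      fix ys \<alpha> assume ys: "ys \<in> tuples M (length xs)" "sat M (type_fm L M xs) ((!) ys)"
        and \<alpha>: "\<alpha> \<in> atoms L (length xs)"
      show "sat M \<alpha> ((!) xs) = sat M \<alpha> ((!) ys)"
        using st[OF ys] atoms_wf[OF \<alpha>] atoms_free_vars[OF \<alpha>] unfolding same_type_def by metis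
    qed
  qed
  ultimately show ?thesis
    unfolding sat_scott_fm using type_fm(3)[of M L "[]"] by blast
qed

lemma sat_scott_fm_bf_equiv:
  fixes M :: "nat struct"
  assumes "sat N (scott_fm L M) e"
  shows "bf_equiv L M N"
proof -
  let ?S = "{(xs, ys). set xs \<subseteq> univ M \<and> set ys \<subseteq> univ N \<and> length xs = length ys \<and>
     sat N (type_fm L M xs) ((!) ys)}"
  have nil: "sat N (type_fm L M []) e = sat N (type_fm L M []) ((!) [])"
    by (rule sat_cong) (use type_fm(2)[of L M "[]"] in auto)
  note D = assms[unfolded sat_scott_fm]
  have F: "sat N (forth_fm L M xs) e" and B: "sat N (back_fm L M xs) e"
    and A: "sat N (diagram_fm L M xs) e" if "set xs \<subseteq> univ M" for xs
    using D that by (auto simp: in_lists_conv_set subset_iff)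
  have "bf_system L M N ?S"
  proof (rule bf_systemI, goal_cases)
    case 1
    then show ?case using D nil by simp
  next
    case (2 xs ys)
    then show ?case by simp
  next
    case (3 xs ys)
    then show ?case using A[unfolded sat_diagram_fm] by (intro same_atomsI) (auto simp: tuples_def)
  next
    case (4 xs ys x)
    then have "ys \<in> tuples N (length xs)" by (auto simp: tuples_def)
    then obtain y where "y \<in> univ N" "sat N (type_fm L M (xs @ [x])) ((!) (ys @ [y]))"
      using F[of xs, unfolded sat_forth_fm] 4 by blast
    then show ?case using 4 by auto
  next
    case (5 xs ys y)
    then have "ys \<in> tuples N (length xs)" by (auto simp: tuples_def)
    then obtain x where "x \<in> univ M" "sat N (type_fm L M (xs @ [x])) ((!) (ys @ [y]))"
      using B[of xs, unfolded sat_back_fm] 5 by blast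
    then show ?case using 5 by auto
  qed
  then show ?thesis unfolding bf_equiv_def by blast
qed

lemma models_scott_fm_iff:
  fixes M :: "nat struct"
  assumes "is_struct L M" "is_struct L N"
  shows "models N (scott_fm L M) \<longleftrightarrow> bf_equiv L M N"
proof
  assume "models N (scott_fm L M)"
  then show "bf_equiv L M N"
    using sat_scott_fm_bf_equiv models_sentence_iff[OF assms(2) is_sentence_scott_fm] by blast
next
  assume "bf_equiv L M N"
  then show "models N (scott_fm L M)"
    using bf_equiv_models[OF _ assms is_sentence_scott_fm] sat_scott_fm_self unfolding models_def by blast
qed

section \<open>Countable back-and-forth equivalent structures are isomorphic\<close>

lemma list_all2_zip_index:
  assumes "list_all2 (\<lambda>u v. (u, v) \<in> set (zip xs ys)) us vs" "length xs = length ys"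
  shows "\<exists>is. set is \<subseteq> {..<length xs} \<and> us = map ((!) xs) is \<and> vs = map ((!) ys) is"
  using assms(1)
proof (induction us vs rule: list_all2_induct)
  case (Cons u us v vs)
  then obtain "is" where "is": "set is \<subseteq> {..<length xs}" "us = map ((!) xs) is" "vs = map ((!) ys) is"
    by blast
  obtain i where "i < length xs" "u = xs ! i" "v = ys ! i"
    using Cons.hyps(1) assms(2) by (auto simp: set_zip)
  then show ?case using "is" by (intro exI[of _ "i # is"]) auto
qed simp

text \<open>Replaces positions by the relation \<open>set (zip xs ys)\<close>, for which order and
  repetition of entries are irrelevant, so that it can be united along chains and combined across
  sorts.\<close>

lemma same_atoms_zipD:
  assumes "same_atoms L M N xs ys" "length xs = length ys"
  shows "(x, y) \<in> set (zip xs ys) \<Longrightarrow> (x', y') \<in> set (zip xs ys) \<Longrightarrow> x = x' \<longleftrightarrow> y = y'"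
    "(f, length us) \<in> funs L \<Longrightarrow> list_all2 (\<lambda>u v. (u, v) \<in> set (zip xs ys)) us vs \<Longrightarrow>
      (x, y) \<in> set (zip xs ys) \<Longrightarrow> x = fint M f us \<longleftrightarrow> y = fint N f vs"
    "(R, length us) \<in> rels L \<Longrightarrow> list_all2 (\<lambda>u v. (u, v) \<in> set (zip xs ys)) us vs \<Longrightarrow>
      rint M R us \<longleftrightarrow> rint N R vs"
proof -
  show "x = x' \<longleftrightarrow> y = y'" if "(x, y) \<in> set (zip xs ys)" "(x', y') \<in> set (zip xs ys)"
    using that assms by (auto simp: set_zip dest: same_atoms_eqD)
  show "x = fint M f us \<longleftrightarrow> y = fint N f vs"
    if h: "(f, length us) \<in> funs L" "list_all2 (\<lambda>u v. (u, v) \<in> set (zip xs ys)) us vs"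
      "(x, y) \<in> set (zip xs ys)"
  proof -
    obtain "is" where "is": "set is \<subseteq> {..<length xs}" "us = map ((!) xs) is" "vs = map ((!) ys) is"
      using list_all2_zip_index[OF h(2) assms(2)] by blast
    obtain i where i: "i < length xs" "x = xs ! i" "y = ys ! i"
      using h(3) assms(2) by (auto simp: set_zip)
    have "(f, length is) \<in> funs L" using h(1) "is"(2) by simp
    from same_atoms_funD[OF assms(1) this "is"(1) i(1)] show ?thesis using "is" i by simp
  qed
  show "rint M R us \<longleftrightarrow> rint N R vs"
    if h: "(R, length us) \<in> rels L" "list_all2 (\<lambda>u v. (u, v) \<in> set (zip xs ys)) us vs"
  proof -
    obtain "is" where "is": "set is \<subseteq> {..<length xs}" "us = map ((!) xs) is" "vs = map ((!) ys) is"
      using list_all2_zip_index[OF h(2) assms(2)] by blast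
    have "(R, length is) \<in> rels L" using h(1) "is"(2) by simp
    from same_atoms_relD[OF assms(1) this "is"(1)] show ?thesis using "is" by simp
  qed
qed

text \<open>Cantor's back-and-forth argument: a chain of members of the system exhausts both
  universes, and the union of the finite correspondences is the graph of an isomorphism.\<close>

lemma bf_equiv_countable_isomorphic:
  fixes M N :: "nat struct"
  assumes "bf_equiv L M N" "is_struct L M" "is_struct L N"
  shows "isomorphic L M N"
proof -
  obtain S where S: "bf_system L M N S" using assms(1) unfolding bf_equiv_def by blast
  have ne: "univ M \<noteq> {}" "univ N \<noteq> {}" using assms unfolding is_struct_def by blast+
  define m where "m = from_nat_into (univ M)"
  define k where "k = from_nat_into (univ N)"
  have rm: "range m = univ M" and rk: "range k = univ N"
    unfolding m_def k_def by (rule range_from_nat_into[OF ne(1)], simp, rule range_from_nat_into[OF ne(2)], simp)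
  \<comment> \<open>From \<open>p n\<close> to \<open>p (Suc n)\<close>, a forth step puts
    \<open>m n\<close> on the left and a back step puts \<open>k n\<close> on the right, so the
    union becomes total on both sides.\<close>
  have "\<exists>p. \<forall>n. p n \<in> S \<and> (\<exists>us vs. p (Suc n) = (fst (p n) @ us, snd (p n) @ vs) \<and>
     m n \<in> set us \<and> k n \<in> set vs)"
  proof (rule dependent_nat_choice)
    show "\<exists>x. x \<in> S" using bf_system_nil[OF S] by blast
    fix q n assume q: "q \<in> S"
    obtain xs ys where xy: "q = (xs, ys)" by (cases q)
    have "m n \<in> univ M" "k n \<in> univ N" using rm rk by auto
    then obtain y where y: "(xs @ [m n], ys @ [y]) \<in> S"
      using bf_systemD(5)[OF S] q xy by blast
    then obtain x where "((xs @ [m n]) @ [x], (ys @ [y]) @ [k n]) \<in> S"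
      using bf_systemD(6)[OF S y] \<open>k n \<in> univ N\<close> by blast
    then show "\<exists>r. r \<in> S \<and> (\<exists>us vs. r = (fst q @ us, snd q @ vs) \<and> m n \<in> set us \<and> k n \<in> set vs)"
      unfolding xy by (intro exI[of _ "((xs @ [m n]) @ [x], (ys @ [y]) @ [k n])"] conjI
          exI[of _ "[m n, x]"] exI[of _ "[y, k n]"]) auto
  qed
  then obtain p where pS: "\<And>n. p n \<in> S"
    and pe: "\<And>n. \<exists>us vs. p (Suc n) = (fst (p n) @ us, snd (p n) @ vs) \<and> m n \<in> set us \<and> k n \<in> set vs"
    by metis
  define xs where "xs n = fst (p n)" for n
  define ys where "ys n = snd (p n)" for n
  have xyS: "(xs n, ys n) \<in> S" for n using pS by (simp add: xs_def ys_def)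
  note D = bf_systemD[OF S xyS]
  define Z where "Z n = set (zip (xs n) (ys n))" for n
  have Zstep: "Z n \<subseteq> Z (Suc n)" for n
    using pe[of n] D(1)[of n] unfolding Z_def xs_def ys_def by auto
  have Zmono: "Z i \<subseteq> Z j" if "i \<le> j" for i j
    using that by (rule lift_Suc_mono_le[of Z, OF Zstep])
  have Zdom: "\<exists>y. (x, y) \<in> (\<Union>n. Z n)" if x: "x \<in> univ M" for x
  proof -
    obtain n where "x = m n" using x rm by blast
    then have "x \<in> set (xs (Suc n))" using pe[of n] unfolding xs_def by auto
    then have "x \<in> fst ` Z (Suc n)"
      unfolding Z_def using D(1)[of "Suc n"] by (metis map_fst_zip set_map)
    then show ?thesis by fastforce
  qed
  have Zran: "\<exists>x. (x, y) \<in> (\<Union>n. Z n)" if y: "y \<in> univ N" for y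
  proof -
    obtain n where "y = k n" using y rk by blast
    then have "y \<in> set (ys (Suc n))" using pe[of n] unfolding ys_def by auto
    then have "y \<in> snd ` Z (Suc n)"
      unfolding Z_def using D(1)[of "Suc n"] by (metis map_snd_zip set_map)
    then show ?thesis by fastforce
  qed
  have Zfield: "x \<in> univ M \<and> y \<in> univ N" if "(x, y) \<in> Z n" for x y n
    using that D(2,3)[of n] unfolding Z_def by (auto dest: set_zip_leftD set_zip_rightD)
  have Zeq: "x = x' \<longleftrightarrow> y = y'" if xy: "(x, y) \<in> (\<Union>n. Z n)" "(x', y') \<in> (\<Union>n. Z n)" for x y x' y'
  proof -
    obtain i j where ij: "(x, y) \<in> Z i" "(x', y') \<in> Z j" using xy by blast
    have "(x, y) \<in> Z (max i j)" "(x', y') \<in> Z (max i j)"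
      using ij Zmono[of i "max i j"] Zmono[of j "max i j"] by auto
    then show ?thesis using same_atoms_zipD(1)[OF D(4,1)] unfolding Z_def by blast
  qed
  define h where "h x = (SOME y. (x, y) \<in> (\<Union>n. Z n))" for x
  have hZ: "(x, h x) \<in> (\<Union>n. Z n)" if "x \<in> univ M" for x
    unfolding h_def using someI_ex[OF Zdom[OF that]] .
  \<comment> \<open>An atom involves finitely many elements, and the increasing sets
    \<open>Z n\<close> contain their pairs at a common stage, where \<open>same_atoms\<close>
    applies.\<close>
  have fin: "\<exists>n. \<forall>u \<in> U. (u, h u) \<in> Z n" if "finite U" "U \<subseteq> univ M" for U
    using that
  proof (induction U rule: finite_induct)
    case (insert u U)
    then obtain i where i: "\<forall>u \<in> U. (u, h u) \<in> Z i" by blast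
    obtain j where j: "(u, h u) \<in> Z j" using hZ insert by blast
    have "\<forall>u \<in> insert u U. (u, h u) \<in> Z (max i j)"
      using i j Zmono[of i "max i j"] Zmono[of j "max i j"] by auto
    then show ?case by blast
  qed simp
  show ?thesis
  proof (rule isomorphicI[of h])
    show "bij_betw h (univ M) (univ N)"
      unfolding bij_betw_def
    proof (intro conjI inj_onI subset_antisym subsetI)
      fix x x' assume "x \<in> univ M" "x' \<in> univ M" "h x = h x'"
      then show "x = x'" using Zeq[OF hZ hZ, of x x'] by simp
    next
      fix y assume "y \<in> h ` univ M"
      then show "y \<in> univ N" using hZ Zfield by blast
    next
      fix y assume "y \<in> univ N"
      then obtain x where x: "(x, y) \<in> (\<Union>n. Z n)" using Zran by blast
      then have "x \<in> univ M" using Zfield by blast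
      moreover from this have "h x = y" using Zeq[OF hZ x] by blast
      ultimately show "y \<in> h ` univ M" by blast
    qed
  next
    fix f us assume f: "(f, length us) \<in> funs L" and us: "set us \<subseteq> univ M"
    \<comment> \<open>The value joins the arguments because a function atom compares an entry of the
      tuple with the function value.\<close>
    have "finite (insert (fint M f us) (set us))" "insert (fint M f us) (set us) \<subseteq> univ M"
      using us is_struct_fint[OF assms(2) f us] by auto
    from fin[OF this] obtain n where n: "\<forall>u \<in> insert (fint M f us) (set us). (u, h u) \<in> Z n" by blast
    then have "list_all2 (\<lambda>u v. (u, v) \<in> set (zip (xs n) (ys n))) us (map h us)"
      by (auto simp: list_all2_conv_all_nth Z_def)
    from same_atoms_zipD(2)[OF D(4,1) f this] show "h (fint M f us) = fint N f (map h us)"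
      using n unfolding Z_def by blast
  next
    fix R us assume R: "(R, length us) \<in> rels L" and us: "set us \<subseteq> univ M"
    from fin[OF _ us] obtain n where n: "\<forall>u \<in> set us. (u, h u) \<in> Z n" by blast
    then have "list_all2 (\<lambda>u v. (u, v) \<in> set (zip (xs n) (ys n))) us (map h us)"
      by (auto simp: list_all2_conv_all_nth Z_def)
    from same_atoms_zipD(3)[OF D(4,1) R this] show "rint M R us = rint N R (map h us)" .
  qed
qed

lemma scott_sentence_scott_fm:
  assumes "is_struct L M"
  shows "scott_sentence L M (scott_fm L M)"
  unfolding scott_sentence_def
proof (intro conjI allI impI)
  fix N :: "nat struct" assume N: "is_struct L N"
  show "models N (scott_fm L M) \<longleftrightarrow> isomorphic L M N"
    unfolding models_scott_fm_iff[OF assms N]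
    using bf_equiv_countable_isomorphic[OF _ assms N] isomorphic_bf_equiv[OF _ assms] by metis
qed (rule is_sentence_scott_fm)

section \<open>Hulls and the downward Lowenheim-Skolem theorem\<close>

primrec stage :: "('a list \<Rightarrow> 'a) set \<Rightarrow> 'a set \<Rightarrow> nat \<Rightarrow> 'a set" where
  "stage G X 0 = X"
| "stage G X (Suc n) = stage G X n \<union> (\<Union>g \<in> G. g ` lists (stage G X n))"

definition hull_of :: "('a list \<Rightarrow> 'a) set \<Rightarrow> 'a set \<Rightarrow> 'a set" where
  "hull_of G X = (\<Union>n. stage G X n)"

lemma subset_hull_of: "X \<subseteq> hull_of G X"
  unfolding hull_of_def by (rule order_trans[OF _ UN_upper[of 0]]) auto

lemma hull_of_closed:
  assumes "g \<in> G" "set xs \<subseteq> hull_of G X"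
  shows "g xs \<in> hull_of G X"
proof -
  have mono: "stage G X i \<subseteq> stage G X j" if "i \<le> j" for i j
    using that by (rule lift_Suc_mono_le[of "stage G X", rotated]) auto
  have "\<exists>n. set xs \<subseteq> stage G X n"
    using assms(2)
  proof (induction xs)
    case (Cons x xs)
    then obtain i where i: "set xs \<subseteq> stage G X i" by auto
    obtain j where j: "x \<in> stage G X j" using Cons.prems unfolding hull_of_def by auto
    have "set (x # xs) \<subseteq> stage G X (max i j)"
      using i j mono[of i "max i j"] mono[of j "max i j"] by auto
    then show ?case by blast
  qed simp
  then obtain n where "set xs \<subseteq> stage G X n" by blast
  then have "g xs \<in> stage G X (Suc n)" using assms(1) by (auto simp: in_lists_conv_set)
  then show ?thesis unfolding hull_of_def by blast
qed

lemma hull_of_subset: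
  assumes "X \<subseteq> Y" "\<And>g xs. g \<in> G \<Longrightarrow> set xs \<subseteq> Y \<Longrightarrow> g xs \<in> Y"
  shows "hull_of G X \<subseteq> Y"
proof -
  have "stage G X n \<subseteq> Y" for n
  proof (induction n)
    case (Suc n)
    have "g ` lists (stage G X n) \<subseteq> Y" if "g \<in> G" for g
      using assms(2)[OF that] Suc by (auto simp: lists_eq_set)
    then show ?case using Suc by auto
  qed (use assms in simp)
  then show ?thesis unfolding hull_of_def by blast
qed

section \<open>Cardinal bounds for unions, lists and hulls\<close>

lemma Cinfinite_not_finite: "Cinfinite r \<Longrightarrow> \<not> finite (Field r)"
  unfolding cinfinite_def by blast

lemma Cinfinite_nat: "Cinfinite |UNIV :: nat set|"
  by (rule conjI) (simp add: cinfinite_def Field_card_of, rule card_of_Card_order)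

lemma UNION_ordLeq_Cinfinite:
  "Cinfinite r \<Longrightarrow> |I| \<le>o r \<Longrightarrow> (\<And>i. i \<in> I \<Longrightarrow> |A i| \<le>o r) \<Longrightarrow> |\<Union>i \<in> I. A i| \<le>o r"
  by (rule card_of_UNION_ordLeq_infinite_Field) (auto simp: Cinfinite_not_finite)

lemma Un_ordLeq_Cinfinite:
  "Cinfinite r \<Longrightarrow> |A| \<le>o r \<Longrightarrow> |B| \<le>o r \<Longrightarrow> |A \<union> B| \<le>o r"
  by (rule card_of_Un_ordLeq_infinite_Field) (auto simp: Cinfinite_not_finite)

lemma Times_ordLeq_Cinfinite:
  "Cinfinite r \<Longrightarrow> |A| \<le>o r \<Longrightarrow> |B| \<le>o r \<Longrightarrow> |A \<times> B| \<le>o r"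
  by (rule card_of_Times_ordLeq_infinite_Field) (auto simp: Cinfinite_not_finite)

lemma image_ordLeq: "|A| \<le>o r \<Longrightarrow> |f ` A| \<le>o r"
  by (rule ordLeq_transitive[OF card_of_image])

lemma countable_ordLeq_Cinfinite:
  assumes "Cinfinite r" "countable A"
  shows "|A| \<le>o r"
proof -
  have "|A| \<le>o |UNIV :: nat set|"
    using assms(2) unfolding countable_def by (auto simp: card_of_ordLeq[symmetric])
  also have "|UNIV :: nat set| =o natLeq" by (rule card_of_nat)
  also have "natLeq \<le>o r" using assms(1) by (rule natLeq_ordLeq_cinfinite)
  finally show ?thesis .
qed

lemma lists_ordLeq_Cinfinite:
  assumes "Cinfinite r" "|A| \<le>o r"
  shows "|lists A| \<le>o r"
proof -
  have "|{xs \<in> lists A. length xs = n}| \<le>o r" for n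
  proof (induction n)
    case 0
    have "countable {xs \<in> lists A. length xs = 0}" by (rule countable_subset[of _ "{[]}"]) auto
    then show ?case using countable_ordLeq_Cinfinite[OF assms(1)] by blast
  next
    case (Suc n)
    have "{xs \<in> lists A. length xs = Suc n} \<subseteq> (\<lambda>(x, xs). x # xs) ` (A \<times> {xs \<in> lists A. length xs = n})"
      by (auto simp: length_Suc_conv image_iff)
    then have "|{xs \<in> lists A. length xs = Suc n}| \<le>o
        |(\<lambda>(x, xs). x # xs) ` (A \<times> {xs \<in> lists A. length xs = n})|" by (rule card_of_mono1)
    moreover have "|(\<lambda>(x, xs). x # xs) ` (A \<times> {xs \<in> lists A. length xs = n})| \<le>o r"
      by (intro image_ordLeq Times_ordLeq_Cinfinite assms Suc)
    ultimately show ?case by (rule ordLeq_transitive)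
  qed
  then have "|\<Union>n. {xs \<in> lists A. length xs = n}| \<le>o r"
    by (intro UNION_ordLeq_Cinfinite[OF assms(1) countable_ordLeq_Cinfinite[OF assms(1)]]) auto
  moreover have "(\<Union>n. {xs \<in> lists A. length xs = n}) = lists A" by auto
  ultimately show ?thesis by simp
qed

lemma hull_of_ordLeq:
  assumes "Cinfinite r" "|X| \<le>o r" "|G| \<le>o r"
  shows "|hull_of G X| \<le>o r"
proof -
  have "|stage G X n| \<le>o r" for n
    by (induction n) (auto intro!: Un_ordLeq_Cinfinite UNION_ordLeq_Cinfinite image_ordLeq
        lists_ordLeq_Cinfinite assms simp del: UN_simps)
  then show ?thesis
    unfolding hull_of_def
    by (intro UNION_ordLeq_Cinfinite[OF assms(1) countable_ordLeq_Cinfinite[OF assms(1)]]) auto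
qed

primrec subfms :: "fm \<Rightarrow> fm set" where
  "subfms (Eq s t) = {Eq s t}"
| "subfms (Rel R ts) = {Rel R ts}"
| "subfms (Neg \<phi>) = insert (Neg \<phi>) (subfms \<phi>)"
| "subfms (Conj \<Phi>) = insert (Conj \<Phi>) (\<Union>i. subfms (\<Phi> i))"
| "subfms (All x \<phi>) = insert (All x \<phi>) (subfms \<phi>)"

lemma countable_subfms: "countable (subfms \<phi>)"
  by (induction \<phi>) auto

lemma subfms_self: "\<phi> \<in> subfms \<phi>"
  by (cases \<phi>) auto

lemma eval_tm_univ_update [simp]: "eval_tm (M\<lparr>univ := H\<rparr>) t e = eval_tm M t e"
proof (induction t)
  case (App f ts)
  then have "map (\<lambda>t. eval_tm (M\<lparr>univ := H\<rparr>) t e) ts = map (\<lambda>t. eval_tm M t e) ts" by simp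
  then show ?case by (simp only: eval_tm.simps) simp
qed simp

text \<open>The Tarski-Vaught argument for one sentence: close \<open>X\<close> under the functions
  and under operations choosing counterexamples to universal subformulas. Although formulas are
  infinite, \<open>\<phi>\<close> has only countably many subformulas, so the hull stays within
  \<open>r\<close>.\<close>

theorem lowenheim_skolem_downward:
  assumes M: "is_struct L M" and \<phi>: "is_sentence L \<phi>" and X: "X \<subseteq> univ M"
    and r: "Cinfinite r" "|X| \<le>o r"
  shows "\<exists>N. univ N \<subseteq> univ M \<and> X \<subseteq> univ N \<and> |univ N| \<le>o r \<and> is_struct L N \<and>
    (models N \<phi> \<longleftrightarrow> models M \<phi>)"
proof -
  obtain a0 where a0: "a0 \<in> univ M" using M unfolding is_struct_def by blast
  \<comment> \<open>\<open>fint\<close> may leave the universe for names or argument lists outside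
    the language; the default \<open>a0\<close> keeps the hull inside \<open>univ M\<close>.\<close>
  define fop where "fop f xs = (if fint M f xs \<in> univ M then fint M f xs else a0)" for f xs
  \<comment> \<open>The argument list is a finite piece of an assignment: entry \<open>v\<close> is
    the value of variable \<open>v\<close>.\<close>
  define wit where "wit \<psi> xs = (case \<psi> of All x \<chi> \<Rightarrow>
      if \<exists>a \<in> univ M. \<not> sat M \<chi> (((!) xs)(x := a)) then SOME a. a \<in> univ M \<and> \<not> sat M \<chi> (((!) xs)(x := a))
      else a0 | _ \<Rightarrow> a0)" for \<psi> xs
  define G where "G = range fop \<union> wit ` subfms \<phi>"
  define H where "H = hull_of G X"
  define N where "N = M\<lparr>univ := H\<rparr>"
  have N: "univ N = H" "fint N = fint M" "rint N = rint M" by (auto simp: N_def)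
  have wit_univ: "wit \<psi> xs \<in> univ M" for \<psi> xs
  proof (cases "\<exists>x \<chi>. \<psi> = All x \<chi> \<and> (\<exists>a \<in> univ M. \<not> sat M \<chi> (((!) xs)(x := a)))")
    case True
    then obtain x \<chi> where *: "\<psi> = All x \<chi>" "\<exists>a. a \<in> univ M \<and> \<not> sat M \<chi> (((!) xs)(x := a))" by blast
    then have "wit \<psi> xs = (SOME a. a \<in> univ M \<and> \<not> sat M \<chi> (((!) xs)(x := a)))"
      unfolding wit_def by auto
    then show ?thesis using someI_ex[OF *(2)] by simp
  next
    case False
    then have "wit \<psi> xs = a0" unfolding wit_def by (auto split: fm.splits)
    then show ?thesis using a0 by simp
  qed
  have wit_sat: "\<not> sat M \<chi> (((!) xs)(x := wit (All x \<chi>) xs))"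
    if "\<exists>a \<in> univ M. \<not> sat M \<chi> (((!) xs)(x := a))" for x \<chi> xs
  proof -
    have *: "\<exists>a. a \<in> univ M \<and> \<not> sat M \<chi> (((!) xs)(x := a))" using that by blast
    have "wit (All x \<chi>) xs = (SOME a. a \<in> univ M \<and> \<not> sat M \<chi> (((!) xs)(x := a)))"
      unfolding wit_def using that by simp
    then show ?thesis using someI_ex[OF *] by simp
  qed
  have HM: "H \<subseteq> univ M"
    unfolding H_def G_def
    by (rule hull_of_subset[OF X]) (use a0 wit_univ in \<open>auto simp: fop_def\<close>)
  have "countable G" unfolding G_def using countable_subfms by auto
  then have card: "|H| \<le>o r"
    unfolding H_def by (intro hull_of_ordLeq r countable_ordLeq_Cinfinite)
  \<comment> \<open>The operations accept the empty list, so the hull is nonempty even if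
    \<open>X\<close> is empty.\<close>
  have "wit \<phi> [] \<in> H"
    unfolding H_def by (rule hull_of_closed) (auto simp: G_def subfms_self)
  then have ne: "H \<noteq> {}" by blast
  have strN: "is_struct L N"
  proof (rule is_structI)
    fix f xs assume f: "(f, length xs) \<in> funs L" and xs: "set xs \<subseteq> univ N"
    have "fint M f xs \<in> univ M" using is_struct_fint[OF M f] xs HM N by simp
    moreover have "fop f xs \<in> H" unfolding H_def
      by (rule hull_of_closed) (use xs N in \<open>auto simp: G_def H_def\<close>)
    ultimately show "fint N f xs \<in> univ N" by (simp add: N fop_def)
  qed (use ne N in simp)
  \<comment> \<open>Finitely many free variables are inherited by all subformulas, since a
    quantifier removes only one; this lets a list carry all relevant values of an
    assignment.\<close>
  have main: "subfms \<psi> \<subseteq> subfms \<phi> \<Longrightarrow> finite (free_vars \<psi>) \<Longrightarrow> range e \<subseteq> H \<Longrightarrow>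
      sat N \<psi> e \<longleftrightarrow> sat M \<psi> e" for \<psi> e
  proof (induction \<psi> arbitrary: e)
    case (Eq s t)
    then show ?case by (simp add: N_def)
  next
    case (Rel R ts)
    then show ?case by (simp add: N_def)
  next
    case (Neg \<psi>)
    then show ?case by simp
  next
    case (Conj \<Psi>)
    have "sat N (\<Psi> i) e \<longleftrightarrow> sat M (\<Psi> i) e" for i
    proof (rule Conj.IH)
      show "subfms (\<Psi> i) \<subseteq> subfms \<phi>" using Conj.prems(1) by auto
      show "finite (free_vars (\<Psi> i))"
        using Conj.prems(2) by (rule finite_subset[rotated]) auto
    qed (use Conj.prems in auto)
    then show ?case by simp
  next
    case (All x \<psi>)
    have IH: "sat N \<psi> (e(x := a)) \<longleftrightarrow> sat M \<psi> (e(x := a))" if "a \<in> H" for a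
    proof (rule All.IH)
      show "subfms \<psi> \<subseteq> subfms \<phi>" using All.prems(1) by auto
      show "finite (free_vars \<psi>)" using All.prems(2) by simp
      show "range (e(x := a)) \<subseteq> H" using All.prems(3) that by auto
    qed
    have "\<forall>a \<in> univ M. sat M \<psi> (e(x := a))" if *: "\<forall>a \<in> H. sat M \<psi> (e(x := a))"
    proof (rule ccontr)
      assume "\<not> (\<forall>a \<in> univ M. sat M \<psi> (e(x := a)))"
      then obtain a where a: "a \<in> univ M" "\<not> sat M \<psi> (e(x := a))" by blast
      have "finite (free_vars \<psi>)" using All.prems(2) by simp
      then obtain b where b: "\<And>v. v \<in> free_vars \<psi> \<Longrightarrow> v < b"
        using finite_nat_set_iff_bounded[of "free_vars \<psi>"] by auto
      \<comment> \<open>\<open>b\<close> bounds the free variables, so this initial piece of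
        \<open>e\<close> decides \<open>\<psi>\<close> and can be handed to the witness
        operation.\<close>
      define xs where "xs = map e [0..<b]"
      have eq: "sat M \<psi> (((!) xs)(x := c)) = sat M \<psi> (e(x := c))" for c
        by (rule sat_cong) (use b in \<open>auto simp: xs_def\<close>)
      have "\<not> sat M \<psi> (((!) xs)(x := wit (All x \<psi>) xs))"
        by (rule wit_sat) (use a eq in blast)
      moreover have "wit (All x \<psi>) xs \<in> H" unfolding H_def
      proof (rule hull_of_closed)
        show "wit (All x \<psi>) \<in> G" using All.prems(1) unfolding G_def by auto
        show "set xs \<subseteq> hull_of G X" using All.prems(3) unfolding xs_def H_def by auto
      qed
      ultimately show False using * eq by blast
    qed
    then show ?case using IH HM N(1) by auto
  qed
  obtain a where a: "a \<in> H" using ne by blast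
  have "models N \<phi> \<longleftrightarrow> models M \<phi>"
    using main[of \<phi> "\<lambda>_. a"] a \<phi> models_sentence_iff[OF strN \<phi>] models_sentence_iff[OF M \<phi>]
    unfolding is_sentence_def by auto
  moreover have "X \<subseteq> H" unfolding H_def by (rule subset_hull_of)
  ultimately show ?thesis using HM card strN N(1) by blast
qed

lemma models_conj_Neg:
  assumes "is_struct L K" "is_sentence L \<phi>" "is_sentence L \<psi>"
  shows "models K (conj_set {\<phi>, Neg \<psi>}) \<longleftrightarrow> models K \<phi> \<and> \<not> models K \<psi>"
proof -
  have "is_sentence L (conj_set {\<phi>, Neg \<psi>})"
    using assms(2,3) unfolding is_sentence_def by simp
  then show ?thesis
    by (simp add: models_sentence_iff[OF assms(1), of _ undefined] assms(2,3))
qed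

text \<open>By definition \<open>\<phi>\<close> only controls structures over the natural numbers. A
  model of \<open>\<phi>\<close> violating \<open>scott_fm L M\<close> would have a countable
  substructure with the same property, and a copy of it over the natural numbers would be isomorphic
  to \<open>M\<close>, a contradiction.\<close>

theorem scott_sentence_models_iff:
  fixes N :: "'b struct"
  assumes \<phi>: "scott_sentence L M \<phi>" and M: "is_struct L M" and N: "is_struct L N"
  shows "models N \<phi> \<longleftrightarrow> bf_equiv L M N"
proof
  have sent: "is_sentence L \<phi>" using \<phi> unfolding scott_sentence_def by blast
  let ?\<sigma> = "scott_fm L M"
  assume "models N \<phi>"
  have "models N ?\<sigma>"
  proof (rule ccontr)
    assume "\<not> models N ?\<sigma>"
    let ?\<chi> = "conj_set {\<phi>, Neg ?\<sigma>}"
    have \<chi>: "is_sentence L ?\<chi>"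
      using sent is_sentence_scott_fm[of L M] unfolding is_sentence_def by simp
    from lowenheim_skolem_downward[OF N \<chi> empty_subsetI Cinfinite_nat] obtain K :: "'b struct" where
      K: "is_struct L K" "|univ K| \<le>o |UNIV :: nat set|" "models K ?\<chi>"
      using models_conj_Neg[OF N sent is_sentence_scott_fm[of L M]] \<open>models N \<phi>\<close>
        \<open>\<not> models N ?\<sigma>\<close> by (auto simp: card_of_empty)
    obtain h :: "_ \<Rightarrow> nat" where "inj_on h (univ K)"
      using K(2) by (auto simp: card_of_ordLeq[symmetric])
    from isomorphic_copy[OF K(1) this] obtain J :: "nat struct" where
      J: "is_struct L J" "isomorphic L K J" by blast
    have "models J ?\<chi>" using isomorphic_models[OF J(2) K(1) J(1) \<chi>] K(3) by blast
    then have "models J \<phi>" "\<not> models J ?\<sigma>" 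
      using models_conj_Neg[OF J(1) sent is_sentence_scott_fm[of L M]] by auto
    then have "isomorphic L M J" using \<phi> J(1) unfolding scott_sentence_def by blast
    then have "models J ?\<sigma>"
      unfolding models_scott_fm_iff[OF M J(1)] by (rule isomorphic_bf_equiv[OF _ M])
    with \<open>\<not> models J ?\<sigma>\<close> show False by blast
  qed
  then show "bf_equiv L M N" using models_scott_fm_iff[OF M N] by blast
next
  assume "bf_equiv L M N"
  have "isomorphic L M M" by (rule isomorphicI[of id]) auto
  then have "models M \<phi>" using \<phi> M unfolding scott_sentence_def by blast
  then show "models N \<phi>"
    using bf_equiv_models[OF \<open>bf_equiv L M N\<close> M N] \<phi> unfolding scott_sentence_def by blast
qed

section \<open>Edge colorings without bad triangles\<close>

definition triangle_free :: "'f set \<Rightarrow> ('f \<Rightarrow> 'f \<Rightarrow> 'b) \<Rightarrow> ('f \<Rightarrow> 'f \<Rightarrow> 'a) \<Rightarrow> bool" where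
  "triangle_free F d c \<longleftrightarrow> (\<forall>x \<in> F. \<forall>y \<in> F. \<forall>z \<in> F. x \<noteq> y \<longrightarrow> x \<noteq> z \<longrightarrow> y \<noteq> z \<longrightarrow>
     \<not> (d x y = d x z \<and> d x z = d y z \<and> c x y = c x z))"

lemma triangle_freeD:
  "triangle_free F d c \<Longrightarrow> x \<in> F \<Longrightarrow> y \<in> F \<Longrightarrow> z \<in> F \<Longrightarrow> x \<noteq> y \<Longrightarrow> x \<noteq> z \<Longrightarrow> y \<noteq> z \<Longrightarrow>
   d x y = d x z \<Longrightarrow> d x z = d y z \<Longrightarrow> c x y = c x z \<Longrightarrow> False"
  unfolding triangle_free_def by blast

definition colored :: "'a set \<Rightarrow> 'b set \<Rightarrow> 'f set \<Rightarrow> ('f \<Rightarrow> 'f \<Rightarrow> 'b) \<Rightarrow> ('f \<Rightarrow> 'f \<Rightarrow> 'a) \<Rightarrow> bool" where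
  "colored A B F d c \<longleftrightarrow> triangle_free F d c \<and> (\<forall>x \<in> F. \<forall>y \<in> F. x \<noteq> y \<longrightarrow> d x y \<in> B \<and> c x y \<in> A)"

text \<open>The first factor holds the order of the branch of a point, transported to the colors
  \<open>d\<close> along it; the second holds the function sending such a color to the corresponding
  color \<open>c\<close>.\<close>

theorem colored_ordLeq:
  fixes F :: "'f set" and d :: "'f \<Rightarrow> 'f \<Rightarrow> 'b" and c :: "'f \<Rightarrow> 'f \<Rightarrow> 'a"
  assumes "colored A B F d c" "A \<noteq> {}"
  shows "|F| \<le>o |Pow (B \<times> B) \<times> Func B A|"
proof -
  have tf: "triangle_free F d c"
    and dB: "\<And>x y. x \<in> F \<Longrightarrow> y \<in> F \<Longrightarrow> x \<noteq> y \<Longrightarrow> d x y \<in> B"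
    and cA: "\<And>x y. x \<in> F \<Longrightarrow> y \<in> F \<Longrightarrow> x \<noteq> y \<Longrightarrow> c x y \<in> A"
    using assms(1) unfolding colored_def by blast+
  obtain a0 where a0: "a0 \<in> A" using \<open>A \<noteq> {}\<close> by blast
  obtain W where W: "well_order_on F W" using well_order_on by blast
  define s where "s = W - Id"
  have wf: "wf s" using W unfolding well_order_on_def s_def by blast
  have s_total: "x = y \<or> (x, y) \<in> s \<or> (y, x) \<in> s" if "x \<in> F" "y \<in> F" for x y
    using W that unfolding well_order_on_def linear_order_on_def total_on_def s_def by blast
  have s_trans: "(x, z) \<in> s" if "(x, y) \<in> s" "(y, z) \<in> s" for x y z
  proof -
    have "trans W" "antisym W"
      using W unfolding well_order_on_def linear_order_on_def partial_order_on_def preorder_on_def by auto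
    then show ?thesis using that unfolding s_def by (auto dest: transD antisymD)
  qed
  have s_irrefl: "(x, x) \<notin> s" for x unfolding s_def by blast
  \<comment> \<open>the branch of the ramification tree of \<open>F\<close> that leads to \<open>f\<close>\<close>
  define On where "On f = wfrec s (\<lambda>g x. x \<in> F \<and> (x, f) \<in> s \<and>
     (\<forall>y. (y, x) \<in> s \<longrightarrow> g y \<longrightarrow> d y x = d y f \<and> c y x = c y f))" for f
  have On: "On f x \<longleftrightarrow> x \<in> F \<and> (x, f) \<in> s \<and>
     (\<forall>y. (y, x) \<in> s \<longrightarrow> On f y \<longrightarrow> d y x = d y f \<and> c y x = c y f)" for f x
    unfolding On_def by (subst wfrec[OF wf]) (simp add: cut_apply)
  have OnF: "x \<in> F" "(x, f) \<in> s" if "On f x" for f x using that On by blast+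
  have On_col: "d y x = d y f" "c y x = c y f" if "On f x" "On f y" "(y, x) \<in> s" for f x y
    using that On by blast+
  have ne: "x \<noteq> f" if "On f x" for f x using OnF(2)[OF that] s_irrefl by blast
  \<comment> \<open>With \<open>x\<close> before \<open>y\<close> on the branch, \<open>y\<close>
    and \<open>f\<close> have the same colors over \<open>x\<close>, so a repeated color makes
    \<open>x\<close>, \<open>y\<close>, \<open>f\<close> a forbidden triangle.\<close>
  have inj1: False if "f \<in> F" "On f x" "On f y" "d x f = d y f" "(x, y) \<in> s" for f x y
  proof (rule triangle_freeD[OF tf OnF(1)[OF that(2)] OnF(1)[OF that(3)] that(1)])
    show "d x y = d x f" "c x y = c x f" using On_col that by blast+
    show "x \<noteq> y" using that(5) s_irrefl by blast
  qed (use that ne in blast)+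
  have inj: "x = y" if "f \<in> F" "On f x" "On f y" "d x f = d y f" for f x y
    using s_total[OF OnF(1)[OF that(2)] OnF(1)[OF that(3)]] inj1[of f x y] inj1[of f y x] that by auto
  \<comment> \<open>The reflexive pairs ensure that \<open>\<rho> f\<close> records every color of
    the branch, even if the branch has a single node.\<close>
  define \<rho> where "\<rho> f = {(d x f, d y f) |x y. On f x \<and> On f y \<and> ((x, y) \<in> s \<or> x = y)}" for f
  \<comment> \<open>\<open>a0\<close> fills the colors that do not occur on the branch, and
    \<open>undefined\<close> outside \<open>B\<close> is required by \<open>Func\<close>.\<close>
  define \<alpha> where "\<alpha> f = (\<lambda>b. if b \<in> B then
      if \<exists>x. On f x \<and> d x f = b then c (SOME x. On f x \<and> d x f = b) f else a0 else undefined)" for f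
  have \<alpha>: "\<alpha> f (d x f) = c x f" if "f \<in> F" "On f x" for f x
  proof -
    have "(SOME y. On f y \<and> d y f = d x f) = x"
      by (rule some_equality) (use inj that in blast)+
    moreover have "d x f \<in> B" using dB OnF that ne by blast
    ultimately show ?thesis unfolding \<alpha>_def using that by auto
  qed
  \<comment> \<open>Equal codes force equal branches with equal colors. Then the earlier point
    \<open>f\<close> satisfies the condition for lying on the branch of \<open>g\<close>, hence
    would lie on its own branch.\<close>
  have key: False if fg: "f \<in> F" "g \<in> F" "(f, g) \<in> s" and \<rho>eq: "\<rho> f = \<rho> g" and \<alpha>eq: "\<alpha> f = \<alpha> g" for f g
  proof -
    have \<rho>D: "\<exists>x y. On f x \<and> On f y \<and> ((x, y) \<in> s \<or> x = y) \<and> d x f = d u g \<and> d y f = d v g"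
      if "On g u" "On g v" "(u, v) \<in> s \<or> u = v" for u v
    proof -
      have "(d u g, d v g) \<in> \<rho> f" unfolding \<rho>eq using that unfolding \<rho>_def by blast
      then show ?thesis unfolding \<rho>_def by (auto simp: eq_commute)
    qed
    \<comment> \<open>Induction along the well-order. The node \<open>x'\<close> of the branch of
      \<open>g\<close> with the color of \<open>x\<close> exists by equality of codes;
      \<open>x' = x\<close> follows by excluding both orders.\<close>
    have claim: "On f x \<longrightarrow> On g x \<and> d x g = d x f \<and> c x g = c x f" for x
      using wf
    proof (induction x rule: wf_induct_rule)
      case (less x)
      show ?case
      proof
        assume x: "On f x"
        have "(d x f, d x f) \<in> \<rho> g" unfolding \<rho>eq[symmetric] using x unfolding \<rho>_def by blast
        then obtain x' where x': "On g x'" "d x' g = d x f" unfolding \<rho>_def by auto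
        have c': "c x' g = c x f" using \<alpha>[OF fg(1) x] \<alpha>[OF fg(2) x'(1)] x'(2) \<alpha>eq by simp
        have IH: "On g y" "d y g = d y f" "c y g = c y f" if "On f y" "(y, x) \<in> s" for y
          using less.IH that by blast+
        \<comment> \<open>If \<open>x\<close> came first, \<open>\<rho>\<close> would match the
          nodes of \<open>g\<close> before \<open>x'\<close> with nodes of \<open>f\<close> before
          \<open>x\<close>, which are the same points by induction. So \<open>x\<close> would
          qualify for the branch of \<open>g\<close>, and then, as a node before \<open>x'\<close>,
          would have to precede itself.\<close>
        have "\<not> (x, x') \<in> s"
        proof
          assume lt: "(x, x') \<in> s"
          have pre: "On f y \<and> (y, x) \<in> s" if y: "On g y" "(y, x') \<in> s" for y
          proof -
            obtain u v where uv: "On f u" "On f v" "(u, v) \<in> s \<or> u = v" "d u f = d y g" "d v f = d x' g"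
              using \<rho>D[OF y(1) x'(1)] y(2) by blast
            have "v = x" using inj[OF fg(1) uv(2) x] uv(5) x'(2) by simp
            have "u \<noteq> x"
            proof
              assume "u = x"
              then have "y = x'" using inj[OF fg(2) y(1) x'(1)] uv(4) x'(2) by simp
              then show False using y(2) s_irrefl by blast
            qed
            then have "(u, x) \<in> s" using uv(3) \<open>v = x\<close> by blast
            then have "u = y" using IH[OF uv(1)] inj[OF fg(2) _ y(1)] uv(4) by simp
            then show ?thesis using uv(1) \<open>(u, x) \<in> s\<close> by blast
          qed
          have "On g x"
            unfolding On[of g x]
          proof (intro conjI allI impI)
            show "x \<in> F" using OnF[OF x] by blast
            show "(x, g) \<in> s" using s_trans[OF lt] OnF[OF x'(1)] by blast
            fix y assume y: "(y, x) \<in> s" "On g y"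
            then have "On f y" using pre s_trans lt by blast
            then show "d y x = d y g" "c y x = c y g" using On_col[OF x _ y(1)] IH[OF _ y(1)] by simp_all
          qed
          from pre[OF this lt] show False using s_irrefl by blast
        qed
        \<comment> \<open>If \<open>x'\<close> came first, it would qualify for the branch of
          \<open>f\<close> by induction, and would have the color of \<open>x\<close> there, against
          injectivity of the colors along a branch.\<close>
        moreover have "\<not> (x', x) \<in> s"
        proof
          assume lt: "(x', x) \<in> s"
          have "On f x'"
            unfolding On[of f x']
          proof (intro conjI allI impI)
            show "x' \<in> F" using OnF[OF x'(1)] by blast
            show "(x', f) \<in> s" using s_trans[OF lt] OnF[OF x] by blast
            fix y assume y: "(y, x') \<in> s" "On f y"
            then have "(y, x) \<in> s" using s_trans lt by blast
            from IH[OF y(2) this] show "d y x' = d y f" "c y x' = c y f"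
              using On_col[OF x'(1) _ y(1)] by simp_all
          qed
          from IH[OF this lt] have "d x' f = d x f" using x'(2) by simp
          then have "x' = x" using inj[OF fg(1) \<open>On f x'\<close> x] by blast
          then show False using lt s_irrefl by blast
        qed
        ultimately have "x' = x" using s_total OnF(1)[OF x] OnF(1)[OF x'(1)] by blast
        then show "On g x \<and> d x g = d x f \<and> c x g = c x f" using x' c' by simp
      qed
    qed
    have conv: "On f y" if y: "On g y" for y
    proof -
      obtain u where u: "On f u" "d u f = d y g" using \<rho>D[OF y y] by blast
      then have "u = y" using claim[of u] inj[OF fg(2) _ y, of u] by simp
      then show ?thesis using u by simp
    qed
    have "On g f"
      unfolding On[of g f] using fg claim conv by metis
    then show False using conv[of f] OnF(2)[of f f] s_irrefl by blast
  qed
  have "inj_on (\<lambda>f. (\<rho> f, \<alpha> f)) F"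
  proof (rule inj_onI)
    fix f g assume "f \<in> F" "g \<in> F" "(\<rho> f, \<alpha> f) = (\<rho> g, \<alpha> g)"
    then show "f = g" using s_total[of f g] key[of f g] key[of g f] by auto
  qed
  moreover have "(\<lambda>f. (\<rho> f, \<alpha> f)) ` F \<subseteq> Pow (B \<times> B) \<times> Func B A"
  proof (intro image_subsetI SigmaI PowI)
    fix f assume f: "f \<in> F"
    show "\<rho> f \<subseteq> B \<times> B" unfolding \<rho>_def using dB OnF(1) ne f by blast
    have "c (SOME x. On f x \<and> d x f = b) f \<in> A" if "\<exists>x. On f x \<and> d x f = b" for b
      using someI_ex[OF that] cA[OF OnF(1) f] ne by blast
    then show "\<alpha> f \<in> Func B A" unfolding Func_def \<alpha>_def using a0 by auto
  qed
  ultimately show ?thesis by (intro card_of_ordLeqI[of "\<lambda>f. (\<rho> f, \<alpha> f)"]) blast+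
qed

section \<open>Generic colorings\<close>

text \<open>
  \<open>p\<close>, \<open>q\<close>, \<open>r\<close>, \<open>w\<close> are the colors \<open>d x y\<close>, \<open>d y x\<close>, \<open>c x y\<close>, \<open>c y x\<close> prescribed for a new
  point \<open>x\<close>; the three cases are the positions that \<open>x\<close> can take in a forbidden triangle.
\<close>

definition admissible :: "'f set \<Rightarrow> ('f \<Rightarrow> 'f \<Rightarrow> 'b) \<Rightarrow> ('f \<Rightarrow> 'f \<Rightarrow> 'a) \<Rightarrow>
    ('f \<Rightarrow> 'b) \<Rightarrow> ('f \<Rightarrow> 'b) \<Rightarrow> ('f \<Rightarrow> 'a) \<Rightarrow> ('f \<Rightarrow> 'a) \<Rightarrow> bool" where
  "admissible X d c p q r w \<longleftrightarrow> (\<forall>y \<in> X. \<forall>z \<in> X. y \<noteq> z \<longrightarrow>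
     \<not> (p y = p z \<and> p z = d y z \<and> r y = r z) \<and>
     \<not> (q y = d y z \<and> d y z = p z \<and> w y = c y z) \<and>
     \<not> (d y z = q y \<and> q y = q z \<and> c y z = w y))"

text \<open>The extension property of a Fraisse limit; one new point over a finite set is all that a
  back-and-forth step asks for.\<close>

definition generic :: "'a set \<Rightarrow> 'b set \<Rightarrow> 'f set \<Rightarrow> ('f \<Rightarrow> 'f \<Rightarrow> 'b) \<Rightarrow> ('f \<Rightarrow> 'f \<Rightarrow> 'a) \<Rightarrow> bool" where
  "generic A B F d c \<longleftrightarrow> (\<forall>X p q r w. finite X \<longrightarrow> X \<subseteq> F \<longrightarrow>
     (\<forall>y \<in> X. p y \<in> B \<and> q y \<in> B \<and> r y \<in> A \<and> w y \<in> A) \<longrightarrow> admissible X d c p q r w \<longrightarrow>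
     (\<exists>x \<in> F - X. \<forall>y \<in> X. d x y = p y \<and> d y x = q y \<and> c x y = r y \<and> c y x = w y))"

text \<open>
  The points of a generic coloring are built as terms: \<open>New l\<close> is a point realizing the prescription
  \<open>l\<close>. Pairs without a prescription receive a color at which their codes differ and which is not
  prescribed by either of the two points. So a forbidden triangle could only lie inside a single
  prescription, where it is excluded by admissibility.
\<close>

datatype ('q, 'i) gen = Base 'q | New "(('q, 'i) gen \<times> 'i) list"

primrec prescr :: "('q, 'i) gen \<Rightarrow> (('q, 'i) gen \<times> 'i) list" where
  "prescr (Base q) = []"
| "prescr (New l) = l"

definition linked :: "('q, 'i) gen \<Rightarrow> ('q, 'i) gen \<Rightarrow> bool" where
  "linked x y \<longleftrightarrow> y \<in> fst ` set (prescr x)"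

text \<open>A prescription mentions only proper subterms, so two points never prescribe colors for
  each other and links have no cycles.\<close>

lemma linked_size:
  assumes "linked x y"
  shows "size y < size x"
proof (cases x)
  case (New l)
  have "(y, i) \<in> set l \<Longrightarrow> size y < Suc (size_list (\<lambda>p. Suc (size (fst p))) l)" for i
    by (induction l) auto
  moreover have "size x = Suc (size_list (\<lambda>p. Suc (size (fst p))) l)"
    by (simp add: New size_prod_simp)
  ultimately show ?thesis using assms New unfolding linked_def by auto
qed (use assms in \<open>simp add: linked_def\<close>)

lemma linked_acyclic: "\<not> (linked x y \<and> linked y z \<and> linked z x)"
  using linked_size[of x y] linked_size[of y z] linked_size[of z x] by auto

lemma map_of_prescr_None: "\<not> linked x y \<Longrightarrow> map_of (prescr x) y = None"
  unfolding linked_def by (simp add: map_of_eq_None_iff)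

type_synonym ('b, 'a) info = "'b \<times> 'b \<times> 'a \<times> 'a"

definition used :: "('q, ('b, 'a) info) gen \<Rightarrow> 'b set" where
  "used x = (\<Union>(y, p, q, r, w) \<in> set (prescr x). {p, q})"

definition fallback :: "'b set \<Rightarrow> (('q, ('b, 'a) info) gen \<Rightarrow> 'b \<Rightarrow> 'a) \<Rightarrow>
    ('q, ('b, 'a) info) gen \<Rightarrow> ('q, ('b, 'a) info) gen \<Rightarrow> 'b" where
  "fallback B code x y = (SOME b. b \<in> B \<and> code x b \<noteq> code y b \<and> b \<notin> used x \<union> used y)"

definition gen_d :: "'b set \<Rightarrow> (('q, ('b, 'a) info) gen \<Rightarrow> 'b \<Rightarrow> 'a) \<Rightarrow>
    ('q, ('b, 'a) info) gen \<Rightarrow> ('q, ('b, 'a) info) gen \<Rightarrow> 'b" where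
  "gen_d B code x y = (case map_of (prescr x) y of Some (p, q, r, w) \<Rightarrow> p
     | None \<Rightarrow> (case map_of (prescr y) x of Some (p, q, r, w) \<Rightarrow> q | None \<Rightarrow> fallback B code x y))"

text \<open>Without a prescription this is the coloring of functions: \<open>d\<close> gives a place
  of difference and \<open>c\<close> the value of the second function there.\<close>

definition gen_c :: "'b set \<Rightarrow> (('q, ('b, 'a) info) gen \<Rightarrow> 'b \<Rightarrow> 'a) \<Rightarrow>
    ('q, ('b, 'a) info) gen \<Rightarrow> ('q, ('b, 'a) info) gen \<Rightarrow> 'a" where
  "gen_c B code x y = (case map_of (prescr x) y of Some (p, q, r, w) \<Rightarrow> r
     | None \<Rightarrow> (case map_of (prescr y) x of Some (p, q, r, w) \<Rightarrow> w
     | None \<Rightarrow> code y (fallback B code x y)))"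

text \<open>The colors are defined on all terms beforehand, so admissibility can refer to them
  without a simultaneous recursion. Taking prescriptions from functions prevents conflicts between
  repeated entries of \<open>ys\<close>.\<close>

inductive_set gens :: "'q set \<Rightarrow> 'a set \<Rightarrow> 'b set \<Rightarrow> (('q, ('b, 'a) info) gen \<Rightarrow> 'b \<Rightarrow> 'a) \<Rightarrow>
    ('q, ('b, 'a) info) gen set" for Q A B code where
  Base: "v \<in> Q \<Longrightarrow> Base v \<in> gens Q A B code"
| New: "(\<And>y. y \<in> set ys \<Longrightarrow> y \<in> gens Q A B code) \<Longrightarrow>
    (\<And>y. y \<in> set ys \<Longrightarrow> p y \<in> B \<and> q y \<in> B \<and> r y \<in> A \<and> w y \<in> A) \<Longrightarrow>
    admissible (set ys) (gen_d B code) (gen_c B code) p q r w \<Longrightarrow>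
    New (map (\<lambda>y. (y, p y, q y, r y, w y)) ys) \<in> gens Q A B code"

lemma gen_prescribed:
  assumes "x = New (map (\<lambda>y. (y, p y, q y, r y, w y)) ys)" "y \<in> set ys"
  shows "gen_d B code x y = p y" "gen_d B code y x = q y" "gen_c B code x y = r y" "gen_c B code y x = w y"
    "linked x y" "p y \<in> used x" "q y \<in> used x"
proof -
  show l: "linked x y" using assms by (auto simp: linked_def image_iff)
  then have "\<not> linked y x" using linked_size[of x y] linked_size[of y x] by auto
  then have 1: "map_of (prescr y) x = None" by (rule map_of_prescr_None)
  have 2: "map_of (prescr x) y = Some (p y, q y, r y, w y)"
    using assms by (simp add: map_of_map_restrict)
  show "gen_d B code x y = p y" "gen_d B code y x = q y" "gen_c B code x y = r y" "gen_c B code y x = w y"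
    unfolding gen_d_def gen_c_def 1 2 by simp_all
  show "p y \<in> used x" "q y \<in> used x" unfolding used_def using assms by auto
qed

lemma gens_linkedD:
  assumes "x \<in> gens Q A B code" "linked x y"
  shows "gen_d B code x y \<in> used x \<inter> B" "gen_d B code y x \<in> used x \<inter> B"
    "gen_c B code x y \<in> A" "gen_c B code y x \<in> A"
proof -
  from assms have *: "gen_d B code x y \<in> used x \<inter> B \<and> gen_d B code y x \<in> used x \<inter> B \<and>
    gen_c B code x y \<in> A \<and> gen_c B code y x \<in> A"
  proof (cases rule: gens.cases)
    case (New ys p q r w)
    then have y: "y \<in> set ys" using assms(2) by (auto simp: linked_def)
    show ?thesis using gen_prescribed[OF New(1) y] New(3)[OF y] by simp
  qed (simp add: linked_def)
  then show "gen_d B code x y \<in> used x \<inter> B" "gen_d B code y x \<in> used x \<inter> B"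
    "gen_c B code x y \<in> A" "gen_c B code y x \<in> A" by auto
qed

text \<open>The clauses of \<open>admissible\<close> read back for the actual colors:
  \<open>x\<close> is the first, second and third vertex of the triangle, respectively.\<close>

lemma gens_linked2D:
  assumes "x \<in> gens Q A B code" "linked x y" "linked x z" "y \<noteq> z"
  shows "\<not> (gen_d B code x y = gen_d B code x z \<and> gen_d B code x z = gen_d B code y z \<and>
      gen_c B code x y = gen_c B code x z)"
    "\<not> (gen_d B code y x = gen_d B code y z \<and> gen_d B code y z = gen_d B code x z \<and>
      gen_c B code y x = gen_c B code y z)"
    "\<not> (gen_d B code y z = gen_d B code y x \<and> gen_d B code y x = gen_d B code z x \<and>
      gen_c B code y z = gen_c B code y x)"
proof -
  obtain ys p q r w where New: "x = New (map (\<lambda>y. (y, p y, q y, r y, w y)) ys)"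
      "admissible (set ys) (gen_d B code) (gen_c B code) p q r w"
    using assms(1,2) by (cases rule: gens.cases) (auto simp: linked_def)
  have y: "y \<in> set ys" and z: "z \<in> set ys" using assms(2,3) New(1) by (auto simp: linked_def)
  note * = New(2)[unfolded admissible_def, rule_format, OF y z assms(4)]
  show "\<not> (gen_d B code x y = gen_d B code x z \<and> gen_d B code x z = gen_d B code y z \<and>
      gen_c B code x y = gen_c B code x z)"
    "\<not> (gen_d B code y x = gen_d B code y z \<and> gen_d B code y z = gen_d B code x z \<and>
      gen_c B code y x = gen_c B code y z)"
    "\<not> (gen_d B code y z = gen_d B code y x \<and> gen_d B code y x = gen_d B code z x \<and>
      gen_c B code y z = gen_c B code y x)"
    using * gen_prescribed(1-4)[OF New(1) y, of B code] gen_prescribed(1-4)[OF New(1) z, of B code]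
    by auto
qed

text \<open>The term listing the prescription over \<open>X\<close> realizes it, and it lies outside
  \<open>X\<close> because no term lists itself.\<close>

lemma generic_gens: "generic A B (gens Q A B code) (gen_d B code) (gen_c B code)"
  unfolding generic_def
proof (intro allI impI)
  fix X p q r w
  assume X: "finite X" "X \<subseteq> gens Q A B code"
    and v: "\<forall>y \<in> X. p y \<in> B \<and> q y \<in> B \<and> r y \<in> A \<and> w y \<in> A"
    and adm: "admissible X (gen_d B code) (gen_c B code) p q r w"
  obtain ys where ys: "set ys = X" using X(1) finite_list by blast
  define x where "x = New (map (\<lambda>y. (y, p y, q y, r y, w y)) ys)"
  have "x \<in> gens Q A B code"
    unfolding x_def by (rule gens.New) (use X(2) v adm ys in auto)
  moreover have "x \<notin> X"
  proof
    assume "x \<in> X"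
    then have "linked x x" using gen_prescribed(5)[OF x_def] ys by blast
    then show False using linked_size by blast
  qed
  moreover have "\<forall>y \<in> X. gen_d B code x y = p y \<and> gen_d B code y x = q y \<and>
      gen_c B code x y = r y \<and> gen_c B code y x = w y"
    using gen_prescribed(1-4)[OF x_def] ys by blast
  ultimately show "\<exists>x \<in> gens Q A B code - X. \<forall>y \<in> X. gen_d B code x y = p y \<and> gen_d B code y x = q y \<and>
      gen_c B code x y = r y \<and> gen_c B code y x = w y" by blast
qed

text \<open>A point prescribes only finitely many colors, so infinitely many differences of the
  codes leave one that neither point prescribes.\<close>

lemma gens_fallback:
  assumes "infinite {b \<in> B. code x b \<noteq> code y b}" "\<not> linked x y" "\<not> linked y x"
  shows "gen_d B code x y \<in> B" "gen_d B code x y \<notin> used x \<union> used y"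
    "code x (gen_d B code x y) \<noteq> code y (gen_d B code x y)"
    "gen_c B code x y = code y (gen_d B code x y)"
proof -
  have d: "gen_d B code x y = fallback B code x y" and c: "gen_c B code x y = code y (fallback B code x y)"
    unfolding gen_d_def gen_c_def map_of_prescr_None[OF assms(2)] map_of_prescr_None[OF assms(3)] by simp_all
  have "finite (used x \<union> used y)" unfolding used_def by auto
  then have "\<exists>b. b \<in> B \<and> code x b \<noteq> code y b \<and> b \<notin> used x \<union> used y"
    using assms(1) by (smt (verit, best) finite_subset mem_Collect_eq subsetI)
  from someI_ex[OF this, folded fallback_def] show "gen_d B code x y \<in> B"
    "gen_d B code x y \<notin> used x \<union> used y" "code x (gen_d B code x y) \<noteq> code y (gen_d B code x y)"
    "gen_c B code x y = code y (gen_d B code x y)" using c d by auto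
qed

lemma triangle_free_gens:
  assumes code: "\<And>x y. x \<in> gens Q A B code \<Longrightarrow> y \<in> gens Q A B code \<Longrightarrow> x \<noteq> y \<Longrightarrow>
    infinite {b \<in> B. code x b \<noteq> code y b}"
  shows "triangle_free (gens Q A B code) (gen_d B code) (gen_c B code)"
  unfolding triangle_free_def
proof (intro ballI impI notI)
  let ?G = "gens Q A B code" and ?d = "gen_d B code" and ?c = "gen_c B code"
  \<comment> \<open>Which direction of a pair carries the color does not matter for comparing it
    with \<open>used\<close>, so the three vertices can be treated alike.\<close>
  define D where "D u v b \<longleftrightarrow> ?d u v = b \<or> ?d v u = b" for u v b
  have D_sym: "D u v b \<longleftrightarrow> D v u b" for u v b unfolding D_def by blast
  have D_linked: "b \<in> used u" if "linked u v" "D u v b" "u \<in> ?G" for u v b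
    using gens_linkedD(1,2)[OF that(3,1)] that(2) unfolding D_def by blast
  have D_free: "b \<notin> used u \<and> b \<notin> used v"
    if "\<not> linked u v" "\<not> linked v u" "D u v b" "u \<in> ?G" "v \<in> ?G" "u \<noteq> v" for u v b
    using gens_fallback(2)[OF code[OF that(4,5,6)] that(1,2)]
      gens_fallback(2)[OF code[OF that(5,4)] that(2,1)] that(3,6) unfolding D_def by blast
  \<comment> \<open>The color of the unlinked pair \<open>u\<close>, \<open>v\<close> is prescribed
    by neither. So the link with \<open>u\<close> must start at \<open>t\<close>; then
    \<open>t\<close> prescribes the color, and the pair \<open>t\<close>, \<open>v\<close> cannot
    carry a fallback color either.\<close>
  have mixed: "linked t u \<and> linked t v"
    if "\<not> linked u v" "\<not> linked v u" "linked u t \<or> linked t u" "D u v b" "D u t b" "D v t b"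
      "u \<in> ?G" "v \<in> ?G" "t \<in> ?G" "u \<noteq> v" "u \<noteq> t" "v \<noteq> t" for u v t b
  proof -
    have "b \<notin> used u" "b \<notin> used v" using D_free[OF that(1,2,4,7,8,10)] by auto
    then have "\<not> linked u t" "\<not> linked v t" using D_linked that by blast+
    then have "linked t u" using that(3) by blast
    then have "b \<in> used t" using D_linked[of t u b] that D_sym by blast
    then have "linked t v"
      using D_free[of v t b] \<open>\<not> linked v t\<close> that by blast
    with \<open>linked t u\<close> show ?thesis by blast
  qed
  fix x y z assume G: "x \<in> ?G" "y \<in> ?G" "z \<in> ?G" and ne: "x \<noteq> y" "x \<noteq> z" "y \<noteq> z"
    and bad: "?d x y = ?d x z \<and> ?d x z = ?d y z \<and> ?c x y = ?c x z"
  define b where "b = ?d x y"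
  have DD: "D x y b" "D x z b" "D y z b" "D y x b" "D z x b" "D z y b"
    unfolding D_def b_def using bad by auto
  have "\<not> (linked x y \<and> linked x z)"
    using gens_linked2D(1)[OF G(1) _ _ ne(3)] bad by blast
  moreover have "\<not> (linked y x \<and> linked y z)"
    using gens_linked2D(2)[OF G(2), of x z] ne bad by blast
  moreover have "\<not> (linked z x \<and> linked z y)"
    using gens_linked2D(3)[OF G(3), of x y] ne bad by metis
  \<comment> \<open>By \<open>mixed\<close>, one linked pair next to an unlinked one would make some
    vertex prescribe for both others, which was just excluded. So all pairs are linked or none; if
    all are and no vertex prescribes twice, the links form a cycle.\<close>
  moreover have "linked x y \<or> linked y x"  if "linked x z \<or> linked z x \<or> linked y z \<or> linked z y"
    using mixed[of x y z b] mixed[of y x z b] that DD G ne calculation by metis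
  moreover have "linked x z \<or> linked z x" if "linked x y \<or> linked y x \<or> linked y z \<or> linked z y"
    using mixed[of x z y b] mixed[of z x y b] that DD G ne calculation by metis
  moreover have "linked y z \<or> linked z y" if "linked x y \<or> linked y x \<or> linked x z \<or> linked z x"
    using mixed[of y z x b] mixed[of z y x b] that DD G ne calculation by metis
  ultimately have free: "\<not> (linked x y \<or> linked y x \<or> linked x z \<or> linked z x \<or> linked y z \<or> linked z y)"
    using linked_acyclic[of x y z] linked_acyclic[of x z y] by blast
  \<comment> \<open>Without links, \<open>x\<close> sees the codes of \<open>y\<close> and
    \<open>z\<close> at \<open>b\<close>, and these differ because \<open>b\<close> is also the
    fallback color of \<open>y\<close>, \<open>z\<close>.\<close>
  then have "?c x y = code y b" "?c x z = code z b"
    using gens_fallback(4)[OF code[OF G(1,2) ne(1)]] gens_fallback(4)[OF code[OF G(1,3) ne(2)]]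
      bad unfolding b_def by auto
  moreover have "code y b \<noteq> code z b"
    using gens_fallback(3)[OF code[OF G(2,3) ne(3)]] free bad unfolding b_def by auto
  ultimately show False using bad by simp
qed

text \<open>The base points indexed by \<open>Q\<close> bring the size up to \<open>r\<close>, and
  \<open>rF\<close> supplies enough functions to serve as distinct codes. The same construction
  yields the countable and the large coloring.\<close>

theorem exists_generic_coloring:
  fixes A :: "'a set" and B :: "'b set" and Q :: "'q set"
  assumes r: "Cinfinite r" and B: "infinite B" and cards: "|A| \<le>o r" "|B| \<le>o r" "|Q| =o r"
    and rF: "r \<le>o |Func B A|"
  shows "\<exists>(F :: ('q, ('b, 'a) info) gen set) d c. |F| =o r \<and> colored A B F d c \<and>
    generic A B F d c"
proof -
  \<comment> \<open>Codes must be chosen before \<open>gens\<close> can be formed, since membership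
    there depends on them. So distinct codes are given to the larger set \<open>T\<close> of all
    terms with prescriptions from \<open>A\<close> and \<open>B\<close>, admissible or not.\<close>
  define ops :: "(('q, ('b, 'a) info) gen list \<Rightarrow> ('q, ('b, 'a) info) gen) set"
    where "ops = (\<lambda>is xs. New (zip xs is)) ` lists (B \<times> B \<times> A \<times> A)"
  define T where "T = hull_of ops (Base ` Q)"
  have QT: "|Base ` Q| \<le>o r" by (rule image_ordLeq) (rule ordIso_imp_ordLeq[OF cards(3)])
  have Tr: "|T| \<le>o r" unfolding T_def ops_def
    by (intro hull_of_ordLeq r QT image_ordLeq lists_ordLeq_Cinfinite Times_ordLeq_Cinfinite cards)
  obtain j where j: "inj_on j T" "j ` T \<subseteq> Func B A"
    using ordLeq_transitive[OF Tr rF] by (auto simp: card_of_ordLeq[symmetric])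
  \<comment> \<open>Through \<open>h\<close> every place of a code is repeated at infinitely many
    colors, so two codes that differ at all differ infinitely often.\<close>
  have "|B| =o |B \<times> (UNIV :: nat set)|"
    by (rule card_of_Times_infinite_simps(2)) (use B in \<open>auto simp: infinite_iff_card_of_nat[symmetric]\<close>)
  then obtain h where h: "bij_betw h B (B \<times> (UNIV :: nat set))"
    by (auto simp: card_of_ordIso[symmetric])
  define code where "code x b = j x (fst (h b))" for x b
  have sub: "gens Q A B code \<subseteq> T"
  proof
    fix x assume "x \<in> gens Q A B code"
    then show "x \<in> T"
    proof induction
      case (Base v)
      then show ?case unfolding T_def by (intro subsetD[OF subset_hull_of] imageI)
    next
      case (New ys p q r w)
      let ?is = "map (\<lambda>y. (p y, q y, r y, w y)) ys"
      have "(\<lambda>xs. New (zip xs ?is)) \<in> ops" unfolding ops_def using New(2) by (intro imageI) auto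
      from hull_of_closed[OF this, of ys "Base ` Q"] New.IH have "New (zip ys ?is) \<in> T"
        unfolding T_def by blast
      then show ?case by (simp add: zip_map2 zip_same_conv_map comp_def)
    qed
  qed
  have code_inf: "infinite {b \<in> B. code x b \<noteq> code y b}"
    if "x \<in> gens Q A B code" "y \<in> gens Q A B code" "x \<noteq> y" for x y
  proof -
    have xy: "x \<in> T" "y \<in> T" using that sub by auto
    then have "j x \<noteq> j y" "j x \<in> Func B A" "j y \<in> Func B A" using j that(3) unfolding inj_on_def by auto
    then obtain b where b: "b \<in> B" "j x b \<noteq> j y b" unfolding Func_def by fastforce
    have "inv_into B h ` ({b} \<times> UNIV) \<subseteq> {b' \<in> B. code x b' \<noteq> code y b'}"
    proof (rule image_subsetI)
      fix e assume e: "e \<in> {b} \<times> (UNIV :: nat set)"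
      then have "e \<in> h ` B" using h b(1) unfolding bij_betw_def by auto
      then have "inv_into B h e \<in> B" "h (inv_into B h e) = e" by (simp_all add: inv_into_into f_inv_into_f)
      then show "inv_into B h e \<in> {b' \<in> B. code x b' \<noteq> code y b'}"
        using e b(2) by (auto simp: code_def)
    qed
    moreover have "infinite (inv_into B h ` ({b} \<times> (UNIV :: nat set)))"
    proof -
      have "{b} \<times> (UNIV :: nat set) \<subseteq> h ` B" using h b(1) unfolding bij_betw_def by auto
      then have "inj_on (inv_into B h) ({b} \<times> (UNIV :: nat set))"
        by (rule inj_on_inv_into)
      then show ?thesis by (simp add: finite_image_iff finite_cartesian_product_iff)
    qed
    ultimately show ?thesis using finite_subset by blast
  qed
  have "|gens Q A B code| =o r"
  proof -
    have "|gens Q A B code| \<le>o r" using ordLeq_transitive[OF card_of_mono1[OF sub] Tr] .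
    moreover have "r \<le>o |gens Q A B code|"
    proof -
      have "|Q| \<le>o |gens Q A B code|"
        by (rule card_of_ordLeqI[of Base]) (auto simp: inj_on_def intro: gens.Base)
      then show ?thesis using ordIso_ordLeq_trans[OF ordIso_symmetric[OF cards(3)]] by blast
    qed
    ultimately show ?thesis by (simp add: ordIso_iff_ordLeq)
  qed
  moreover have "gen_d B code x y \<in> B \<and> gen_c B code x y \<in> A"
    if xy: "x \<in> gens Q A B code" "y \<in> gens Q A B code" "x \<noteq> y" for x y
  proof -
    consider "linked x y" | "linked y x" | "\<not> linked x y" "\<not> linked y x" by blast
    then show ?thesis
    proof cases
      case 1
      then show ?thesis using gens_linkedD[OF xy(1)] by blast
    next
      case 2
      then show ?thesis using gens_linkedD[OF xy(2)] by blast
    next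
      case 3
      note * = gens_fallback[OF code_inf[OF xy] 3]
      have "fst (h (gen_d B code x y)) \<in> B"
        using *(1) h unfolding bij_betw_def by (metis imageI mem_Times_iff)
      then have "code y (gen_d B code x y) \<in> A"
        using j(2) sub xy(2) unfolding code_def Func_def by auto
      then show ?thesis using * by simp
    qed
  qed
  moreover have "triangle_free (gens Q A B code) (gen_d B code) (gen_c B code)"
    by (rule triangle_free_gens) (rule code_inf)
  ultimately have "|gens Q A B code| =o r \<and>
      colored A B (gens Q A B code) (gen_d B code) (gen_c B code) \<and>
      generic A B (gens Q A B code) (gen_d B code) (gen_c B code)"
    using generic_gens[of A B Q code] unfolding colored_def by simp
  then show ?thesis by (intro exI)
qed

section \<open>The combined structure\<close>

datatype ('a, 'b, 'f) elt = InA 'a | InB 'b | InF 'f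

definition rel_lang :: lang where
  "rel_lang = \<lparr>funs = {}, rels = UNIV\<rparr>"

text \<open>
  The first component of the symbol is its kind, the second one is the name of the symbol of \<open>LA\<close> or
  \<open>LB\<close> that it stands for; function symbols are replaced by their graphs.
\<close>

inductive comb_rel :: "lang \<Rightarrow> 'a struct \<Rightarrow> lang \<Rightarrow> 'b struct \<Rightarrow> 'f set \<Rightarrow> ('f \<Rightarrow> 'f \<Rightarrow> 'b) \<Rightarrow>
    ('f \<Rightarrow> 'f \<Rightarrow> 'a) \<Rightarrow> nat \<times> nat \<Rightarrow> ('a, 'b, 'f) elt list \<Rightarrow> bool"
  for LA A LB B F d c where
  sortA: "a \<in> univ A \<Longrightarrow> comb_rel LA A LB B F d c (0, 0) [InA a]"
| sortB: "b \<in> univ B \<Longrightarrow> comb_rel LA A LB B F d c (8, 0) [InB b]"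
| colB: "x \<in> F \<Longrightarrow> y \<in> F \<Longrightarrow> x \<noteq> y \<Longrightarrow> comb_rel LA A LB B F d c (2, 0) [InF x, InF y, InB (d x y)]"
| colA: "x \<in> F \<Longrightarrow> y \<in> F \<Longrightarrow> x \<noteq> y \<Longrightarrow> comb_rel LA A LB B F d c (3, 0) [InF x, InF y, InA (c x y)]"
| relA: "set as \<subseteq> univ A \<Longrightarrow> (R, length as) \<in> rels LA \<Longrightarrow> rint A R as \<Longrightarrow>
    comb_rel LA A LB B F d c (4, R) (map InA as)"
| funA: "set as \<subseteq> univ A \<Longrightarrow> (f, length as) \<in> funs LA \<Longrightarrow> a \<in> univ A \<Longrightarrow> a = fint A f as \<Longrightarrow>
    comb_rel LA A LB B F d c (5, f) (map InA as @ [InA a])"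
| relB: "set bs \<subseteq> univ B \<Longrightarrow> (R, length bs) \<in> rels LB \<Longrightarrow> rint B R bs \<Longrightarrow>
    comb_rel LA A LB B F d c (6, R) (map InB bs)"
| funB: "set bs \<subseteq> univ B \<Longrightarrow> (f, length bs) \<in> funs LB \<Longrightarrow> b \<in> univ B \<Longrightarrow> b = fint B f bs \<Longrightarrow>
    comb_rel LA A LB B F d c (7, f) (map InB bs @ [InB b])"

definition comb :: "lang \<Rightarrow> 'a struct \<Rightarrow> lang \<Rightarrow> 'b struct \<Rightarrow> 'f set \<Rightarrow> ('f \<Rightarrow> 'f \<Rightarrow> 'b) \<Rightarrow> ('f \<Rightarrow> 'f \<Rightarrow> 'a)
    \<Rightarrow> ('a, 'b, 'f) elt struct" where
  "comb LA A LB B F d c = \<lparr>univ = InA ` univ A \<union> InB ` univ B \<union> InF ` F,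
     fint = \<lambda>_ _. undefined, rint = \<lambda>k. comb_rel LA A LB B F d c (prod_decode k)\<rparr>"

lemma comb_simps [simp]:
  "univ (comb LA A LB B F d c) = InA ` univ A \<union> InB ` univ B \<union> InF ` F"
  "rint (comb LA A LB B F d c) k = comb_rel LA A LB B F d c (prod_decode k)"
  unfolding comb_def by simp_all

lemma comb_rel_iff:
  "comb_rel LA A LB B F d c (0, 0) zs \<longleftrightarrow> (\<exists>a \<in> univ A. zs = [InA a])"
  "comb_rel LA A LB B F d c (8, 0) zs \<longleftrightarrow> (\<exists>b \<in> univ B. zs = [InB b])"
  "comb_rel LA A LB B F d c (2, 0) zs \<longleftrightarrow>
     (\<exists>x \<in> F. \<exists>y \<in> F. x \<noteq> y \<and> zs = [InF x, InF y, InB (d x y)])"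
  "comb_rel LA A LB B F d c (3, 0) zs \<longleftrightarrow>
     (\<exists>x \<in> F. \<exists>y \<in> F. x \<noteq> y \<and> zs = [InF x, InF y, InA (c x y)])"
  "comb_rel LA A LB B F d c (4, R) zs \<longleftrightarrow>
     (\<exists>as. set as \<subseteq> univ A \<and> (R, length as) \<in> rels LA \<and> rint A R as \<and> zs = map InA as)"
  "comb_rel LA A LB B F d c (5, R) zs \<longleftrightarrow>
     (\<exists>as a. set as \<subseteq> univ A \<and> (R, length as) \<in> funs LA \<and> a \<in> univ A \<and> a = fint A R as \<and>
        zs = map InA as @ [InA a])"
  "comb_rel LA A LB B F d c (6, R) zs \<longleftrightarrow>
     (\<exists>bs. set bs \<subseteq> univ B \<and> (R, length bs) \<in> rels LB \<and> rint B R bs \<and> zs = map InB bs)"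
  "comb_rel LA A LB B F d c (7, R) zs \<longleftrightarrow>
     (\<exists>bs b. set bs \<subseteq> univ B \<and> (R, length bs) \<in> funs LB \<and> b \<in> univ B \<and> b = fint B R bs \<and>
        zs = map InB bs @ [InB b])"
  by (auto elim!: comb_rel.cases intro: comb_rel.intros)

section \<open>Back-and-forth between combined structures\<close>

text \<open>A member of a system seen as a finite partial injection: the two parts are extended by
  sets of colors, whose order is irrelevant.\<close>

definition bf_pairs :: "('a list \<times> 'b list) set \<Rightarrow> ('a \<times> 'b) set \<Rightarrow> bool" where
  "bf_pairs S P \<longleftrightarrow> (\<exists>(xs, ys) \<in> S. P = set (zip xs ys))"

lemma bf_pairs_converse: "bf_pairs S P \<Longrightarrow> bf_pairs (S\<inverse>) (P\<inverse>)"
proof -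
  assume "bf_pairs S P"
  then obtain xs ys where "(xs, ys) \<in> S" "P = set (zip xs ys)" unfolding bf_pairs_def by blast
  moreover have "(set (zip xs ys))\<inverse> = set (zip ys xs)" by (auto simp: set_zip)
  ultimately show ?thesis unfolding bf_pairs_def by blast
qed

lemma bf_pairs_extend:
  assumes S: "bf_system L M N S" and P: "bf_pairs S P" and X: "finite X" "X \<subseteq> univ M"
  shows "\<exists>P'. bf_pairs S P' \<and> P \<subseteq> P' \<and> (\<forall>x \<in> X. \<exists>y. (x, y) \<in> P')"
proof -
  obtain xs ys where xy: "(xs, ys) \<in> S" "P = set (zip xs ys)" using P unfolding bf_pairs_def by blast
  obtain us where us: "set us = X" using X(1) finite_list by blast
  obtain vs where vs: "length vs = length us" "(xs @ us, ys @ vs) \<in> S"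
    using bf_system_forth_list[OF S xy(1), of us] us X(2) by blast
  have z: "zip (xs @ us) (ys @ vs) = zip xs ys @ zip us vs"
    using bf_systemD(1)[OF S xy(1)] by simp
  have "\<exists>y. (x, y) \<in> set (zip us vs)" if "x \<in> X" for x
    using that us vs(1) by (metis in_set_impl_in_set_zip1)
  then show ?thesis
    using vs(2) xy(2) z unfolding bf_pairs_def
    by (intro exI[of _ "set (zip (xs @ us) (ys @ vs))"] conjI bexI[OF _ vs(2)]) auto
qed

lemma bf_pairsD:
  assumes S: "bf_system L M N S" and P: "bf_pairs S P"
  shows "(x, y) \<in> P \<Longrightarrow> x \<in> univ M" "(x, y) \<in> P \<Longrightarrow> y \<in> univ N"
    "(x, y) \<in> P \<Longrightarrow> (x', y') \<in> P \<Longrightarrow> x = x' \<longleftrightarrow> y = y'"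
    "(f, length us) \<in> funs L \<Longrightarrow> list_all2 (\<lambda>u v. (u, v) \<in> P) us vs \<Longrightarrow>
      (x, y) \<in> P \<Longrightarrow> x = fint M f us \<longleftrightarrow> y = fint N f vs"
    "(R, length us) \<in> rels L \<Longrightarrow> list_all2 (\<lambda>u v. (u, v) \<in> P) us vs \<Longrightarrow> rint M R us \<longleftrightarrow> rint N R vs"
proof -
  obtain xs ys where xy: "(xs, ys) \<in> S" "P = set (zip xs ys)" using P unfolding bf_pairs_def by blast
  note D = bf_systemD[OF S xy(1)]
  show "(x, y) \<in> P \<Longrightarrow> x \<in> univ M" "(x, y) \<in> P \<Longrightarrow> y \<in> univ N"
    using D(2,3) unfolding xy(2) by (auto dest: set_zip_leftD set_zip_rightD)
  note Z = same_atoms_zipD[OF D(4,1), folded xy(2)]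
  show "(x, y) \<in> P \<Longrightarrow> (x', y') \<in> P \<Longrightarrow> x = x' \<longleftrightarrow> y = y'" by (rule Z(1))
  show "(f, length us) \<in> funs L \<Longrightarrow> list_all2 (\<lambda>u v. (u, v) \<in> P) us vs \<Longrightarrow>
      (x, y) \<in> P \<Longrightarrow> x = fint M f us \<longleftrightarrow> y = fint N f vs" by (rule Z(2))
  show "(R, length us) \<in> rels L \<Longrightarrow> list_all2 (\<lambda>u v. (u, v) \<in> P) us vs \<Longrightarrow> rint M R us \<longleftrightarrow> rint N R vs"
    by (rule Z(3))
qed

inductive corr for PA :: "('a \<times> 'c) set" and PB :: "('b \<times> 'd) set" and G :: "('f \<times> 'g) set" where
  corrA: "(a, a') \<in> PA \<Longrightarrow> corr PA PB G (InA a) (InA a')"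
| corrB: "(b, b') \<in> PB \<Longrightarrow> corr PA PB G (InB b) (InB b')"
| corrF: "(f, f') \<in> G \<Longrightarrow> corr PA PB G (InF f) (InF f')"

inductive_simps corr_simps [simp]:
  "corr PA PB G (InA a) z" "corr PA PB G (InB b) z" "corr PA PB G (InF f) z"
  "corr PA PB G z (InA a')" "corr PA PB G z (InB b')" "corr PA PB G z (InF f')"

lemma corr_converse: "corr PA PB G z z' \<Longrightarrow> corr (PA\<inverse>) (PB\<inverse>) (G\<inverse>) z' z"
  by (induction rule: corr.induct) (simp_all add: corr.intros)

lemma corr_mono: "corr PA PB G z z' \<Longrightarrow> PA \<subseteq> PA' \<Longrightarrow> PB \<subseteq> PB' \<Longrightarrow> G \<subseteq> G' \<Longrightarrow> corr PA' PB' G' z z'"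
  by (induction rule: corr.induct) (simp_all add: corr.intros subset_iff)

text \<open>The colors of all pairs of matched points must already be matched by \<open>PA\<close>
  and \<open>PB\<close>, so a later match of a color cannot contradict them.\<close>

definition comb_piso where
  "comb_piso SA SB F d c F' d' c' PA PB G \<longleftrightarrow> bf_pairs SA PA \<and> bf_pairs SB PB \<and> finite G \<and>
     (\<forall>(f, f') \<in> G. f \<in> F \<and> f' \<in> F') \<and>
     (\<forall>(f, f') \<in> G. \<forall>(g, g') \<in> G. (f = g \<longleftrightarrow> f' = g') \<and>
        (f \<noteq> g \<longrightarrow> (d f g, d' f' g') \<in> PB \<and> (c f g, c' f' g') \<in> PA))"

lemma comb_pisoD:
  assumes "comb_piso SA SB F d c F' d' c' PA PB G"
  shows "bf_pairs SA PA" "bf_pairs SB PB" "finite G" "(f, f') \<in> G \<Longrightarrow> f \<in> F" "(f, f') \<in> G \<Longrightarrow> f' \<in> F'"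
    "(f, f') \<in> G \<Longrightarrow> (g, g') \<in> G \<Longrightarrow> f = g \<longleftrightarrow> f' = g'"
    "(f, f') \<in> G \<Longrightarrow> (g, g') \<in> G \<Longrightarrow> f \<noteq> g \<Longrightarrow> (d f g, d' f' g') \<in> PB"
    "(f, f') \<in> G \<Longrightarrow> (g, g') \<in> G \<Longrightarrow> f \<noteq> g \<Longrightarrow> (c f g, c' f' g') \<in> PA"
proof -
  have G1: "\<And>p. p \<in> G \<Longrightarrow> fst p \<in> F \<and> snd p \<in> F'"
    and G2: "\<And>p q. p \<in> G \<Longrightarrow> q \<in> G \<Longrightarrow> (fst p = fst q \<longleftrightarrow> snd p = snd q) \<and>
      (fst p \<noteq> fst q \<longrightarrow> (d (fst p) (fst q), d' (snd p) (snd q)) \<in> PB \<and>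
        (c (fst p) (fst q), c' (snd p) (snd q)) \<in> PA)"
    using assms unfolding comb_piso_def split_beta by blast+
  show "bf_pairs SA PA" "bf_pairs SB PB" "finite G"
    using assms unfolding comb_piso_def by blast+
  show "(f, f') \<in> G \<Longrightarrow> f \<in> F" "(f, f') \<in> G \<Longrightarrow> f' \<in> F'" using G1[of "(f, f')"] by simp_all
  show "(f, f') \<in> G \<Longrightarrow> (g, g') \<in> G \<Longrightarrow> f = g \<longleftrightarrow> f' = g'"
    "(f, f') \<in> G \<Longrightarrow> (g, g') \<in> G \<Longrightarrow> f \<noteq> g \<Longrightarrow> (d f g, d' f' g') \<in> PB"
    "(f, f') \<in> G \<Longrightarrow> (g, g') \<in> G \<Longrightarrow> f \<noteq> g \<Longrightarrow> (c f g, c' f' g') \<in> PA"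
    using G2[of "(f, f')" "(g, g')"] by simp_all
qed

lemma comb_piso_converse:
  assumes "comb_piso SA SB F d c F' d' c' PA PB G"
  shows "comb_piso (SA\<inverse>) (SB\<inverse>) F' d' c' F d c (PA\<inverse>) (PB\<inverse>) (G\<inverse>)"
proof -
  note D = comb_pisoD[OF assms]
  show ?thesis
    unfolding comb_piso_def
  proof (intro conjI)
    show "\<forall>(f, f') \<in> G\<inverse>. f \<in> F' \<and> f' \<in> F" using D(4,5) by auto
    show "\<forall>(f, f') \<in> G\<inverse>. \<forall>(g, g') \<in> G\<inverse>. (f = g \<longleftrightarrow> f' = g') \<and>
        (f \<noteq> g \<longrightarrow> (d' f g, d f' g') \<in> PB\<inverse> \<and> (c' f g, c f' g') \<in> PA\<inverse>)"
      using D(6,7,8) by fast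
  qed (use D(1-3) bf_pairs_converse in auto)
qed

lemma list_all2_corr_mapA:
  "list_all2 (corr PA PB G) (map InA as) zs \<Longrightarrow> \<exists>as'. zs = map InA as' \<and> list_all2 (\<lambda>a a'. (a, a') \<in> PA) as as'"
proof (induction as arbitrary: zs)
  case (Cons a as)
  then obtain z zs' where z: "zs = z # zs'" "corr PA PB G (InA a) z"
    "list_all2 (corr PA PB G) (map InA as) zs'" by (auto simp: list_all2_Cons1)
  from Cons.IH[OF z(3)] obtain as' where *: "zs' = map InA as'" "list_all2 (\<lambda>a a'. (a, a') \<in> PA) as as'" by blast
  obtain a' where "z = InA a'" "(a, a') \<in> PA" using z(2) by auto
  then show ?case using z(1) * by (intro exI[of _ "a' # as'"]) simp
qed simp

lemma list_all2_corr_mapB: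
  "list_all2 (corr PA PB G) (map InB bs) zs \<Longrightarrow> \<exists>bs'. zs = map InB bs' \<and> list_all2 (\<lambda>b b'. (b, b') \<in> PB) bs bs'"
proof (induction bs arbitrary: zs)
  case (Cons b bs)
  then obtain z zs' where z: "zs = z # zs'" "corr PA PB G (InB b) z"
    "list_all2 (corr PA PB G) (map InB bs) zs'" by (auto simp: list_all2_Cons1)
  from Cons.IH[OF z(3)] obtain bs' where *: "zs' = map InB bs'" "list_all2 (\<lambda>b b'. (b, b') \<in> PB) bs bs'" by blast
  obtain b' where "z = InB b'" "(b, b') \<in> PB" using z(2) by auto
  then show ?case using z(1) * by (intro exI[of _ "b' # bs'"]) simp
qed simp

lemma list_all2_pairs_range:
  "list_all2 (\<lambda>a a'. (a, a') \<in> P) as as' \<Longrightarrow> (\<And>a a'. (a, a') \<in> P \<Longrightarrow> a' \<in> Y) \<Longrightarrow> set as' \<subseteq> Y"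
  by (induction rule: list_all2_induct) auto

text \<open>One implication suffices: all notions involved are closed under converses, which gives
  the other.\<close>

lemma comb_rel_corr:
  assumes SA: "bf_system LA A A' SA" and SB: "bf_system LB B B' SB"
    and v: "comb_piso SA SB F d c F' d' c' PA PB G"
    and zs: "list_all2 (corr PA PB G) zs zs'" and "comb_rel LA A LB B F d c k zs"
  shows "comb_rel LA A' LB B' F' d' c' k zs'"
proof -
  note D = comb_pisoD[OF v]
  note PA = bf_pairsD[OF SA D(1)] and PB = bf_pairsD[OF SB D(2)]
  from assms(5) show ?thesis using zs
  proof cases
    case (sortA a)
    then show ?thesis using zs PA(2) by (auto simp: list_all2_Cons1 intro!: comb_rel.sortA)
  next
    case (sortB b)
    then show ?thesis using zs PB(2) by (auto simp: list_all2_Cons1 intro!: comb_rel.sortB)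
  next
    case (colB x y)
    then obtain x' y' b' where *: "zs' = [InF x', InF y', InB b']" "(x, x') \<in> G" "(y, y') \<in> G" "(d x y, b') \<in> PB"
      using zs by (auto simp: list_all2_Cons1)
    have "b' = d' x' y'" using PB(3)[OF *(4) D(7)[OF *(2,3) colB(5)]] by simp
    then show ?thesis using * D(5)[OF *(2)] D(5)[OF *(3)] D(6)[OF *(2,3)] colB by (auto intro!: comb_rel.colB)
  next
    case (colA x y)
    then obtain x' y' b' where *: "zs' = [InF x', InF y', InA b']" "(x, x') \<in> G" "(y, y') \<in> G" "(c x y, b') \<in> PA"
      using zs by (auto simp: list_all2_Cons1)
    have "b' = c' x' y'" using PA(3)[OF *(4) D(8)[OF *(2,3) colA(5)]] by simp
    then show ?thesis using * D(5)[OF *(2)] D(5)[OF *(3)] D(6)[OF *(2,3)] colA by (auto intro!: comb_rel.colA)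
  next
    case (relA as R)
    then obtain as' where as': "zs' = map InA as'" "list_all2 (\<lambda>a a'. (a, a') \<in> PA) as as'"
      using list_all2_corr_mapA zs by blast
    have "set as' \<subseteq> univ A'" using list_all2_pairs_range[OF as'(2)] PA(2) by blast
    then show ?thesis using as' relA PA(5)[OF relA(4) as'(2)] list_all2_lengthD[OF as'(2)]
      by (auto intro!: comb_rel.relA)
  next
    case (funA as f a)
    from zs funA(2) have "list_all2 (corr PA PB G) (map InA (as @ [a])) zs'" by simp
    then obtain as1 where as1: "zs' = map InA as1" "list_all2 (\<lambda>a a'. (a, a') \<in> PA) (as @ [a]) as1"
      using list_all2_corr_mapA by blast
    then obtain as' a' where as': "as1 = as' @ [a']" "list_all2 (\<lambda>a a'. (a, a') \<in> PA) as as'" "(a, a') \<in> PA"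
      by (auto simp: list_all2_append1 list_all2_Cons1)
    have "set as' \<subseteq> univ A'" using list_all2_pairs_range[OF as'(2)] PA(2) by blast
    then show ?thesis
      using as1(1) as' funA PA(4)[OF funA(4) as'(2,3)] PA(2)[OF as'(3)] list_all2_lengthD[OF as'(2)]
      by (auto intro!: comb_rel.funA)
  next
    case (relB bs R)
    then obtain bs' where bs': "zs' = map InB bs'" "list_all2 (\<lambda>a a'. (a, a') \<in> PB) bs bs'"
      using list_all2_corr_mapB zs by blast
    have "set bs' \<subseteq> univ B'" using list_all2_pairs_range[OF bs'(2)] PB(2) by blast
    then show ?thesis using bs' relB PB(5)[OF relB(4) bs'(2)] list_all2_lengthD[OF bs'(2)]
      by (auto intro!: comb_rel.relB)
  next
    case (funB bs f b)
    from zs funB(2) have "list_all2 (corr PA PB G) (map InB (bs @ [b])) zs'" by simp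
    then obtain bs1 where bs1: "zs' = map InB bs1" "list_all2 (\<lambda>a a'. (a, a') \<in> PB) (bs @ [b]) bs1"
      using list_all2_corr_mapB by blast
    then obtain bs' b' where bs': "bs1 = bs' @ [b']" "list_all2 (\<lambda>a a'. (a, a') \<in> PB) bs bs'" "(b, b') \<in> PB"
      by (auto simp: list_all2_append1 list_all2_Cons1)
    have "set bs' \<subseteq> univ B'" using list_all2_pairs_range[OF bs'(2)] PB(2) by blast
    then show ?thesis
      using bs1(1) bs' funB PB(4)[OF funB(4) bs'(2,3)] PB(2)[OF bs'(3)] list_all2_lengthD[OF bs'(2)]
      by (auto intro!: comb_rel.funB)
  qed
qed

text \<open>For a new point \<open>f\<close>, first match its finitely many colors over
  \<open>Domain G\<close> by extending the two parts. Their images form a prescription over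
  \<open>Range G\<close>, realized by genericity once it is admissible.\<close>

lemma comb_piso_extend:
  assumes SA: "bf_system LA A A' SA" and SB: "bf_system LB B B' SB"
    and v: "comb_piso SA SB F d c F' d' c' PA PB G"
    and F: "colored (univ A) (univ B) F d c" and F': "generic (univ A') (univ B') F' d' c'"
    and z: "z \<in> univ (comb LA A LB B F d c)"
  shows "\<exists>PA1 PB1 G1 z'. comb_piso SA SB F d c F' d' c' PA1 PB1 G1 \<and> PA \<subseteq> PA1 \<and> PB \<subseteq> PB1 \<and> G \<subseteq> G1 \<and>
    corr PA1 PB1 G1 z z'"
proof -
  note D = comb_pisoD[OF v]
  consider a where "z = InA a" "a \<in> univ A" | b where "z = InB b" "b \<in> univ B"
    | f where "z = InF f" "f \<in> F" using z by auto
  then show ?thesis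
  proof cases
    case 1
    from bf_pairs_extend[OF SA D(1), of "{a}"] 1(2) obtain PA1 a' where
      P: "bf_pairs SA PA1" "PA \<subseteq> PA1" "(a, a') \<in> PA1" by auto
    have "comb_piso SA SB F d c F' d' c' PA1 PB G"
      using v P(1,2) unfolding comb_piso_def by fast
    then show ?thesis using P 1(1)
      by (intro exI[of _ PA1] exI[of _ PB] exI[of _ G] exI[of _ "InA a'"]) simp
  next
    case 2
    from bf_pairs_extend[OF SB D(2), of "{b}"] 2(2) obtain PB1 b' where
      P: "bf_pairs SB PB1" "PB \<subseteq> PB1" "(b, b') \<in> PB1" by auto
    have "comb_piso SA SB F d c F' d' c' PA PB1 G"
      using v P(1,2) unfolding comb_piso_def by fast
    then show ?thesis using P 2(1)
      by (intro exI[of _ PA] exI[of _ PB1] exI[of _ G] exI[of _ "InB b'"]) simp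
  next
    case 3
    show ?thesis
    proof (cases "f \<in> Domain G")
      case True
      then obtain f' where "(f, f') \<in> G" by blast
      then show ?thesis using v 3(1)
        by (intro exI[of _ PA] exI[of _ PB] exI[of _ G] exI[of _ "InF f'"]) simp
    next
      case False
      have dom: "g \<in> F" "f \<noteq> g" if "(g, g') \<in> G" for g g'
        using that D(4) False by blast+
      have col: "d f g \<in> univ B" "d g f \<in> univ B" "c f g \<in> univ A" "c g f \<in> univ A" if "(g, g') \<in> G" for g g'
        using F 3(2) dom[OF that] unfolding colored_def by metis+
      define XB where "XB = d f ` Domain G \<union> (\<lambda>g. d g f) ` Domain G"
      define XA where "XA = c f ` Domain G \<union> (\<lambda>g. c g f) ` Domain G"
      have fin: "finite XB" "finite XA"
        unfolding XB_def XA_def using D(3) by (auto intro: finite_Domain)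
      have sub: "XB \<subseteq> univ B" "XA \<subseteq> univ A" unfolding XB_def XA_def using col by auto
      obtain PB1 where PB1: "bf_pairs SB PB1" "PB \<subseteq> PB1" "\<forall>x \<in> XB. \<exists>y. (x, y) \<in> PB1"
        using bf_pairs_extend[OF SB D(2) fin(1) sub(1)] by blast
      obtain PA1 where PA1: "bf_pairs SA PA1" "PA \<subseteq> PA1" "\<forall>x \<in> XA. \<exists>y. (x, y) \<in> PA1"
        using bf_pairs_extend[OF SA D(1) fin(2) sub(2)] by blast
      note PBD = bf_pairsD[OF SB PB1(1)] and PAD = bf_pairsD[OF SA PA1(1)]
      define \<tau> where "\<tau> g' = (SOME g. (g, g') \<in> G)" for g'
      have \<tau>: "(\<tau> g', g') \<in> G" if "g' \<in> Range G" for g'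
        unfolding \<tau>_def using someI_ex[of "\<lambda>g. (g, g') \<in> G"] that by blast
      have \<tau>_eq: "\<tau> g' = g" if "(g, g') \<in> G" for g g'
        using D(6)[OF \<tau> that] that by blast
      define mB where "mB b = (SOME b'. (b, b') \<in> PB1)" for b
      define mA where "mA a = (SOME a'. (a, a') \<in> PA1)" for a
      have mB: "(b, mB b) \<in> PB1" if "b \<in> XB" for b
        unfolding mB_def using someI_ex[of "\<lambda>y. (b, y) \<in> PB1"] PB1(3) that by blast
      have mA: "(a, mA a) \<in> PA1" if "a \<in> XA" for a
        unfolding mA_def using someI_ex[of "\<lambda>y. (a, y) \<in> PA1"] PA1(3) that by blast
      define p where "p g' = mB (d f (\<tau> g'))" for g'
      define q where "q g' = mB (d (\<tau> g') f)" for g'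
      define r where "r g' = mA (c f (\<tau> g'))" for g'
      define w where "w g' = mA (c (\<tau> g') f)" for g'
      have pqrw: "(d f g, p g') \<in> PB1" "(d g f, q g') \<in> PB1" "(c f g, r g') \<in> PA1" "(c g f, w g') \<in> PA1"
        if "(g, g') \<in> G" for g g'
        unfolding p_def q_def r_def w_def \<tau>_eq[OF that]
        by (rule mB mA; use that in \<open>auto simp: XB_def XA_def\<close>)+
      have tf: "triangle_free F d c" using F unfolding colored_def by blast
      \<comment> \<open>A violated clause pulls back along the injections \<open>PA1\<close> and
        \<open>PB1\<close> to a forbidden triangle in \<open>F\<close> with \<open>f\<close> as a
        vertex.\<close>
      have "admissible (Range G) d' c' p q r w"
        unfolding admissible_def
      proof (intro ballI impI)
        fix y' z' assume y': "y' \<in> Range G" and z': "z' \<in> Range G" and ne: "y' \<noteq> z'"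
        define y where "y = \<tau> y'"
        define z where "z = \<tau> z'"
        have G: "(y, y') \<in> G" "(z, z') \<in> G" unfolding y_def z_def using \<tau> y' z' by auto
        have yz: "y \<noteq> z" using D(6)[OF G] ne by blast
        note my = pqrw[OF G(1)] and mz = pqrw[OF G(2)]
        have dyz: "(d y z, d' y' z') \<in> PB1" "(c y z, c' y' z') \<in> PA1"
          using D(7,8)[OF G yz] PB1(2) PA1(2) by auto
        note E = PBD(3) and EA = PAD(3)
        note T = triangle_freeD[OF tf]
        have 1: "\<not> (p y' = p z' \<and> p z' = d' y' z' \<and> r y' = r z')"
          using E[OF my(1) mz(1)] E[OF mz(1) dyz(1)] EA[OF my(3) mz(3)]
            T[of f y z] 3(2) dom[OF G(1)] dom[OF G(2)] yz by metis
        have 2: "\<not> (q y' = d' y' z' \<and> d' y' z' = p z' \<and> w y' = c' y' z')"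
          using E[OF my(2) dyz(1)] E[OF dyz(1) mz(1)] EA[OF my(4) dyz(2)]
            T[of y f z] 3(2) dom[OF G(1)] dom[OF G(2)] yz by metis
        have 3: "\<not> (d' y' z' = q y' \<and> q y' = q z' \<and> c' y' z' = w y')"
          using E[OF dyz(1) my(2)] E[OF my(2) mz(2)] EA[OF dyz(2) my(4)]
            T[of y z f] 3(2) dom[OF G(1)] dom[OF G(2)] yz by metis
        show "\<not> (p y' = p z' \<and> p z' = d' y' z' \<and> r y' = r z') \<and>
          \<not> (q y' = d' y' z' \<and> d' y' z' = p z' \<and> w y' = c' y' z') \<and>
          \<not> (d' y' z' = q y' \<and> q y' = q z' \<and> c' y' z' = w y')" using 1 2 3 by blast
      qed
      moreover have "\<forall>g' \<in> Range G. p g' \<in> univ B' \<and> q g' \<in> univ B' \<and> r g' \<in> univ A' \<and> w g' \<in> univ A'"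
        using pqrw PBD(2) PAD(2) by blast
      moreover have "finite (Range G)" "Range G \<subseteq> F'" using D(3,5) by (auto intro: finite_Range)
      ultimately obtain f' where f': "f' \<in> F'" "f' \<notin> Range G"
        and f'_col: "\<And>g'. g' \<in> Range G \<Longrightarrow> d' f' g' = p g' \<and> d' g' f' = q g' \<and> c' f' g' = r g' \<and> c' g' f' = w g'"
        using F'[unfolded generic_def, rule_format, of "Range G" p q r w] by blast
      let ?G = "insert (f, f') G"
      have "comb_piso SA SB F d c F' d' c' PA1 PB1 ?G"
        unfolding comb_piso_def
      proof (intro conjI PA1(1) PB1(1))
        show "finite ?G" using D(3) by simp
        show "\<forall>(g, g') \<in> ?G. g \<in> F \<and> g' \<in> F'" using D(4,5) 3(2) f'(1) by auto
        have new: "(f = g \<longleftrightarrow> f' = g') \<and> (g = f \<longleftrightarrow> g' = f') \<and> (d f g, d' f' g') \<in> PB1 \<and> (c f g, c' f' g') \<in> PA1 \<and>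
            (d g f, d' g' f') \<in> PB1 \<and> (c g f, c' g' f') \<in> PA1" if g: "(g, g') \<in> G" for g g'
        proof -
          have g': "g' \<in> Range G" using g by blast
          then show ?thesis using pqrw[OF g] f'_col[OF g'] f'(2) dom[OF g] by auto
        qed
        have old: "(g = h \<longleftrightarrow> g' = h') \<and> (g \<noteq> h \<longrightarrow> (d g h, d' g' h') \<in> PB1 \<and> (c g h, c' g' h') \<in> PA1)"
          if "(g, g') \<in> G" "(h, h') \<in> G" for g g' h h'
          using D(6-8)[OF that] PA1(2) PB1(2) by blast
        show "\<forall>(g, g') \<in> ?G. \<forall>(h, h') \<in> ?G. (g = h \<longleftrightarrow> g' = h') \<and>
            (g \<noteq> h \<longrightarrow> (d g h, d' g' h') \<in> PB1 \<and> (c g h, c' g' h') \<in> PA1)"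
        proof (intro ballI, clarify, intro conjI impI)
          fix g g' h h' assume gh: "(g, g') \<in> ?G" "(h, h') \<in> ?G"
          show "g = h \<longleftrightarrow> g' = h'" using gh new old by blast
          show "(d g h, d' g' h') \<in> PB1" "(c g h, c' g' h') \<in> PA1" if "g \<noteq> h"
            using gh new old that by blast+
        qed
      qed
      then show ?thesis using 3(1) PA1(2) PB1(2)
        by (intro exI[of _ PA1] exI[of _ PB1] exI[of _ ?G] exI[of _ "InF f'"]) auto
    qed
  qed
qed

definition comb_bf where
  "comb_bf SA SB F d c F' d' c' = {(zs, zs'). \<exists>PA PB G. comb_piso SA SB F d c F' d' c' PA PB G \<and>
     list_all2 (corr PA PB G) zs zs'}"

lemma comb_bf_converse:
  assumes "(zs, zs') \<in> comb_bf SA SB F d c F' d' c'"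
  shows "(zs', zs) \<in> comb_bf (SA\<inverse>) (SB\<inverse>) F' d' c' F d c"
proof -
  obtain PA PB G where P: "comb_piso SA SB F d c F' d' c' PA PB G" "list_all2 (corr PA PB G) zs zs'"
    using assms unfolding comb_bf_def by blast
  have "list_all2 (corr (PA\<inverse>) (PB\<inverse>) (G\<inverse>)) zs' zs"
    using P(2) by (auto simp: list_all2_conv_all_nth intro: corr_converse)
  then show ?thesis unfolding comb_bf_def using comb_piso_converse[OF P(1)] by blast
qed

lemma comb_bf_forth:
  assumes SA: "bf_system LA A A' SA" and SB: "bf_system LB B B' SB"
    and F: "colored (univ A) (univ B) F d c" and F': "generic (univ A') (univ B') F' d' c'"
    and zs: "(zs, zs') \<in> comb_bf SA SB F d c F' d' c'" and z: "z \<in> univ (comb LA A LB B F d c)"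
  shows "\<exists>z'. (zs @ [z], zs' @ [z']) \<in> comb_bf SA SB F d c F' d' c'"
proof -
  obtain PA PB G where P: "comb_piso SA SB F d c F' d' c' PA PB G" "list_all2 (corr PA PB G) zs zs'"
    using zs unfolding comb_bf_def by blast
  obtain PA1 PB1 G1 z' where Q: "comb_piso SA SB F d c F' d' c' PA1 PB1 G1" "PA \<subseteq> PA1" "PB \<subseteq> PB1" "G \<subseteq> G1"
    "corr PA1 PB1 G1 z z'" using comb_piso_extend[OF SA SB P(1) F F' z] by blast
  have "list_all2 (corr PA1 PB1 G1) zs zs'"
    by (rule list_all2_mono[OF P(2)]) (rule corr_mono[OF _ Q(2-4)])
  then have "list_all2 (corr PA1 PB1 G1) (zs @ [z]) (zs' @ [z'])"
    using Q(5) by (simp add: list_all2_appendI)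
  then show ?thesis unfolding comb_bf_def using Q(1) by blast
qed

lemma comb_bf_props:
  assumes SA: "bf_system LA A A' SA" and SB: "bf_system LB B B' SB"
    and zs: "(zs, zs') \<in> comb_bf SA SB F d c F' d' c'"
  shows "length zs = length zs'" "set zs \<subseteq> univ (comb LA A LB B F d c)"
    "set zs' \<subseteq> univ (comb LA A' LB B' F' d' c')"
    "same_atoms rel_lang (comb LA A LB B F d c) (comb LA A' LB B' F' d' c') zs zs'"
proof -
  obtain PA PB G where P: "comb_piso SA SB F d c F' d' c' PA PB G" "list_all2 (corr PA PB G) zs zs'"
    using zs unfolding comb_bf_def by blast
  note D = comb_pisoD[OF P(1)]
  note PA = bf_pairsD[OF SA D(1)] and PB = bf_pairsD[OF SB D(2)]
  show len: "length zs = length zs'" using P(2) by (rule list_all2_lengthD)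
  have nth: "corr PA PB G (zs ! i) (zs' ! i)" if "i < length zs" for i
    using P(2) that by (rule list_all2_nthD)
  have univ: "z \<in> univ (comb LA A LB B F d c) \<and> z' \<in> univ (comb LA A' LB B' F' d' c')"
    if "corr PA PB G z z'" for z z'
    using that PA(1,2) PB(1,2) D(4,5) by (cases rule: corr.cases) auto
  show "set zs \<subseteq> univ (comb LA A LB B F d c)" "set zs' \<subseteq> univ (comb LA A' LB B' F' d' c')"
    using univ nth len by (metis in_set_conv_nth subsetI)+
  have eq: "z = y \<longleftrightarrow> z' = y'" if "corr PA PB G z z'" "corr PA PB G y y'" for z z' y y'
    using that(1)
  proof cases
    case (corrA a a')
    from that(2) show ?thesis by cases (use corrA(1,2) PA(3)[OF corrA(3)] in auto)
  next
    case (corrB b b')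
    from that(2) show ?thesis by cases (use corrB(1,2) PB(3)[OF corrB(3)] in auto)
  next
    case (corrF f f')
    from that(2) show ?thesis by cases (use corrF(1,2) D(6)[OF corrF(3)] in auto)
  qed
  have rel: "comb_rel LA A LB B F d c k us \<longleftrightarrow> comb_rel LA A' LB B' F' d' c' k us'"
    if us: "list_all2 (corr PA PB G) us us'" for us us' k
  proof
    assume "comb_rel LA A LB B F d c k us"
    from comb_rel_corr[OF SA SB P(1) us this] show "comb_rel LA A' LB B' F' d' c' k us'" .
  next
    assume *: "comb_rel LA A' LB B' F' d' c' k us'"
    have "list_all2 (corr (PA\<inverse>) (PB\<inverse>) (G\<inverse>)) us' us"
      using us by (auto simp: list_all2_conv_all_nth intro: corr_converse)
    from comb_rel_corr[OF bf_system_converse[OF SA] bf_system_converse[OF SB] comb_piso_converse[OF P(1)] this *]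
    show "comb_rel LA A LB B F d c k us" .
  qed
  have "rint (comb LA A LB B F d c) R (map ((!) zs) is) = rint (comb LA A' LB B' F' d' c') R (map ((!) zs') is)"
    if "set is \<subseteq> {..<length zs}" for R "is"
    unfolding comb_simps by (rule rel) (use that nth in \<open>auto simp: list_all2_conv_all_nth subset_iff\<close>)
  then show "same_atoms rel_lang (comb LA A LB B F d c) (comb LA A' LB B' F' d' c') zs zs'"
    unfolding same_atoms_def using eq nth by (simp add: rel_lang_def)
qed

theorem comb_bf_equiv:
  assumes "bf_equiv LA A A'" "bf_equiv LB B B'"
    and F: "colored (univ A) (univ B) F d c" "generic (univ A) (univ B) F d c"
    and F': "colored (univ A') (univ B') F' d' c'" "generic (univ A') (univ B') F' d' c'"
  shows "bf_equiv rel_lang (comb LA A LB B F d c) (comb LA A' LB B' F' d' c')"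
proof -
  obtain SA SB where SA: "bf_system LA A A' SA" and SB: "bf_system LB B B' SB"
    using assms(1,2) unfolding bf_equiv_def by blast
  let ?S = "comb_bf SA SB F d c F' d' c'"
  have "bf_system rel_lang (comb LA A LB B F d c) (comb LA A' LB B' F' d' c') ?S"
  proof (rule bf_systemI, goal_cases)
    case 1
    have "bf_pairs SA {}" "bf_pairs SB {}"
      unfolding bf_pairs_def using bf_system_nil[OF SA] bf_system_nil[OF SB] by force+
    then have "comb_piso SA SB F d c F' d' c' {} {} {}" unfolding comb_piso_def by simp
    then show ?case unfolding comb_bf_def by blast
  next
    case (2 zs zs')
    show ?case using comb_bf_props(1-3)[OF SA SB 2] by blast
  next
    case (3 zs zs')
    show ?case using comb_bf_props(4)[OF SA SB 3] .
  next
    case (4 zs zs' z)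
    obtain z' where z': "(zs @ [z], zs' @ [z']) \<in> ?S" using comb_bf_forth[OF SA SB F(1) F'(2) 4] by blast
    then show ?case using comb_bf_props(3)[OF SA SB z'] by auto
  next
    case (5 zs zs' z')
    obtain z where "(zs' @ [z'], zs @ [z]) \<in> comb_bf (SA\<inverse>) (SB\<inverse>) F' d' c' F d c"
      using comb_bf_forth[OF bf_system_converse[OF SA] bf_system_converse[OF SB] F'(1) F(2)
          comb_bf_converse[OF 5(1)] 5(2)] by blast
    from comb_bf_converse[OF this] have z: "(zs @ [z], zs' @ [z']) \<in> ?S" by simp
    then show ?case using comb_bf_props(2)[OF SA SB z] by auto
  qed
  then show ?thesis unfolding bf_equiv_def by blast
qed

section \<open>Recovering the parts of a combined structure\<close>

text \<open>The set \<open>U\<close> defined in \<open>N\<close> by the sort symbol corresponds to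
  \<open>A\<close> under the system. Relations are copied, and that the graph symbols define total
  functions on \<open>U\<close> is inferred from \<open>A\<close> through the system.\<close>

lemma bf_part:
  fixes A :: "'a struct" and M :: "'m struct" and N :: "'n struct"
  assumes S: "bf_system rel_lang M N S" and A: "is_struct LA A"
    and i: "inj_on i (univ A)" "i ` univ A \<subseteq> univ M"
    and sort: "\<And>z. z \<in> univ M \<Longrightarrow> rint M sA [z] \<longleftrightarrow> z \<in> i ` univ A"
    and rel: "\<And>R as. (R, length as) \<in> rels LA \<Longrightarrow> set as \<subseteq> univ A \<Longrightarrow>
      rint M (rA R) (map i as) \<longleftrightarrow> rint A R as"
    and fn: "\<And>f as a. (f, length as) \<in> funs LA \<Longrightarrow> set as \<subseteq> univ A \<Longrightarrow> a \<in> univ A \<Longrightarrow>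
      rint M (gA f) (map i as @ [i a]) \<longleftrightarrow> a = fint A f as"
  shows "\<exists>A' :: 'n struct. univ A' = {z \<in> univ N. rint N sA [z]} \<and> is_struct LA A' \<and> bf_equiv LA A A'"
proof -
  define U where "U = {z \<in> univ N. rint N sA [z]}"
  define T where "T = {(xs, ys). set xs \<subseteq> univ A \<and> (map i xs, ys) \<in> S}"
  have relS: "rint M R (map ((!) xs) is) \<longleftrightarrow> rint N R (map ((!) ys) is)"
    if "(xs, ys) \<in> S" "set is \<subseteq> {..<length xs}" for xs ys R "is"
    using same_atoms_relD[OF bf_systemD(4)[OF S that(1)] _ that(2)] by (simp add: rel_lang_def)
  have rel1: "rint M R [xs ! j] \<longleftrightarrow> rint N R [ys ! j]" if "(xs, ys) \<in> S" "j < length xs" for xs ys R j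
    using relS[OF that(1), of "[j]" R] that(2) by simp
  have lenT: "length xs = length ys" if "(xs, ys) \<in> T" for xs ys
    using bf_systemD(1)[OF S, of "map i xs" ys] that unfolding T_def by simp
  have TU: "set ys \<subseteq> U" if t: "(xs, ys) \<in> T" for xs ys
  proof
    fix y assume "y \<in> set ys"
    then obtain j where j: "j < length ys" "y = ys ! j" by (metis in_set_conv_nth)
    have s: "(map i xs, ys) \<in> S" "set xs \<subseteq> univ A" using t unfolding T_def by auto
    have jx: "j < length xs" using j(1) lenT[OF t] by simp
    then have x: "xs ! j \<in> univ A" using s(2) nth_mem by blast
    then have "rint M sA [map i xs ! j]" using sort[of "i (xs ! j)"] i(2) jx by auto
    then have "rint N sA [y]" using rel1[OF s(1), of j sA] jx j(2) by simp
    moreover have "y \<in> univ N" using bf_systemD(3)[OF S s(1)] j nth_mem by blast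
    ultimately show "y \<in> U" unfolding U_def by blast
  qed
  have forth: "\<exists>y. (xs @ [x], ys @ [y]) \<in> T" if "(xs, ys) \<in> T" "x \<in> univ A" for xs ys x
  proof -
    have s: "(map i xs, ys) \<in> S" "set xs \<subseteq> univ A" using that(1) unfolding T_def by auto
    have "i x \<in> univ M" using i(2) that(2) by blast
    from bf_systemD(5)[OF S s(1) this] obtain y where "(map i xs @ [i x], ys @ [y]) \<in> S" by blast
    then show ?thesis using s(2) that(2) unfolding T_def by auto
  qed
  have conv: "\<exists>x. (xs @ [x], ys @ [y]) \<in> T" if "(xs, ys) \<in> T" "y \<in> U" for xs ys y
  proof -
    have s: "(map i xs, ys) \<in> S" "set xs \<subseteq> univ A" using that(1) unfolding T_def by auto
    have y: "y \<in> univ N" "rint N sA [y]" using that(2) unfolding U_def by auto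
    from bf_systemD(6)[OF S s(1) y(1)] obtain z where z: "z \<in> univ M" "(map i xs @ [z], ys @ [y]) \<in> S" by blast
    have "rint M sA [z]"
      using rel1[OF z(2), of "length xs" sA] y(2) lenT[OF that(1)] by (simp add: nth_append)
    then obtain x where "x \<in> univ A" "z = i x" using sort[OF z(1)] by blast
    then show ?thesis using s(2) z(2) unfolding T_def by (intro exI[of _ x]) auto
  qed
  have nil: "([], []) \<in> T" using bf_system_nil[OF S] unfolding T_def by simp
  have conv_list: "\<exists>us. length us = length vs \<and> (us, vs) \<in> T" if "set vs \<subseteq> U" for vs
    using that
  proof (induction vs rule: rev_induct)
    case Nil
    then show ?case using nil by simp
  next
    case (snoc v vs)
    then obtain us where us: "length us = length vs" "(us, vs) \<in> T" by auto
    then obtain u where "(us @ [u], vs @ [v]) \<in> T" using conv[OF us(2), of v] snoc.prems by auto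
    then show ?case using us(1) by (intro exI[of _ "us @ [u]"]) simp
  qed
  have relT: "rint A R (map ((!) xs) is) \<longleftrightarrow> rint N (rA R) (map ((!) ys) is)"
    if t: "(xs, ys) \<in> T" and "is": "set is \<subseteq> {..<length xs}" and R: "(R, length is) \<in> rels LA" for xs ys R "is"
  proof -
    have s: "(map i xs, ys) \<in> S" "set xs \<subseteq> univ A" using t unfolding T_def by auto
    have m: "map ((!) (map i xs)) is = map i (map ((!) xs) is)" using "is" by auto
    have sub: "set (map ((!) xs) is) \<subseteq> univ A" using "is" s(2) nth_mem by fastforce
    have "rint A R (map ((!) xs) is) \<longleftrightarrow> rint M (rA R) (map i (map ((!) xs) is))"
      using rel[OF _ sub, of R] R by simp
    also have "\<dots> \<longleftrightarrow> rint N (rA R) (map ((!) ys) is)"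
      using relS[OF s(1), of "is" "rA R"] "is" unfolding m by simp
    finally show ?thesis .
  qed
  have fnT: "xs ! j = fint A f (map ((!) xs) is) \<longleftrightarrow> rint N (gA f) (map ((!) ys) is @ [ys ! j])"
    if t: "(xs, ys) \<in> T" and "is": "set is \<subseteq> {..<length xs}" and f: "(f, length is) \<in> funs LA"
      and j: "j < length xs" for xs ys f "is" j
  proof -
    have s: "(map i xs, ys) \<in> S" "set xs \<subseteq> univ A" using t unfolding T_def by auto
    have m: "map ((!) (map i xs)) (is @ [j]) = map i (map ((!) xs) is) @ [i (xs ! j)]" using "is" j by auto
    have sub: "set (map ((!) xs) is) \<subseteq> univ A" using "is" s(2) nth_mem by fastforce
    have x: "xs ! j \<in> univ A" using s(2) j nth_mem by blast
    have "xs ! j = fint A f (map ((!) xs) is) \<longleftrightarrow> rint M (gA f) (map i (map ((!) xs) is) @ [i (xs ! j)])"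
      using fn[OF _ sub x, of f] f by simp
    also have "\<dots> \<longleftrightarrow> rint N (gA f) (map ((!) ys) (is @ [j]))"
      using relS[OF s(1), of "is @ [j]" "gA f"] "is" j unfolding m by simp
    finally show ?thesis by simp
  qed
  have eqT: "xs ! j = xs ! k \<longleftrightarrow> ys ! j = ys ! k"
    if t: "(xs, ys) \<in> T" and jk: "j < length xs" "k < length xs" for xs ys j k
  proof -
    have s: "(map i xs, ys) \<in> S" "set xs \<subseteq> univ A" using t unfolding T_def by auto
    have "i (xs ! j) = i (xs ! k) \<longleftrightarrow> ys ! j = ys ! k"
      using same_atoms_eqD[OF bf_systemD(4)[OF S s(1)], of j k] jk by simp
    moreover have "xs ! j \<in> univ A" "xs ! k \<in> univ A" using s(2) jk nth_mem by blast+
    ultimately show ?thesis by (simp add: inj_on_eq_iff[OF i(1)])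
  qed
  \<comment> \<open>Pull the arguments back to \<open>A\<close> and answer their function value by
    \<open>y\<close>. Any \<open>z\<close> of the sort pulls back to some \<open>x\<close> over this
    extended tuple, and both conditions on \<open>z\<close> amount to \<open>x\<close> being the
    function value.\<close>
  have graph: "\<exists>y \<in> U. \<forall>z \<in> U. rint N (gA f) (vs @ [z]) \<longleftrightarrow> z = y"
    if f: "(f, length vs) \<in> funs LA" and vs: "set vs \<subseteq> U" for f vs
  proof -
    obtain us where us: "length us = length vs" "(us, vs) \<in> T" using conv_list[OF vs] by blast
    let ?n = "length us"
    have usA: "set us \<subseteq> univ A" using us(2) unfolding T_def by blast
    have f': "(f, length [0..<?n]) \<in> funs LA" using f us(1) by simp
    have "fint A f us \<in> univ A" by (rule is_struct_fint[OF A _ usA]) (use f us(1) in simp)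
    from forth[OF us(2) this] obtain y where y: "(us @ [fint A f us], vs @ [y]) \<in> T" by blast
    have mapn: "map ((!) (us @ w)) [0..<?n] = us" for w by (rule nth_equalityI) (auto simp: nth_append)
    have mapv: "map ((!) (vs @ w)) [0..<?n] = vs" for w
      using us(1) by (intro nth_equalityI) (auto simp: nth_append)
    have "rint N (gA f) (vs @ [z]) \<longleftrightarrow> z = y" if z: "z \<in> U" for z
    proof -
      obtain x where x: "((us @ [fint A f us]) @ [x], (vs @ [y]) @ [z]) \<in> T" using conv[OF y z] by blast
      then have x': "(us @ [fint A f us, x], vs @ [y, z]) \<in> T" by simp
      have sub: "set [0..<?n] \<subseteq> {..<length (us @ [fint A f us, x])}"
        and last: "(us @ [fint A f us, x]) ! Suc ?n = x" "(vs @ [y, z]) ! Suc ?n = z"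
        using us(1) by (auto simp: nth_append)
      have "x = fint A f us \<longleftrightarrow> rint N (gA f) (vs @ [z])"
        using fnT[OF x' sub f', of "Suc ?n"] unfolding mapn mapv last by simp
      moreover have "x = fint A f us \<longleftrightarrow> z = y"
        using eqT[OF x', of "Suc ?n" ?n] us(1) by (simp add: nth_append)
      ultimately show ?thesis by blast
    qed
    moreover have "y \<in> U" using TU[OF y] by simp
    ultimately show ?thesis by blast
  qed
  define fA where "fA f vs = (SOME y. y \<in> U \<and> (\<forall>z \<in> U. rint N (gA f) (vs @ [z]) \<longleftrightarrow> z = y))" for f vs
  have fA: "fA f vs \<in> U" "\<And>z. z \<in> U \<Longrightarrow> rint N (gA f) (vs @ [z]) \<longleftrightarrow> z = fA f vs"
    if "(f, length vs) \<in> funs LA" "set vs \<subseteq> U" for f vs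
  proof -
    have "\<exists>y. y \<in> U \<and> (\<forall>z \<in> U. rint N (gA f) (vs @ [z]) \<longleftrightarrow> z = y)" using graph[OF that] by blast
    from someI_ex[OF this, folded fA_def] show "fA f vs \<in> U"
      "\<And>z. z \<in> U \<Longrightarrow> rint N (gA f) (vs @ [z]) \<longleftrightarrow> z = fA f vs" by blast+
  qed
  define A' where "A' = \<lparr>univ = U, fint = fA, rint = \<lambda>R. rint N (rA R)\<rparr>"
  have A': "univ A' = U" "fint A' = fA" "rint A' R = rint N (rA R)" for R by (simp_all add: A'_def)
  obtain a where "a \<in> univ A" using A unfolding is_struct_def by blast
  from forth[OF nil this] obtain y where "([a], [y]) \<in> T" by auto
  then have "U \<noteq> {}" using TU by fastforce
  then have "is_struct LA A'" by (intro is_structI) (use fA(1) A' in auto)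
  moreover have "bf_system LA A A' T"
  proof (rule bf_systemI, goal_cases)
    case 1
    show ?case by (rule nil)
  next
    case (2 xs ys)
    then show ?case using lenT[OF 2] TU[OF 2] A'(1) unfolding T_def by blast
  next
    case (3 xs ys)
    have nthU: "ys ! j \<in> U" if "j < length xs" for j
      using TU[OF 3] lenT[OF 3] that nth_mem by fastforce
    have "xs ! j = fint A f (map ((!) xs) is) \<longleftrightarrow> ys ! j = fint A' f (map ((!) ys) is)"
      if "(f, length is) \<in> funs LA" "set is \<subseteq> {..<length xs}" "j < length xs" for f "is" j
    proof -
      have "set (map ((!) ys) is) \<subseteq> U" using that(2) nthU by auto
      then show ?thesis
        unfolding fnT[OF 3 that(2,1,3)] A'(2)
        by (intro fA(2) nthU that(3)) (use that(1) in simp_all)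
    qed
    then show ?case unfolding same_atoms_def A'(3) using eqT[OF 3] relT[OF 3] by blast
  next
    case (4 xs ys x)
    then obtain y where y: "(xs @ [x], ys @ [y]) \<in> T" using forth by blast
    then show ?case using TU[OF y] A'(1) by auto
  next
    case (5 xs ys y)
    then obtain x where x: "(xs @ [x], ys @ [y]) \<in> T" using conv A'(1) by blast
    then show ?case unfolding T_def by auto
  qed
  ultimately show ?thesis using A'(1) unfolding U_def bf_equiv_def by blast
qed

text \<open>The two sorts are handled by \<open>bf_part\<close>. Whatever lies outside them
  corresponds to points of \<open>F\<close>, and both the existence of colors and the absence of
  forbidden triangles concern finite tuples, which the system transfers.\<close>

theorem comb_bf_parts:
  fixes N :: "'n struct"
  assumes bf: "bf_equiv rel_lang (comb LA A LB B F d c) N"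
    and A: "is_struct LA A" and B: "is_struct LB B" and F: "colored (univ A) (univ B) F d c"
  shows "\<exists>(A' :: 'n struct) (B' :: 'n struct) F' d' c'. univ N = univ A' \<union> univ B' \<union> F' \<and>
    is_struct LA A' \<and> bf_equiv LA A A' \<and> is_struct LB B' \<and> bf_equiv LB B B' \<and>
    colored (univ A') (univ B') F' d' c'"
proof -
  let ?M = "comb LA A LB B F d c"
  obtain S where S: "bf_system rel_lang ?M N S" using bf unfolding bf_equiv_def by blast
  let ?kA = "prod_encode (0, 0)" and ?kB = "prod_encode (8, 0)"
  have "\<exists>A' :: 'n struct. univ A' = {z \<in> univ N. rint N ?kA [z]} \<and> is_struct LA A' \<and> bf_equiv LA A A'"
    by (rule bf_part[OF S A, of InA _ "\<lambda>R. prod_encode (4, R)" "\<lambda>R. prod_encode (5, R)"])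
      (auto simp: inj_on_def comb_rel_iff inj_map_eq_map)
  then obtain A' :: "'n struct" where A': "univ A' = {z \<in> univ N. rint N ?kA [z]}" "is_struct LA A'"
    "bf_equiv LA A A'" by blast
  have "\<exists>B' :: 'n struct. univ B' = {z \<in> univ N. rint N ?kB [z]} \<and> is_struct LB B' \<and> bf_equiv LB B B'"
    by (rule bf_part[OF S B, of InB _ "\<lambda>R. prod_encode (6, R)" "\<lambda>R. prod_encode (7, R)"])
      (auto simp: inj_on_def comb_rel_iff inj_map_eq_map)
  then obtain B' :: "'n struct" where B': "univ B' = {z \<in> univ N. rint N ?kB [z]}" "is_struct LB B'"
    "bf_equiv LB B B'" by blast
  define F' where "F' = univ N - univ A' - univ B'"
  define d' where "d' x y = (SOME b. b \<in> univ B' \<and> rint N (prod_encode (2, 0)) [x, y, b])" for x y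
  define c' where "c' x y = (SOME a. a \<in> univ A' \<and> rint N (prod_encode (3, 0)) [x, y, a])" for x y
  have relS: "comb_rel LA A LB B F d c k (map ((!) zs) is) \<longleftrightarrow> rint N (prod_encode k) (map ((!) ys) is)"
    if "(zs, ys) \<in> S" "set is \<subseteq> {..<length zs}" for zs ys k "is"
    using same_atoms_relD[OF bf_systemD(4)[OF S that(1)] _ that(2), of "prod_encode k"]
    by (simp add: rel_lang_def)
  have eqS: "zs ! i = zs ! j \<longleftrightarrow> ys ! i = ys ! j"
    if "(zs, ys) \<in> S" "i < length zs" "j < length zs" for zs ys i j
    using same_atoms_eqD[OF bf_systemD(4)[OF S that(1)] that(2,3)] .
  have isF: "\<exists>f \<in> F. zs ! i = InF f" if zs: "(zs, ys) \<in> S" and i: "i < length zs" and y: "ys ! i \<in> F'" for zs ys i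
  proof -
    have "\<not> comb_rel LA A LB B F d c (0, 0) [zs ! i]" "\<not> comb_rel LA A LB B F d c (8, 0) [zs ! i]"
      using relS[OF zs, of "[i]" "(0, 0)"] relS[OF zs, of "[i]" "(8, 0)"] i y A'(1) B'(1)
      unfolding F'_def by auto
    moreover have "zs ! i \<in> univ ?M" using bf_systemD(2)[OF S zs] i nth_mem by blast
    ultimately show ?thesis by (auto simp: comb_rel_iff)
  qed
  have isA: "zs ! i \<in> InA ` univ A \<longleftrightarrow> ys ! i \<in> univ A'" if zs: "(zs, ys) \<in> S" and i: "i < length zs" for zs ys i
  proof -
    have "ys ! i \<in> univ N" using bf_systemD(1,3)[OF S zs] i by auto
    then show ?thesis using relS[OF zs, of "[i]" "(0, 0)"] i A'(1) by (auto simp: comb_rel_iff)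
  qed
  have isB: "zs ! i \<in> InB ` univ B \<longleftrightarrow> ys ! i \<in> univ B'" if zs: "(zs, ys) \<in> S" and i: "i < length zs" for zs ys i
  proof -
    have "ys ! i \<in> univ N" using bf_systemD(1,3)[OF S zs] i by auto
    then show ?thesis using relS[OF zs, of "[i]" "(8, 0)"] i B'(1) by (auto simp: comb_rel_iff)
  qed
  have F'N: "F' \<subseteq> univ N" unfolding F'_def by blast
  \<comment> \<open>Pull \<open>x\<close> and \<open>y\<close> back to points of \<open>F\<close>,
    append their two colors there, and push these forward to \<open>N\<close>.\<close>
  have col: "(\<exists>b. b \<in> univ B' \<and> rint N (prod_encode (2, 0)) [x, y, b]) \<and>
      (\<exists>a. a \<in> univ A' \<and> rint N (prod_encode (3, 0)) [x, y, a])"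
    if xy: "x \<in> F'" "y \<in> F'" "x \<noteq> y" for x y
  proof -
    have "set [x, y] \<subseteq> univ N" using xy F'N by auto
    from bf_system_back_list[OF S bf_system_nil[OF S] this] obtain zs where
      "length zs = length [x, y]" "(zs, [x, y]) \<in> S" by auto
    then obtain z1 z2 where z: "([z1, z2], [x, y]) \<in> S" by (auto simp: length_Suc_conv)
    obtain f g where fg: "f \<in> F" "g \<in> F" "z1 = InF f" "z2 = InF g"
      using isF[OF z, of 0] isF[OF z, of 1] xy by auto
    have "f \<noteq> g" using eqS[OF z, of 0 1] xy fg by auto
    then have ba: "d f g \<in> univ B" "c f g \<in> univ A" using F fg unfolding colored_def by blast+
    then have "set [InB (d f g), InA (c f g)] \<subseteq> univ ?M" by simp
    from bf_system_forth_list[OF S z this] obtain vs where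
      "length vs = length [InB (d f g) :: ('a, 'b, 'c) elt, InA (c f g)]"
      "([z1, z2] @ [InB (d f g), InA (c f g)], [x, y] @ vs) \<in> S" by blast
    then obtain b a where ba': "([z1, z2, InB (d f g), InA (c f g)], [x, y, b, a]) \<in> S"
      by (auto simp: length_Suc_conv)
    have "b \<in> univ B'" "a \<in> univ A'" using isB[OF ba', of 2] isA[OF ba', of 3] ba by auto
    moreover have "rint N (prod_encode (2, 0)) [x, y, b]"
      using relS[OF ba', of "[0, 1, 2]" "(2, 0)"] fg \<open>f \<noteq> g\<close> by (auto simp: comb_rel_iff)
    moreover have "rint N (prod_encode (3, 0)) [x, y, a]"
      using relS[OF ba', of "[0, 1, 3]" "(3, 0)"] fg \<open>f \<noteq> g\<close> by (auto simp: comb_rel_iff)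
    ultimately show ?thesis by blast
  qed
  have d': "d' x y \<in> univ B'" "rint N (prod_encode (2, 0)) [x, y, d' x y]"
    and c': "c' x y \<in> univ A'" "rint N (prod_encode (3, 0)) [x, y, c' x y]"
    if xy: "x \<in> F'" "y \<in> F'" "x \<noteq> y" for x y
    using someI_ex[OF conjunct1[OF col[OF xy]], folded d'_def]
      someI_ex[OF conjunct2[OF col[OF xy]], folded c'_def] by blast+
  have "colored (univ A') (univ B') F' d' c'"
    unfolding colored_def triangle_free_def
  proof (intro conjI ballI impI notI)
    fix x y assume "x \<in> F'" "y \<in> F'" "x \<noteq> y"
    then show "d' x y \<in> univ B'" "c' x y \<in> univ A'" using d' c' by blast+
  next
    fix x y z assume xyz: "x \<in> F'" "y \<in> F'" "z \<in> F'" "x \<noteq> y" "x \<noteq> z" "y \<noteq> z"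
      and bad: "d' x y = d' x z \<and> d' x z = d' y z \<and> c' x y = c' x z"
    define b where "b = d' x y"
    define a where "a = c' x y"
    have R: "rint N (prod_encode (2, 0)) [x, y, b]" "rint N (prod_encode (2, 0)) [x, z, b]"
      "rint N (prod_encode (2, 0)) [y, z, b]" "rint N (prod_encode (3, 0)) [x, y, a]"
      "rint N (prod_encode (3, 0)) [x, z, a]"
      using d'(2) c'(2) xyz bad unfolding a_def b_def by metis+
    \<comment> \<open>The triangle is pulled back together with its two colors; in the combined
      structure the color relations are graphs, so the colors there coincide too.\<close>
    have "set [x, y, z, b, a] \<subseteq> univ N"
      using xyz F'N d'(1)[of x y] c'(1)[of x y] A'(1) B'(1) unfolding a_def b_def by auto
    from bf_system_back_list[OF S bf_system_nil[OF S] this] obtain zs where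
      "length zs = length [x, y, z, b, a]" "(zs, [x, y, z, b, a]) \<in> S" by auto
    then obtain z1 z2 z3 z4 z5 where z: "([z1, z2, z3, z4, z5], [x, y, z, b, a]) \<in> S"
      by (auto simp: length_Suc_conv)
    obtain f g h where fgh: "f \<in> F" "g \<in> F" "h \<in> F" "z1 = InF f" "z2 = InF g" "z3 = InF h"
      using isF[OF z, of 0] isF[OF z, of 1] isF[OF z, of 2] xyz by auto
    have ne: "f \<noteq> g" "f \<noteq> h" "g \<noteq> h"
      using eqS[OF z, of 0 1] eqS[OF z, of 0 2] eqS[OF z, of 1 2] xyz fgh by auto
    have "z4 = InB (d f g)" using relS[OF z, of "[0, 1, 3]" "(2, 0)"] R(1) fgh by (simp add: comb_rel_iff)
    moreover have "z4 = InB (d f h)" using relS[OF z, of "[0, 2, 3]" "(2, 0)"] R(2) fgh by (simp add: comb_rel_iff)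
    moreover have "z4 = InB (d g h)" using relS[OF z, of "[1, 2, 3]" "(2, 0)"] R(3) fgh by (simp add: comb_rel_iff)
    moreover have "z5 = InA (c f g)" using relS[OF z, of "[0, 1, 4]" "(3, 0)"] R(4) fgh by (simp add: comb_rel_iff)
    moreover have "z5 = InA (c f h)" using relS[OF z, of "[0, 2, 4]" "(3, 0)"] R(5) fgh by (simp add: comb_rel_iff)
    ultimately show False
      using F fgh(1-3) ne triangle_freeD[of F d c f g h] unfolding colored_def by auto
  qed
  moreover have "univ N = univ A' \<union> univ B' \<union> F'" unfolding F'_def using A'(1) B'(1) by blast
  ultimately show ?thesis using A'(2,3) B'(2,3) by blast
qed

section \<open>Cardinalities of models\<close>

text \<open>Start the hull from a set of size \<open>r\<close>, so that it has exactly this size,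
  and copy it to the type underlying \<open>r\<close>, where \<open>has_model_of_card\<close>
  looks.\<close>

lemma lowenheim_skolem_exact:
  fixes M :: "'a struct" and r :: "'r rel"
  assumes M: "is_struct L M" and \<phi>: "is_sentence L \<phi>" and r: "Cinfinite r" "r \<le>o |univ M|"
  shows "\<exists>N :: 'r struct. is_struct L N \<and> |univ N| =o r \<and> (models N \<phi> \<longleftrightarrow> models M \<phi>)"
proof -
  have Fr: "|Field r| =o r" using r(1) card_of_Field_ordIso by blast
  from ordIso_ordLeq_trans[OF Fr r(2)] obtain g where g: "inj_on g (Field r)" "g ` Field r \<subseteq> univ M"
    by (auto simp: card_of_ordLeq[symmetric])
  define X where "X = g ` Field r"
  have Xr: "|X| =o r"
  proof -
    have "|Field r| =o |X|" unfolding X_def card_of_ordIso[symmetric] using g(1) by (auto simp: bij_betw_def)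
    then show ?thesis using ordIso_transitive[OF ordIso_symmetric Fr] by blast
  qed
  obtain K where K: "X \<subseteq> univ K" "|univ K| \<le>o r" "is_struct L K" "models K \<phi> \<longleftrightarrow> models M \<phi>"
    using lowenheim_skolem_downward[OF M \<phi> g(2)[folded X_def] r(1) ordIso_imp_ordLeq[OF Xr]] by blast
  have Kr: "|univ K| =o r"
    using K(2) ordIso_ordLeq_trans[OF ordIso_symmetric[OF Xr] card_of_mono1[OF K(1)]]
    by (simp add: ordIso_iff_ordLeq)
  from ordIso_transitive[OF Kr ordIso_symmetric[OF Fr]] obtain h where h: "bij_betw h (univ K) (Field r)"
    by (auto simp: card_of_ordIso[symmetric])
  from isomorphic_copy[OF K(3) bij_betw_imp_inj_on[OF h]] obtain N :: "'r struct" where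
    N: "univ N = h ` univ K" "is_struct L N" "isomorphic L K N" by blast
  have "|univ N| =o r" using Fr h N(1) unfolding bij_betw_def by simp
  then show ?thesis using N K isomorphic_models[OF N(3) K(3) N(2) \<phi>] by blast
qed

text \<open>A model larger than \<open>r\<close> could be shrunk to one of cardinality exactly
  \<open>cardSuc r\<close>, so excluding that one cardinality bounds all models over all
  types.\<close>

lemma model_card_bound:
  fixes N :: "'b struct" and r :: "'r rel"
  assumes M: "is_struct L M" and \<phi>: "scott_sentence L M \<phi>" and r: "Cinfinite r"
    and no: "\<not> has_model_of_card L \<phi> (cardSuc r)" and N: "is_struct L N" "bf_equiv L M N"
  shows "|univ N| \<le>o r"
proof (rule ccontr)
  assume "\<not> |univ N| \<le>o r"
  then have "r <o |univ N|"
    using ordLess_or_ordLeq[OF card_order_on_well_order_on card_of_Well_order] r by blast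
  then have "cardSuc r \<le>o |univ N|" using r cardSuc_ordLess_ordLeq card_of_Card_order by blast
  moreover have "is_sentence L \<phi>" using \<phi> unfolding scott_sentence_def by blast
  ultimately obtain K :: "'r set struct" where
    K: "is_struct L K" "|univ K| =o cardSuc r" "models K \<phi> \<longleftrightarrow> models N \<phi>"
    using lowenheim_skolem_exact[OF N(1) _ Cinfinite_cardSuc[OF r]] by blast
  then show False
    using no N(2) scott_sentence_models_iff[OF \<phi> M N(1)] unfolding has_model_of_card_def by blast
qed

text \<open>A tuple of distinct elements longer than \<open>card (univ M)\<close> would be answered
  in \<open>M\<close> by distinct elements. This makes the countable parts infinite, as their
  colorings require.\<close>

lemma bf_equiv_infinite:
  assumes "bf_equiv L M N" "infinite (univ N)"
  shows "infinite (univ M)"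
proof
  assume fin: "finite (univ M)"
  obtain S where S: "bf_system L M N S" using assms(1) unfolding bf_equiv_def by blast
  obtain V where V: "V \<subseteq> univ N" "finite V" "card V = Suc (card (univ M))"
    using infinite_arbitrarily_large[OF assms(2)] by blast
  obtain vs where vs: "set vs = V" "distinct vs" using finite_distinct_list[OF V(2)] by blast
  obtain us where us: "length us = length vs" "set us \<subseteq> univ M" "(us, vs) \<in> S"
    using bf_system_back_list[OF S bf_system_nil[OF S], of vs] vs(1) V(1) by auto
  have "distinct us"
    using vs(2) same_atoms_eqD[OF bf_systemD(4)[OF S us(3)]] us(1) by (simp add: distinct_conv_nth)
  then have "length us \<le> card (univ M)" using us(2) fin card_mono distinct_card by metis
  moreover have "length us = Suc (card (univ M))" using us(1) vs V(3) distinct_card by metis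
  ultimately show False by simp
qed

lemma ordLeq_Func:
  assumes "B \<noteq> {}"
  shows "|A| \<le>o |Func B A|"
proof (rule card_of_ordLeqI)
  obtain b where "b \<in> B" using assms by blast
  then show "inj_on (\<lambda>a x. if x \<in> B then a else undefined) A" by (auto simp: inj_on_def fun_eq_iff)
qed (auto simp: Func_def)

lemma Func_ordLeq_cexp:
  assumes "|A| \<le>o \<kappa>" "|B| \<le>o \<mu>" "B \<noteq> {}"
  shows "|Func B A| \<le>o \<kappa> ^c \<mu>"
proof -
  have "|A| ^c |B| \<le>o \<kappa> ^c \<mu>"
    by (rule cexp_mono'[OF assms(1,2)]) (use assms(3) in \<open>simp add: Field_card_of\<close>)
  then show ?thesis unfolding cexp_def[of "|A|" "|B|"] Field_card_of .
qed

lemma infinite_ordIso_Cinfinite: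
  assumes "|X| =o r" "Cinfinite r"
  shows "infinite X"
  using Cinfinite_cong[OF ordIso_symmetric[OF assms(1)] assms(2)] by (simp add: cinfinite_def Field_card_of)

lemma is_struct_comb: "is_struct LA A \<Longrightarrow> is_struct rel_lang (comb LA A LB B F d c)"
  unfolding is_struct_def rel_lang_def by auto

lemma comb_ordLeq:
  assumes "Cinfinite r" "|univ A| \<le>o r" "|univ B| \<le>o r" "|F| \<le>o r"
  shows "|univ (comb LA A LB B F d c)| \<le>o r"
  unfolding comb_simps by (intro Un_ordLeq_Cinfinite image_ordLeq assms)

theorem cexp_completely_characterizable:
  fixes \<kappa> :: "'k rel" and \<mu> :: "'l rel" and N :: "'n struct"
  assumes \<kappa>: "completely_characterizable \<kappa>" and \<mu>: "Cinfinite \<mu>"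
    and LB: "is_struct LB MB" "scott_sentence LB MB \<phi>B" "\<not> has_model_of_card LB \<phi>B (cardSuc \<mu>)"
    and N: "is_struct LB N" "models N \<phi>B" "\<mu> \<le>o |univ N|"
  shows "completely_characterizable (\<kappa> ^c \<mu>)"
proof -
  obtain LA MA \<phi>A where cK: "Cinfinite \<kappa>" and LA: "is_struct LA MA" "scott_sentence LA MA \<phi>A"
      "\<not> has_model_of_card LA \<phi>A (cardSuc \<kappa>)" and "has_model_of_card LA \<phi>A \<kappa>"
    using \<kappa> unfolding completely_characterizable_def by blast
  then obtain NA :: "'k struct" where NA: "is_struct LA NA" "models NA \<phi>A" "|univ NA| =o \<kappa>"
    unfolding has_model_of_card_def by blast
  have bfA: "bf_equiv LA MA NA" using scott_sentence_models_iff[OF LA(2,1) NA(1)] NA(2) by blast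
  \<comment> \<open>\<open>N\<close> may exceed \<open>\<mu>\<close> and live on another type; it is
    shrunk to a model of size exactly \<open>\<mu>\<close>.\<close>
  have "is_sentence LB \<phi>B" using LB(2) unfolding scott_sentence_def by blast
  from lowenheim_skolem_exact[OF N(1) this \<mu> N(3)] obtain NB :: "'l struct" where
    NB: "is_struct LB NB" "|univ NB| =o \<mu>" "models NB \<phi>B" using N(2) by blast
  have bfB: "bf_equiv LB MB NB" using scott_sentence_models_iff[OF LB(2,1) NB(1)] NB(3) by blast
  let ?r = "\<kappa> ^c \<mu>"
  have two: "ctwo \<le>o \<kappa>" using cK by (rule ctwo_ordLeq_Cinfinite)
  have r: "Cinfinite ?r" by (rule Cinfinite_cexp[OF two \<mu>])
  have \<kappa>r: "\<kappa> \<le>o ?r" using ordLeq_cexp1[OF Cinfinite_Cnotzero[OF \<mu>]] cK by blast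
  have \<mu>r: "\<mu> \<le>o ?r" using ordLeq_cexp2[OF two] \<mu> by blast
  have infNB: "infinite (univ NB)" by (rule infinite_ordIso_Cinfinite[OF NB(2) \<mu>])
  have infA: "infinite (univ MA)"
    by (rule bf_equiv_infinite[OF bfA infinite_ordIso_Cinfinite[OF NA(3) cK]])
  have infB: "infinite (univ MB)" by (rule bf_equiv_infinite[OF bfB infNB])
  have neB: "univ MB \<noteq> {}" using LB(1) unfolding is_struct_def by blast

  \<comment> \<open>For the countable structure, infinitely many codes are enough, and already the
    constant functions provide them.\<close>
  have nat: "|UNIV :: nat set| \<le>o |Func (univ MB) (univ MA)|"
    using infA ordLeq_transitive[OF _ ordLeq_Func[OF neB]] by (simp add: infinite_iff_card_of_nat)
  obtain F0 :: "(nat, (nat, nat) info) gen set" and d0 c0 where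
    F0: "|F0| =o |UNIV :: nat set|" "colored (univ MA) (univ MB) F0 d0 c0" "generic (univ MA) (univ MB) F0 d0 c0"
    using exists_generic_coloring[OF Cinfinite_nat infB card_of_mono1[OF subset_UNIV]
        card_of_mono1[OF subset_UNIV] card_of_refl[of "UNIV :: nat set"] nat] by blast
  define MC where "MC = comb LA MA LB MB F0 d0 c0"
  have MC: "is_struct rel_lang MC" unfolding MC_def by (rule is_struct_comb[OF LA(1)])
  have "|univ MC| \<le>o |UNIV :: nat set|" unfolding MC_def
    by (rule comb_ordLeq[OF Cinfinite_nat card_of_mono1[OF subset_UNIV] card_of_mono1[OF subset_UNIV]
          ordIso_imp_ordLeq[OF F0(1)]])
  then obtain h :: "_ \<Rightarrow> nat" where "inj_on h (univ MC)" by (auto simp: card_of_ordLeq[symmetric])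
  from isomorphic_copy[OF MC this] obtain K :: "nat struct" where
    K: "is_struct rel_lang K" "isomorphic rel_lang MC K" by blast
  have bfMK: "bf_equiv rel_lang MC K" by (rule isomorphic_bf_equiv[OF K(2) MC])
  let ?\<sigma> = "scott_fm rel_lang K"

  have big: "?r \<le>o |Func (univ NB) (univ NA)|"
  proof -
    have "\<kappa> ^c \<mu> \<le>o |univ NA| ^c |univ NB|"
      by (rule cexp_mono'[OF ordIso_imp_ordLeq[OF ordIso_symmetric[OF NA(3)]]
            ordIso_imp_ordLeq[OF ordIso_symmetric[OF NB(2)]]])
        (use \<mu> in \<open>simp add: cinfinite_def\<close>)
    then show ?thesis unfolding cexp_def[of "|univ NA|" "|univ NB|"] Field_card_of .
  qed
  have Ar: "|univ NA| \<le>o ?r" by (rule ordIso_ordLeq_trans[OF NA(3) \<kappa>r])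
  have Br: "|univ NB| \<le>o ?r" by (rule ordIso_ordLeq_trans[OF NB(2) \<mu>r])
  \<comment> \<open>This set, whose cardinality is the power by definition, indexes the base points
    of the large coloring.\<close>
  have Qr: "|Func (Field \<mu>) (Field \<kappa>)| =o ?r" unfolding cexp_def by (rule card_of_refl)
  obtain F1 :: "('l \<Rightarrow> 'k, ('l, 'k) info) gen set" and d1 c1 where
    F1: "|F1| =o ?r" "colored (univ NA) (univ NB) F1 d1 c1" "generic (univ NA) (univ NB) F1 d1 c1"
    using exists_generic_coloring[OF r infNB Ar Br Qr big] by blast
  define NC where "NC = comb LA NA LB NB F1 d1 c1"
  have NC: "is_struct rel_lang NC" unfolding NC_def by (rule is_struct_comb[OF NA(1)])
  have "bf_equiv rel_lang MC NC" unfolding MC_def NC_def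
    by (rule comb_bf_equiv[OF bfA bfB F0(2,3) F1(2,3)])
  then have "bf_equiv rel_lang K NC" by (rule bf_equiv_trans[OF bf_equiv_sym[OF bfMK]])
  then have NC\<sigma>: "models NC ?\<sigma>" unfolding models_scott_fm_iff[OF K(1) NC] .
  have NC_le: "|univ NC| \<le>o ?r" unfolding NC_def
    by (rule comb_ordLeq[OF r Ar Br ordIso_imp_ordLeq[OF F1(1)]])
  have "|F1| \<le>o |univ NC|"
    by (rule card_of_ordLeqI[of InF]) (auto simp: inj_on_def NC_def)
  from ordIso_ordLeq_trans[OF ordIso_symmetric[OF F1(1)] this] have NCr: "|univ NC| =o ?r"
    using NC_le by (simp add: ordIso_iff_ordLeq)
  \<comment> \<open>The cardinal \<open>\<kappa> ^c \<mu>\<close> is a relation on functions, so the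
    model must be copied to that type.\<close>
  obtain g :: "_ \<Rightarrow> 'l \<Rightarrow> 'k" where g: "inj_on g (univ NC)"
    using NC_le unfolding cexp_def by (auto simp: card_of_ordLeq[symmetric])
  from isomorphic_copy[OF NC g] obtain NC' :: "('l \<Rightarrow> 'k) struct" where
    NC': "univ NC' = g ` univ NC" "is_struct rel_lang NC'" "isomorphic rel_lang NC NC'" by blast
  have "|univ NC'| =o |univ NC|"
    unfolding NC'(1) by (rule ordIso_symmetric) (use g in \<open>auto simp: card_of_ordIso[symmetric] bij_betw_def\<close>)
  then have "has_model_of_card rel_lang ?\<sigma> ?r"
    unfolding has_model_of_card_def
    using NC'(2) ordIso_transitive[OF _ NCr] NC\<sigma>
      isomorphic_models[OF NC'(3) NC NC'(2) is_sentence_scott_fm[of rel_lang K]] by blast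
  moreover have "\<not> has_model_of_card rel_lang ?\<sigma> (cardSuc ?r)"
  proof
    assume "has_model_of_card rel_lang ?\<sigma> (cardSuc ?r)"
    then obtain J :: "('l \<Rightarrow> 'k) set struct" where
      J: "is_struct rel_lang J" "models J ?\<sigma>" "|univ J| =o cardSuc ?r"
      unfolding has_model_of_card_def by blast
    have "bf_equiv rel_lang K J" using J(2) unfolding models_scott_fm_iff[OF K(1) J(1)] .
    from bf_equiv_trans[OF bfMK this] have "bf_equiv rel_lang (comb LA MA LB MB F0 d0 c0) J"
      unfolding MC_def .
    from comb_bf_parts[OF this LA(1) LB(1) F0(2)] obtain A' B' :: "('l \<Rightarrow> 'k) set struct" and F' d' c' where
      J': "univ J = univ A' \<union> univ B' \<union> F'" and A': "is_struct LA A'" "bf_equiv LA MA A'"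
      and B': "is_struct LB B'" "bf_equiv LB MB B'" and F': "colored (univ A') (univ B') F' d' c'" by blast
    have A\<kappa>: "|univ A'| \<le>o \<kappa>" by (rule model_card_bound[OF LA(1,2) cK LA(3) A'])
    have B\<mu>: "|univ B'| \<le>o \<mu>" by (rule model_card_bound[OF LB(1,2) \<mu> LB(3) B'])
    have ne: "univ A' \<noteq> {}" "univ B' \<noteq> {}" using A'(1) B'(1) unfolding is_struct_def by blast+
    \<comment> \<open>The orders of branches number at most 2^(mu * mu), which is at most kappa^mu
      since 2 is below kappa and mu * mu equals mu.\<close>
    have "|Pow (univ B' \<times> univ B')| =o |Func (univ B' \<times> univ B') (UNIV :: bool set)|" by (rule card_of_Pow_Func)
    moreover have "|Func (univ B' \<times> univ B') (UNIV :: bool set)| \<le>o ?r"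
      by (rule Func_ordLeq_cexp[OF two[unfolded ctwo_def] Times_ordLeq_Cinfinite[OF \<mu> B\<mu> B\<mu>]]) (use ne in simp)
    ultimately have "|Pow (univ B' \<times> univ B')| \<le>o ?r" by (rule ordIso_ordLeq_trans)
    then have "|Pow (univ B' \<times> univ B') \<times> Func (univ B') (univ A')| \<le>o ?r"
      by (rule Times_ordLeq_Cinfinite[OF r _ Func_ordLeq_cexp[OF A\<kappa> B\<mu> ne(2)]])
    from ordLeq_transitive[OF colored_ordLeq[OF F' ne(1)] this] have "|F'| \<le>o ?r" .
    then have "|univ J| \<le>o ?r" unfolding J'
      by (intro Un_ordLeq_Cinfinite r ordLeq_transitive[OF A\<kappa> \<kappa>r] ordLeq_transitive[OF B\<mu> \<mu>r])
    from ordIso_ordLeq_trans[OF ordIso_symmetric[OF J(3)] this] have "cardSuc ?r \<le>o ?r" .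
    moreover have "?r <o cardSuc ?r" using cardSuc_greater r by blast
    ultimately show False using not_ordLess_ordLeq by blast
  qed
  ultimately show ?thesis
    unfolding completely_characterizable_def using r K(1) scott_sentence_scott_fm[OF K(1)] by blast
qed

theorem theorem5p4:
  fixes \<kappa> :: "'k rel" and lam :: "'l rel"
  assumes "Cinfinite \<kappa>" and "Cinfinite lam"
    and "ctwo ^c lam <o \<kappa>"
    and "completely_characterizable \<kappa>"
    and "characterizable_by_dlo TYPE('n) lam"
    and "least_exponent_exceeding lam \<kappa>"
  shows "completely_characterizable (\<kappa> ^c lam)"
proof -
  obtain L p M \<phi> and N :: "'n struct" where M: "is_struct L M" "scott_sentence L M \<phi>"
    "\<not> has_model_of_card L \<phi> (cardSuc lam)" and N: "is_struct L N" "models N \<phi>"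
    and card: "|Field (sym_rel N p)| =o lam"
    using assms(5) unfolding characterizable_by_dlo_def by blast
  \<comment> \<open>The ordered set shows that \<open>N\<close> has at least \<open>lam\<close>
    elements, while the bound on models comes from the missing model of size
    \<open>cardSuc lam\<close>.\<close>
  have "Field (sym_rel N p) \<subseteq> univ N" unfolding sym_rel_def Field_def by auto
  from ordIso_ordLeq_trans[OF ordIso_symmetric[OF card] card_of_mono1[OF this]]
  show ?thesis by (rule cexp_completely_characterizable[OF assms(4,2) M N])
qed

end
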